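(* Let $M>0$, $\gamma=2$, $p(\rho)=\rho^{2}$, and let $\mathfrak{R}\ge R_M$. If $|\beta|$ is sufficiently small (i.e. there exists $\beta_0>0$ such that for every constant $\beta\in\mathbb{R}$ with $|\beta|<\beta_0$), the following three statements hold. (1) $\displaystyle\inf_{\rho\in W_M^{\ast}}F(\rho)<0$, and there are positive constants $C_1,C_2$ independent of $\rho$ such that $$F(\rho)\ge C_1\int_{\mathbb{R}^3}\rho(x)^{2}\,dx-C_2\qquad\text{for all }\rho\in W_M^{\ast}.$$ (2) If $\{\rho^i\}\subset W_M^{\ast}$ is a minimizing sequence for the functional $F$ (on $W_M^{\ast}$), then there exist a sequence of vertical shifts $a_i\mathbf{e}_3$ ($a_i\in\mathbb{R}$, $\mathbf{e}_3=(0,0,1)$), a subsequence of $\{\rho^i\}$ (still labeled $\{\rho^i\}$), and a function $\tilde\rho\in W_M^{\ast}$ such that for any $\epsilon>0$ there exists $R>0$ with $$\int_{a_i\mathbf{e}_3+B_R(0)}\rho^i(x)\,dx\ge M-\epsilon,\qquad i\in\mathbb{N},$$ and $$T\rho^i(x):=\rho^i(x+a_i\mathbf{e}_3)\rightharpoonup\tilde\rho\quad\text{weakly in }L^{2}(\mathbb{R}^3)\text{ as }i\to\infty.$$ (3) The function $\tilde\rho$ in (2) is a minimizer of $F$ in $W_M^{\ast}$.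
   Context: Write $x=(x_1,x_2,x_3)\in\mathbb{R}^3$, $r=\sqrt{x_1^2+x_2^2}$, $z=x_3$. A function is axisymmetric if it depends only on $(r,z)$. $B_R(0)$ is the ball of radius $R$ centered at $0$ in $\mathbb{R}^3$. Pressure and potentials: $p(\rho)=\rho^{\gamma}$ and $A(\rho)=\frac{p(\rho)}{\gamma-1}$ (here $\gamma=2$). Set $\mathfrak{G}(\rho)(x)=\int_{\mathbb{R}^3}\frac{\rho(y)}{|x-y|}\,dy$. The magnetic potential $\psi=\mathfrak{P}(\rho)$ of an axisymmetric density $\rho$ is the solution of $\operatorname{div}\left(\frac{1}{r^2}\nabla\psi\right)=-4\pi\beta\rho$ given by $\mathfrak{P}(\rho)(x)=-4\pi\beta\int_{\mathbb{R}^3}G(x,y)\rho(y)\,dy$, where $G$ is the Green's function, $\operatorname{div}\left(\frac1{r^2}\nabla G(x,y)\right)=\delta(x-y)$. Explicitly, $\mathfrak{P}(\rho)(x)=r^2\chi_e(x_1,x_2,x_3,0,0)$, where, writing $\rho(x)=f(r,x_3)$ and, for $x\in\mathbb{R}^5$, $\rho_e(x)=f\left(\sqrt{x_1^2+x_2^2+x_4^2+x_5^2},\,x_3\right)$, $$\chi_e(x)=\int_{\mathbb{R}^5}G_5(x-y)\,(-4\pi\beta)\,\rho_e(y)\,dy,\qquad G_5(x)=-\frac{1}{15\,\omega_5}|x|^{-3},$$ with $\omega_5$ the volume of the unit ball of $\mathbb{R}^5$ (so $\Delta_5\chi_e=-4\pi\beta\rho_e$). Energy functional: $\displaystyle F(\rho)=\int_{\mathbb{R}^3}\left(A(\rho)-\tfrac12\rho\,\mathfrak{G}(\rho)-\tfrac12\beta\rho\,\mathfrak{P}(\rho)\right)dx.$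 Radius $R_M$: let $X_M$ be the set of $\rho:\mathbb{R}^3\to\mathbb{R}$ with $\rho\ge0$ a.e., $\int\rho\,dx=M$ and $\int_{\mathbb{R}^3}[A(\rho)+\frac12\rho\,\mathfrak{G}(\rho)]\,dx<\infty$, and let $\tilde F(\rho)=\int_{\mathbb{R}^3}[A(\rho)-\frac12\rho\,\mathfrak{G}(\rho)]\,dx$. For $\gamma>4/3$ it is known that $\tilde F$ has a minimizer $\hat\rho$ in $X_M$ (the non-rotating non-magnetic star solution), which is radial (about the origin), unique, and compactly supported: there is a unique $R_M>0$ with $\hat\rho(x)>0$ for $|x|<R_M$ and $\hat\rho(x)=0$ for $|x|\ge R_M$. Function classes: $W_M$ is the set of axisymmetric $\rho:\mathbb{R}^3\to\mathbb{R}$ with $\rho\ge 0$ a.e., $\rho\in L^1(\mathbb{R}^3)\cap L^{\gamma}(\mathbb{R}^3)$, $\int_{\mathbb{R}^3}\rho\,dx=M$. For a fixed constant $\mathfrak{R}\ge R_M$, $W_M^{\ast}=\{\rho\in W_M:\ \rho(r,z)=0\text{ for }r\ge\mathfrak{R}\}$. *)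

theory Defs
  imports "HOL-Analysis.Analysis"
begin

text \<open>All integrals are Bochner integrals over Lebesgue measure on \<open>real ^ 3\<close> or \<open>real ^ 5\<close>;
  the elements of the function classes below are genuine functions, not equivalence classes.\<close>

definition cyl_r :: "real ^ 3 \<Rightarrow> real" where
  "cyl_r x = sqrt ((x $ 1)\<^sup>2 + (x $ 2)\<^sup>2)"

definition e3 :: "real ^ 3" where
  "e3 = axis 3 1"

definition axisymmetric :: "(real ^ 3 \<Rightarrow> real) \<Rightarrow> bool" where
  "axisymmetric \<rho> \<longleftrightarrow> (\<exists>f. \<forall>x. \<rho> x = f (cyl_r x) (x $ 3))"

definition radial :: "(real ^ 3 \<Rightarrow> real) \<Rightarrow> bool" where
  "radial \<rho> \<longleftrightarrow> (\<exists>f. \<forall>x. \<rho> x = f (norm x))"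

definition in_Lp :: "real \<Rightarrow> (real ^ 3 \<Rightarrow> real) \<Rightarrow> bool" where
  "in_Lp p f \<longleftrightarrow>
     f \<in> borel_measurable lebesgue \<and> integrable lebesgue (\<lambda>x. \<bar>f x\<bar> powr p)"

text \<open>Weak convergence in \<open>L\<^sup>2\<close>, with the dual space identified with \<open>L\<^sup>2\<close> itself.\<close>

definition weakly_L2 :: "(nat \<Rightarrow> real ^ 3 \<Rightarrow> real) \<Rightarrow> (real ^ 3 \<Rightarrow> real) \<Rightarrow> bool" where
  "weakly_L2 u v \<longleftrightarrow>
     (\<forall>i. in_Lp 2 (u i)) \<and> in_Lp 2 v \<and>
     (\<forall>g. in_Lp 2 g \<longrightarrow>
        (\<lambda>i. LINT x|lebesgue. u i x * g x) \<longlonglongrightarrow> (LINT x|lebesgue. v x * g x))"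

text \<open>Densities are nonnegative almost everywhere, so only the values at \<open>s \<ge> 0\<close> matter.\<close>

definition pressure :: "real \<Rightarrow> real \<Rightarrow> real" where
  "pressure \<gamma> s = s powr \<gamma>"

definition internal_energy :: "real \<Rightarrow> real \<Rightarrow> real" where
  "internal_energy \<gamma> s = pressure \<gamma> s / (\<gamma> - 1)"

text \<open>For integrable \<open>\<rho>\<close> the integrand is integrable for almost every \<open>x\<close>; on the
  exceptional null set the Bochner integral takes its default value \<open>0\<close>.\<close>

definition grav_potential :: "(real ^ 3 \<Rightarrow> real) \<Rightarrow> real ^ 3 \<Rightarrow> real" where
  "grav_potential \<rho> x = (LINT y|lebesgue. \<rho> y / norm (x - y))"

text \<open>For axisymmetric \<open>\<rho>\<close> with \<open>\<rho> x = f (cyl_r x) (x $ 3)\<close>, the value \<open>f s z\<close> for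
  \<open>s \<ge> 0\<close> is recovered as \<open>\<rho> (vector [s, 0, z])\<close>.\<close>

definition lift5 :: "(real ^ 3 \<Rightarrow> real) \<Rightarrow> real ^ 5 \<Rightarrow> real" where
  "lift5 \<rho> x =
     \<rho> (vector [sqrt ((x $ 1)\<^sup>2 + (x $ 2)\<^sup>2 + (x $ 4)\<^sup>2 + (x $ 5)\<^sup>2), 0, x $ 3])"

text \<open>Fundamental solution of the Laplacian on \<open>real ^ 5\<close>.\<close>

definition G5 :: "real ^ 5 \<Rightarrow> real" where
  "G5 x = - (1 / (15 * measure lebesgue (ball (0 :: real ^ 5) 1))) * (1 / norm x ^ 3)"

definition chi_e :: "real \<Rightarrow> (real ^ 3 \<Rightarrow> real) \<Rightarrow> real ^ 5 \<Rightarrow> real" where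
  "chi_e \<beta> \<rho> x = (LINT y|lebesgue. G5 (x - y) * (- 4 * pi * \<beta>) * lift5 \<rho> y)"

text \<open>The solution \<open>\<psi> = r\<^sup>2 \<chi>\<close> of \<open>div (r\<^sup>-\<^sup>2 \<nabla>\<psi>) = - 4 \<pi> \<beta> \<rho>\<close>, where the
  five-dimensional lift of \<open>\<chi>\<close> is the Newtonian potential \<open>chi_e\<close>.\<close>

definition mag_potential :: "real \<Rightarrow> (real ^ 3 \<Rightarrow> real) \<Rightarrow> real ^ 3 \<Rightarrow> real" where
  "mag_potential \<beta> \<rho> x = (cyl_r x)\<^sup>2 * chi_e \<beta> \<rho> (vector [x $ 1, x $ 2, x $ 3, 0, 0])"

definition energy :: "real \<Rightarrow> real \<Rightarrow> (real ^ 3 \<Rightarrow> real) \<Rightarrow> real" where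
  "energy \<gamma> \<beta> \<rho> =
     (LINT x|lebesgue. internal_energy \<gamma> (\<rho> x)
        - 1/2 * \<rho> x * grav_potential \<rho> x
        - 1/2 * \<beta> * \<rho> x * mag_potential \<beta> \<rho> x)"

definition W :: "real \<Rightarrow> real \<Rightarrow> (real ^ 3 \<Rightarrow> real) set" where
  "W \<gamma> M = {\<rho>. axisymmetric \<rho> \<and> (AE x in lebesgue. \<rho> x \<ge> 0) \<and>
              integrable lebesgue \<rho> \<and> in_Lp \<gamma> \<rho> \<and> (LINT x|lebesgue. \<rho> x) = M}"

definition W_star :: "real \<Rightarrow> real \<Rightarrow> real \<Rightarrow> (real ^ 3 \<Rightarrow> real) set" where
  "W_star \<gamma> M \<RR> = {\<rho> \<in> W \<gamma> M. \<forall>x. cyl_r x \<ge> \<RR> \<longrightarrow> \<rho> x = 0}"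

definition X :: "real \<Rightarrow> real \<Rightarrow> (real ^ 3 \<Rightarrow> real) set" where
  "X \<gamma> M = {\<rho>. (AE x in lebesgue. \<rho> x \<ge> 0) \<and>
              integrable lebesgue \<rho> \<and> (LINT x|lebesgue. \<rho> x) = M \<and>
              integrable lebesgue
                (\<lambda>x. internal_energy \<gamma> (\<rho> x) + 1/2 * \<rho> x * grav_potential \<rho> x)}"

definition nonmag_energy :: "real \<Rightarrow> (real ^ 3 \<Rightarrow> real) \<Rightarrow> real" where
  "nonmag_energy \<gamma> \<rho> =
     (LINT x|lebesgue. internal_energy \<gamma> (\<rho> x) - 1/2 * \<rho> x * grav_potential \<rho> x)"

definition minimizer_on ::
  "((real ^ 3 \<Rightarrow> real) \<Rightarrow> real) \<Rightarrow> (real ^ 3 \<Rightarrow> real) set \<Rightarrow> (real ^ 3 \<Rightarrow> real) \<Rightarrow> bool" where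
  "minimizer_on E S \<rho> \<longleftrightarrow> \<rho> \<in> S \<and> (\<forall>\<sigma>\<in>S. E \<rho> \<le> E \<sigma>)"

text \<open>\<open>R\<^sub>M\<close> is the radius of the non-rotating non-magnetic star of mass \<open>M\<close>. The
  functional is translation invariant; centring the minimizer at the origin selects the
  representative.\<close>

definition star_radius :: "real \<Rightarrow> real \<Rightarrow> real \<Rightarrow> bool" where
  "star_radius \<gamma> M R\<^sub>M \<longleftrightarrow> R\<^sub>M > 0 \<and>
     (\<exists>\<rho>. minimizer_on (nonmag_energy \<gamma>) (X \<gamma> M) \<rho> \<and> radial \<rho> \<and>
          (\<forall>x. norm x < R\<^sub>M \<longrightarrow> \<rho> x > 0) \<and> (\<forall>x. norm x \<ge> R\<^sub>M \<longrightarrow> \<rho> x = 0))"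

text \<open>The infimum is taken in the extended reals, so that it is meaningful without knowing
  beforehand that the set is nonempty and the functional bounded below on it.\<close>

definition inf_on ::
  "((real ^ 3 \<Rightarrow> real) \<Rightarrow> real) \<Rightarrow> (real ^ 3 \<Rightarrow> real) set \<Rightarrow> ereal" where
  "inf_on E S = (INF \<rho>\<in>S. ereal (E \<rho>))"

definition minimizing_sequence ::
  "((real ^ 3 \<Rightarrow> real) \<Rightarrow> real) \<Rightarrow> (real ^ 3 \<Rightarrow> real) set \<Rightarrow> (nat \<Rightarrow> real ^ 3 \<Rightarrow> real) \<Rightarrow> bool" where
  "minimizing_sequence E S u \<longleftrightarrow>
     (\<forall>i. u i \<in> S) \<and> (\<lambda>i. ereal (E (u i))) \<longlonglongrightarrow> inf_on E S"

text \<open>Here \<open>u\<close> is the already extracted subsequence and \<open>a\<close> its sequence of vertical shifts.\<close>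

definition tight_weak_limit ::
  "real \<Rightarrow> (nat \<Rightarrow> real ^ 3 \<Rightarrow> real) \<Rightarrow> (nat \<Rightarrow> real) \<Rightarrow> (real ^ 3 \<Rightarrow> real) \<Rightarrow> bool" where
  "tight_weak_limit M u a v \<longleftrightarrow>
     (\<forall>\<epsilon>>0. \<exists>R>0. \<forall>i. (LINT x:ball (a i *\<^sub>R e3) R|lebesgue. u i x) \<ge> M - \<epsilon>) \<and>
     weakly_L2 (\<lambda>i x. u i (x + a i *\<^sub>R e3)) v"

end

theory Submission
  imports Defs "HOL-Library.Diagonal_Subsequence"
begin

text \<open>
  For \<open>\<gamma> = 2\<close> the functional is a quadratic form: \<open>F \<rho> = \<integral> \<rho>\<^sup>2 - Q \<rho> \<rho>\<close>, where \<open>Q\<close> has a positive symmetric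
  kernel, invariant under vertical translations, whose singularity is locally square integrable and
  which decays in the vertical direction on a cylinder of bounded radius. The magnetic part of the
  kernel is obtained by averaging \<open>1 / |x - y| ^ 3\<close> over the orbits of the rotations of \<open>real ^ 5\<close>.

  The square integrability bounds the potential of \<open>\<rho>\<close> by the mass and the \<open>L\<^sup>2\<close> norm, which gives the
  coercivity. Homogeneity turns the infimum into \<open>I (m / M)\<^sup>2\<close> as a function of the mass \<open>m\<close>, with \<open>I < 0\<close>, so
  splitting the mass costs a definite amount: if two parts of mass \<open>p\<close> and \<open>q\<close> are separated by a thick
  layer of small mass (which exists by pigeonhole), then the energy exceeds the infimum by nearly
  \<open>2 |I| p q / M\<^sup>2\<close>. Hence a minimizing sequence has uniformly small tails above and below its median
  height. Along tight sequences the potentials converge pointwise and boundedly, so \<open>Q\<close> is weakly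
  continuous, and weak limits are minimizers.
\<close>

section \<open>Lebesgue measure in cylindrical coordinates\<close>

text \<open>The densities are genuine Lebesgue measurable functions, and \<open>lift5\<close> reads
  them only on a half-plane, which is a null set of \<open>real ^ 3\<close>; a Borel representative
  chosen almost everywhere says nothing about the values there. The way out is a Borel function of
  \<open>(r, z)\<close>, obtained by averaging over orbits, that represents both the density and its
  lift almost everywhere. The same averaging makes a weak limit axisymmetric, which a priori is
  invariant only up to null sets depending on the rotation.

  The magnetic kernel carries the factor \<open>\<beta>\<^sup>2\<close>, so it is attractive for
  either sign of \<beta> and only lowers the energy. Hence the infimum is negative as soon as the
  non-magnetic star has negative energy, which follows by comparing it with a uniform ball; the star
  belongs to \<open>W_star\<close> because its radius does not exceed that of the cylinder.

  Weak limits are built from masses of sets: a subsequence converges on every Borel set, the limit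
  is a measure by equi-integrability, and its Radon-Nikodym density is the weak limit. Tightness
  prevents mass from being lost.\<close>

lemma exhaust_5:
  fixes x :: 5
  shows "x = 1 \<or> x = 2 \<or> x = 3 \<or> x = 4 \<or> x = 5"
proof (induct x)
  case (of_int z)
  then have "z = 0 \<or> z = 1 \<or> z = 2 \<or> z = 3 \<or> z = 4" by fastforce
  then show ?case by auto
qed

lemma UNIV_5: "UNIV = {1, 2, 3, 4, 5::5}"
  using exhaust_5 by auto

lemma vector_5 [simp]:
  "(vector [a,b,c,d,e] :: 'a::zero^5) $ 1 = a"
  "(vector [a,b,c,d,e] :: 'a::zero^5) $ 2 = b"
  "(vector [a,b,c,d,e] :: 'a::zero^5) $ 3 = c"
  "(vector [a,b,c,d,e] :: 'a::zero^5) $ 4 = d"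
  "(vector [a,b,c,d,e] :: 'a::zero^5) $ 5 = e"
  unfolding vector_def by simp_all

lemma borel_measurable_vec_nth [measurable (raw)]:
  fixes f :: "'a \<Rightarrow> real ^ 'n"
  assumes "f \<in> borel_measurable M"
  shows "(\<lambda>x. f x $ i) \<in> borel_measurable M"
  by (rule borel_measurable_continuous_on[OF _ assms, of "\<lambda>v. v $ i"])
     (auto intro!: continuous_intros)

lemma borel_measurable_vecI:
  fixes f :: "'a \<Rightarrow> real ^ 'n"
  assumes "\<And>i. (\<lambda>x. f x $ i) \<in> borel_measurable M"
  shows "f \<in> borel_measurable M"
  by (subst borel_measurable_euclidean_space)
     (auto simp: Basis_vec_def inner_axis assms)

lemma borel_measurable_vector_2 [measurable (raw)]:
  assumes [measurable]: "f \<in> borel_measurable M" "g \<in> borel_measurable M"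
  shows "(\<lambda>x. vector [f x, g x] :: real ^ 2) \<in> borel_measurable M"
proof (rule borel_measurable_vecI)
  fix i :: 2 show "(\<lambda>x. (vector [f x, g x] :: real ^ 2) $ i) \<in> borel_measurable M"
    using exhaust_2[of i] by (auto simp: assms)
qed

lemma borel_measurable_vector_3 [measurable (raw)]:
  assumes [measurable]: "f \<in> borel_measurable M" "g \<in> borel_measurable M" "h \<in> borel_measurable M"
  shows "(\<lambda>x. vector [f x, g x, h x] :: real ^ 3) \<in> borel_measurable M"
proof (rule borel_measurable_vecI)
  fix i :: 3 show "(\<lambda>x. (vector [f x, g x, h x] :: real ^ 3) $ i) \<in> borel_measurable M"
    using exhaust_3[of i] by (auto simp: assms)
qed

lemma borel_measurable_vector_5 [measurable (raw)]:
  assumes [measurable]: "f \<in> borel_measurable M" "g \<in> borel_measurable M" "h \<in> borel_measurable M"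
    "k \<in> borel_measurable M" "l \<in> borel_measurable M"
  shows "(\<lambda>x. vector [f x, g x, h x, k x, l x] :: real ^ 5) \<in> borel_measurable M"
proof (rule borel_measurable_vecI)
  fix i :: 5 show "(\<lambda>x. (vector [f x, g x, h x, k x, l x] :: real ^ 5) $ i) \<in> borel_measurable M"
    using exhaust_5[of i] by (auto simp: assms)
qed

lemma norm_vec2: "norm (a :: real ^ 2) = sqrt ((a $ 1)\<^sup>2 + (a $ 2)\<^sup>2)"
  by (simp add: norm_vec_def L2_set_def UNIV_2)

lemma prod_Basis_vec:
  fixes f :: "real ^ 'n \<Rightarrow> 'b::comm_monoid_mult"
  shows "prod f Basis = (\<Prod>i\<in>UNIV. f (axis i 1))"
proof -
  have "inj (\<lambda>i::'n. axis i (1::real))" by (auto intro!: injI simp: axis_eq_axis)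
  moreover have "Basis = range (\<lambda>i::'n. axis i (1::real))" by (auto simp: Basis_vec_def)
  ultimately show ?thesis using prod.reindex[of "\<lambda>i::'n. axis i (1::real)" UNIV f] by (metis (no_types, lifting) comp_apply prod.cong)
qed

lemma emeasure_box_vec2:
  assumes "a \<le> c" "b \<le> d"
  shows "emeasure lborel (box (vector [a, b] :: real ^ 2) (vector [c, d])) = ennreal ((c - a) * (d - b))"
proof -
  have "(vector [a, b] :: real ^ 2) \<bullet> x \<le> vector [c, d] \<bullet> x" if "x \<in> Basis" for x :: "real ^ 2"
  proof -
    have "\<exists>i::2. x = axis i 1" using that by (auto simp: Basis_vec_def)
    then obtain i :: 2 where "x = axis i 1" by blast
    then show ?thesis using assms exhaust_2[of i] by (auto simp: inner_axis)
  qed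
  then have "emeasure lborel (box (vector [a, b] :: real ^ 2) (vector [c, d]))
      = ennreal (\<Prod>x\<in>Basis. (vector [c, d] - vector [a, b] :: real ^ 2) \<bullet> x)"
    by simp
  also have "(\<Prod>x\<in>Basis. (vector [c, d] - vector [a, b] :: real ^ 2) \<bullet> x) = (c - a) * (d - b)"
    unfolding prod_Basis_vec by (simp add: UNIV_2 inner_axis)
  finally show ?thesis .
qed

definition emb3 :: "(real ^ 2) \<times> real \<Rightarrow> real ^ 3" where
  "emb3 p = vector [fst p $ 1, fst p $ 2, snd p]"

text \<open>The four directions orthogonal to the axis are split into two planes. The first contains
  the horizontal part of the points at which the magnetic potential is evaluated; the second is to
  be integrated out.\<close>

definition emb5 :: "((real ^ 2) \<times> real) \<times> (real ^ 2) \<Rightarrow> real ^ 5" where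
  "emb5 p = vector [fst (fst p) $ 1, fst (fst p) $ 2, snd (fst p), snd p $ 1, snd p $ 2]"

lemma emb3_measurable [measurable]: "emb3 \<in> borel \<rightarrow>\<^sub>M borel"
  unfolding emb3_def[abs_def] borel_prod[symmetric] by measurable

lemma emb5_measurable [measurable]: "emb5 \<in> borel \<rightarrow>\<^sub>M borel"
  unfolding emb5_def[abs_def] borel_prod[symmetric] by measurable

lemma lborel_emb3: "distr lborel borel emb3 = lborel"
proof (rule lborel_eqI[symmetric])
  fix l u :: "real ^ 3" assume le: "\<And>b. b \<in> Basis \<Longrightarrow> l \<bullet> b \<le> u \<bullet> b"
  have le: "l $ i \<le> u $ i" for i
    using le[of "axis i 1"] by (simp add: inner_axis)
  have eq: "emb3 -` box l u = box (vector [l $ 1, l $ 2]) (vector [u $ 1, u $ 2]) \<times> box (l $ 3) (u $ 3)"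
    by (auto simp: emb3_def mem_box_cart forall_3 forall_2)
  have "emeasure (distr lborel borel emb3) (box l u) = emeasure lborel (emb3 -` box l u)"
    by (subst emeasure_distr) auto
  also have "\<dots> = ennreal ((u $ 1 - l $ 1) * (u $ 2 - l $ 2) * (u $ 3 - l $ 3))"
    unfolding eq lborel_prod[symmetric] using le
    by (simp add: lborel.emeasure_pair_measure_Times emeasure_box_vec2 ennreal_mult)
  also have "(u $ 1 - l $ 1) * (u $ 2 - l $ 2) * (u $ 3 - l $ 3) = (\<Prod>b\<in>Basis. (u - l) \<bullet> b)"
    unfolding prod_Basis_vec UNIV_3 by (simp add: inner_axis mult.assoc)
  finally show "emeasure (distr lborel borel emb3) (box l u) = (\<Prod>b\<in>Basis. (u - l) \<bullet> b)" .
qed simp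

lemma lborel_emb5: "distr lborel borel emb5 = lborel"
proof (rule lborel_eqI[symmetric])
  fix l u :: "real ^ 5" assume le: "\<And>b. b \<in> Basis \<Longrightarrow> l \<bullet> b \<le> u \<bullet> b"
  have le: "l $ i \<le> u $ i" for i
    using le[of "axis i 1"] by (simp add: inner_axis)
  have f5: "(\<forall>i::5. P i) \<longleftrightarrow> P 1 \<and> P 2 \<and> P 3 \<and> P 4 \<and> P 5" for P
    by (metis exhaust_5)
  have eq: "emb5 -` box l u = (box (vector [l $ 1, l $ 2]) (vector [u $ 1, u $ 2]) \<times> box (l $ 3) (u $ 3))
     \<times> box (vector [l $ 4, l $ 5]) (vector [u $ 4, u $ 5])"
    by (auto simp: emb5_def mem_box_cart f5 forall_2)
  have "emeasure (distr lborel borel emb5) (box l u) = emeasure lborel (emb5 -` box l u)"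
    by (subst emeasure_distr) auto
  also have "\<dots> = ennreal ((u $ 1 - l $ 1) * (u $ 2 - l $ 2) * (u $ 3 - l $ 3) * ((u $ 4 - l $ 4) * (u $ 5 - l $ 5)))"
    unfolding eq lborel_prod[symmetric] using le
    by (simp add: lborel.emeasure_pair_measure_Times emeasure_box_vec2 ennreal_mult)
  also have "(u $ 1 - l $ 1) * (u $ 2 - l $ 2) * (u $ 3 - l $ 3) * ((u $ 4 - l $ 4) * (u $ 5 - l $ 5)) = (\<Prod>b\<in>Basis. (u - l) \<bullet> b)"
    unfolding prod_Basis_vec UNIV_5 by (simp add: inner_axis mult.assoc)
  finally show "emeasure (distr lborel borel emb5) (box l u) = (\<Prod>b\<in>Basis. (u - l) \<bullet> b)" .
qed simp

lemma nn_integral_emb3: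
  assumes [measurable]: "f \<in> borel_measurable borel"
  shows "(\<integral>\<^sup>+x. f x \<partial>lborel) = (\<integral>\<^sup>+a. \<integral>\<^sup>+t. f (emb3 (a, t)) \<partial>lborel \<partial>lborel)"
proof -
  have "(\<integral>\<^sup>+x. f x \<partial>lborel) = (\<integral>\<^sup>+x. f x \<partial>distr lborel borel emb3)" by (simp add: lborel_emb3)
  also have "\<dots> = (\<integral>\<^sup>+p. f (emb3 p) \<partial>(lborel \<Otimes>\<^sub>M lborel))"
    by (subst nn_integral_distr) (auto simp: lborel_prod)
  also have "\<dots> = (\<integral>\<^sup>+a. \<integral>\<^sup>+t. f (emb3 (a, t)) \<partial>lborel \<partial>lborel)"
    by (subst lborel.nn_integral_fst[symmetric]) (auto simp: lborel_prod)
  finally show ?thesis .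
qed

lemma nn_integral_emb5:
  assumes [measurable]: "f \<in> borel_measurable borel"
  shows "(\<integral>\<^sup>+x. f x \<partial>lborel) = (\<integral>\<^sup>+a. \<integral>\<^sup>+t. \<integral>\<^sup>+b. f (emb5 ((a, t), b)) \<partial>lborel \<partial>lborel \<partial>lborel)"
proof -
  have "(\<integral>\<^sup>+x. f x \<partial>lborel) = (\<integral>\<^sup>+x. f x \<partial>distr lborel borel emb5)" by (simp add: lborel_emb5)
  also have "\<dots> = (\<integral>\<^sup>+p. f (emb5 p) \<partial>((lborel \<Otimes>\<^sub>M lborel) \<Otimes>\<^sub>M lborel))"
    by (subst nn_integral_distr) (auto simp: lborel_prod)
  also have "\<dots> = (\<integral>\<^sup>+p. \<integral>\<^sup>+b. f (emb5 (p, b)) \<partial>lborel \<partial>(lborel \<Otimes>\<^sub>M lborel))"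
    by (subst lborel.nn_integral_fst[symmetric]) (auto simp: lborel_prod)
  also have "\<dots> = (\<integral>\<^sup>+a. \<integral>\<^sup>+t. \<integral>\<^sup>+b. f (emb5 ((a, t), b)) \<partial>lborel \<partial>lborel \<partial>lborel)"
    by (subst lborel.nn_integral_fst[symmetric]) (auto simp: lborel_prod)
  finally show ?thesis .
qed

section \<open>Planar integration: complex multiplication and squared radii\<close>

definition cmul :: "real ^ 2 \<Rightarrow> real ^ 2 \<Rightarrow> real ^ 2" where
  "cmul v w = vector [v $ 1 * w $ 1 - v $ 2 * w $ 2, v $ 1 * w $ 2 + v $ 2 * w $ 1]"

lemma cmul_measurable [measurable (raw)]:
  assumes [measurable]: "f \<in> borel_measurable M" "g \<in> borel_measurable M"
  shows "(\<lambda>x. cmul (f x) (g x)) \<in> borel_measurable M"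
  unfolding cmul_def[abs_def] by measurable

lemma cmul_commute: "cmul v w = cmul w v"
  by (simp add: cmul_def algebra_simps)

lemma linear_cmul: "linear (cmul v)"
  by (rule linearI) (auto simp: vec_eq_iff cmul_def forall_2 algebra_simps)

lemma norm_cmul: "norm (cmul v w) = norm v * norm w"
proof -
  have "(v $ 1 * w $ 1 - v $ 2 * w $ 2)\<^sup>2 + (v $ 1 * w $ 2 + v $ 2 * w $ 1)\<^sup>2
      = ((v $ 1)\<^sup>2 + (v $ 2)\<^sup>2) * ((w $ 1)\<^sup>2 + (w $ 2)\<^sup>2)"
    by (simp add: power2_eq_square algebra_simps)
  then show ?thesis by (simp add: norm_vec2 cmul_def real_sqrt_mult)
qed

lemma norm2_sq: "(norm (v::real^2))\<^sup>2 = (v $ 1)\<^sup>2 + (v $ 2)\<^sup>2"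
  by (simp add: norm_vec2)

text \<open>Multiplication by \<open>v\<close>, as a real 2x2 matrix, has determinant
  \<open>(norm v)\<^sup>2\<close>; it suffices to compare boxes with their preimages, since boxes
  determine Lebesgue measure.\<close>

lemma lborel_cmul:
  assumes "v \<noteq> 0"
  shows "lborel = density (distr lborel borel (cmul v)) (\<lambda>_. ennreal ((norm v)\<^sup>2))"
proof (rule lborel_eqI)
  fix l u :: "real ^ 2" assume le: "\<And>b. b \<in> Basis \<Longrightarrow> l \<bullet> b \<le> u \<bullet> b"
  have pos: "(norm v)\<^sup>2 > 0" using assms by simp
  \<comment> \<open>The complex inverse of \<open>v\<close>. It exhibits the preimage of a box as a
    linear image of the box, hence as a set of finite measure.\<close>
  define v' where "v' = (1 / (norm v)\<^sup>2) *\<^sub>R (vector [v $ 1, - v $ 2] :: real ^ 2)"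
  define n where "n = (norm v)\<^sup>2"
  have n: "n = v $ 1 * v $ 1 + v $ 2 * v $ 2" unfolding n_def norm2_sq by (simp add: power2_eq_square)
  have "n \<noteq> 0" using pos n_def by simp
  have inv1: "cmul v (cmul v' w) = w" for w
  proof -
    have v': "v' $ 1 = v $ 1 / n" "v' $ 2 = - v $ 2 / n" by (auto simp: v'_def n_def)
    have 1: "w $ 1 = (v $ 1 * (v $ 1 * w $ 1 + v $ 2 * w $ 2) - v $ 2 * (v $ 1 * w $ 2 - v $ 2 * w $ 1)) / n"
      using \<open>n \<noteq> 0\<close> by (subst eq_divide_eq) (simp add: n algebra_simps)
    have 2: "w $ 2 = (v $ 1 * (v $ 1 * w $ 2 - v $ 2 * w $ 1) + v $ 2 * (v $ 1 * w $ 1 + v $ 2 * w $ 2)) / n"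
      using \<open>n \<noteq> 0\<close> by (subst eq_divide_eq) (simp add: n algebra_simps)
    have "cmul v (cmul v' w) $ 1 = (v $ 1 * (v $ 1 * w $ 1 + v $ 2 * w $ 2) - v $ 2 * (v $ 1 * w $ 2 - v $ 2 * w $ 1)) / n"
      by (simp add: cmul_def v' algebra_simps diff_divide_distrib add_divide_distrib)
    moreover have "cmul v (cmul v' w) $ 2 = (v $ 1 * (v $ 1 * w $ 2 - v $ 2 * w $ 1) + v $ 2 * (v $ 1 * w $ 1 + v $ 2 * w $ 2)) / n"
      by (simp add: cmul_def v' algebra_simps diff_divide_distrib add_divide_distrib)
    ultimately show ?thesis using 1 2 unfolding vec_eq_iff forall_2 by argo
  qed
  have inj: "cmul v w = cmul v w' \<Longrightarrow> w = w'" for w w'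
  proof -
    assume "cmul v w = cmul v w'"
    then have "cmul v (w - w') = 0" using linear_cmul[of v] by (simp add: linear_diff)
    then have "norm v * norm (w - w') = 0" by (metis norm_cmul norm_zero)
    then show "w = w'" using assms by simp
  qed
  let ?B = "cmul v -` box l u"
  have "?B = cmul v' ` box l u"
  proof (intro equalityI subsetI)
    fix w assume "w \<in> ?B"
    moreover have "cmul v' (cmul v w) = w" by (rule inj) (rule inv1)
    ultimately show "w \<in> cmul v' ` box l u" by (metis image_eqI vimageD)
  qed (auto simp: inv1)
  moreover have "box l u \<in> lmeasurable" by simp
  ultimately have lm: "?B \<in> lmeasurable"
    using measurable_linear_image[OF linear_cmul] by metis
  have "cmul v ` ?B = box l u"
  proof (intro equalityI subsetI)
    fix w assume "w \<in> box l u"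
    then show "w \<in> cmul v ` ?B" by (intro image_eqI[of _ _ "cmul v' w"]) (auto simp: inv1)
  qed auto
  then have "measure lebesgue (box l u) = \<bar>det (matrix (cmul v))\<bar> * measure lebesgue ?B"
    using measure_linear_image[OF linear_cmul lm, of v] by simp
  also have "det (matrix (cmul v)) = (norm v)\<^sup>2"
    unfolding norm2_sq by (simp add: det_2 matrix_def cmul_def axis_def power2_eq_square)
  finally have m: "measure lebesgue (box l u) = (norm v)\<^sup>2 * measure lebesgue ?B" by simp
  have Bb: "?B \<in> sets borel" by (rule measurable_sets_borel[of _ borel]) auto
  have "emeasure (density (distr lborel borel (cmul v)) (\<lambda>_. ennreal ((norm v)\<^sup>2))) (box l u)
     = ennreal ((norm v)\<^sup>2) * emeasure lborel ?B"
    by (simp add: emeasure_density nn_integral_cmult emeasure_distr)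
  also have "emeasure lborel ?B = ennreal (measure lebesgue ?B)"
  proof -
    have "emeasure lebesgue ?B = emeasure lborel ?B"
      by (subst emeasure_completion) (auto simp: Bb)
    then show ?thesis using fmeasurableD2[OF lm] emeasure_eq_ennreal_measure by metis
  qed
  also have "ennreal ((norm v)\<^sup>2) * \<dots> = ennreal (measure lebesgue (box l u))"
    unfolding m by (simp add: ennreal_mult)
  also have "measure lebesgue (box l u) = (\<Prod>b\<in>Basis. (u - l) \<bullet> b)"
    using le by (simp add: measure_lborel_box_eq inner_diff_left)
  finally show "emeasure (density (distr lborel borel (cmul v)) (\<lambda>_. ennreal ((norm v)\<^sup>2))) (box l u)
     = (\<Prod>b\<in>Basis. (u - l) \<bullet> b)" .
qed simp

lemma nn_integral_cmul:
  assumes "v \<noteq> 0" and [measurable]: "f \<in> borel_measurable borel"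
  shows "(\<integral>\<^sup>+w. f w \<partial>lborel) = ennreal ((norm v)\<^sup>2) * (\<integral>\<^sup>+w. f (cmul v w) \<partial>lborel)"
  by (subst lborel_cmul[OF assms(1)])
     (simp add: nn_integral_density nn_integral_cmult nn_integral_distr)

lemma AE_cmul:
  assumes "v \<noteq> 0" and [measurable]: "Measurable.pred borel P" and "AE w in lborel. P w"
  shows "AE w in lborel. P (cmul v w)"
proof -
  have "AE w in density (distr lborel borel (cmul v)) (\<lambda>_. ennreal ((norm v)\<^sup>2)). P w"
    using assms lborel_cmul by metis
  then have "AE w in distr lborel borel (cmul v). P w"
    using assms(1) by (simp add: AE_density)
  then show ?thesis by (subst (asm) AE_distr_iff) auto
qed

text \<open>The area \<open>pi * a\<close> of a disc of squared radius \<open>a\<close> is linear in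
  \<open>a\<close>, and the half-lines \<open>{..a}\<close> form an intersection-stable generator of
  the Borel sets.\<close>

lemma distr_norm_sq:
  "distr lborel borel (\<lambda>b::real^2. (norm b)\<^sup>2) = density lborel (\<lambda>s. ennreal pi * indicator {0..} s)"
proof (rule measure_eqI_generator_eq[where E = "range (\<lambda>a::real. {..a})" and A = "\<lambda>n. {..real n}" and \<Omega> = UNIV])
  show "Int_stable (range (\<lambda>a::real. {..a}))"
    by (auto simp: Int_stable_def)
  show "sets (distr lborel borel (\<lambda>b::real^2. (norm b)\<^sup>2)) = sigma_sets UNIV (range atMost)"
    by (simp add: borel_eq_atMost)
  show "sets (density lborel (\<lambda>s. ennreal pi * indicator {0..} s)) = sigma_sets UNIV (range (atMost :: real \<Rightarrow> _))"
    by (simp add: borel_eq_atMost)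
  have ball: "emeasure (distr lborel borel (\<lambda>b::real^2. (norm b)\<^sup>2)) {..a} = ennreal (pi * max a 0)" for a
  proof (cases "a \<ge> 0")
    case True
    have "{b::real^2. (norm b)\<^sup>2 \<le> a} = cball 0 (sqrt a)"
      using True by (auto simp: real_le_rsqrt) (metis real_sqrt_le_iff real_sqrt_pow2 norm_ge_zero power_mono)
    then show ?thesis using True
      by (simp add: emeasure_distr vimage_def emeasure_cball unit_ball_vol_2)
  next
    case False
    then have "{b::real^2. (norm b)\<^sup>2 \<le> a} = {}" by (auto simp: not_le intro: less_le_trans)
    then show ?thesis using False by (simp add: emeasure_distr vimage_def)
  qed
  show "emeasure (distr lborel borel (\<lambda>b::real^2. (norm b)\<^sup>2)) Y =
      emeasure (density lborel (\<lambda>s. ennreal pi * indicator {0..} s)) Y" if Yr: "Y \<in> range atMost" for Y :: "real set"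
  proof -
    obtain a where Y: "Y = {..a}" using Yr by (rule imageE)
    have "emeasure (density lborel (\<lambda>s. ennreal pi * indicator {0..} s)) {..a}
        = (\<integral>\<^sup>+s. ennreal pi * indicator {0..a} s \<partial>lborel)"
      by (subst emeasure_density) (auto intro!: nn_integral_cong simp: indicator_def)
    also have "\<dots> = ennreal (pi * max a 0)"
      by (cases "a \<ge> 0") (simp_all add: nn_integral_cmult_indicator ennreal_mult)
    finally show ?thesis unfolding Y ball by simp
  qed
  show "emeasure (distr lborel borel (\<lambda>b::real^2. (norm b)\<^sup>2)) {..real i} \<noteq> \<infinity>" for i
    unfolding ball by simp
  show "(\<Union>i. {..real i}) = UNIV" by (auto intro: real_arch_simple)
qed auto

lemma nn_integral_norm_sq:
  assumes [measurable]: "\<phi> \<in> borel_measurable borel"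
  shows "(\<integral>\<^sup>+b. \<phi> ((norm (b::real^2))\<^sup>2) \<partial>lborel) = ennreal pi * (\<integral>\<^sup>+s. \<phi> s * indicator {0..} s \<partial>lborel)"
proof -
  have "(\<integral>\<^sup>+b. \<phi> ((norm (b::real^2))\<^sup>2) \<partial>lborel) = (\<integral>\<^sup>+s. \<phi> s \<partial>distr lborel borel (\<lambda>b::real^2. (norm b)\<^sup>2))"
    by (simp add: nn_integral_distr)
  also have "\<dots> = (\<integral>\<^sup>+s. ennreal pi * (\<phi> s * indicator {0..} s) \<partial>lborel)"
    unfolding distr_norm_sq by (simp add: nn_integral_density mult_ac)
  finally show ?thesis by (simp add: nn_integral_cmult)
qed

text \<open>Both \<open>|b|\<^sup>2\<close> and \<open>|y|\<^sup>2\<close> are distributed as \<open>\<pi>\<close> times Lebesgue measure on the half-line, so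
  a function of \<open>a\<close> and \<open>|a|\<^sup>2 + |b|\<^sup>2\<close> on \<open>real ^ 4\<close> can be integrated over the discs \<open>|a| \<le> |y|\<close>.\<close>

lemma nn_integral_disc:
  fixes H :: "(real ^ 2) \<times> real \<Rightarrow> ennreal"
  assumes [measurable]: "H \<in> borel_measurable borel"
  shows "(\<integral>\<^sup>+a. \<integral>\<^sup>+b. H (a, (norm a)\<^sup>2 + (norm (b::real^2))\<^sup>2) \<partial>lborel \<partial>lborel)
    = (\<integral>\<^sup>+y. \<integral>\<^sup>+a. H (a, (norm (y::real^2))\<^sup>2) * indicator {a. norm a \<le> norm y} a \<partial>lborel \<partial>lborel)"
proof -
  have [measurable]: "H \<in> borel_measurable (borel \<Otimes>\<^sub>M borel)" by (simp add: borel_prod)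
  have "(\<integral>\<^sup>+a. \<integral>\<^sup>+b. H (a, (norm a)\<^sup>2 + (norm (b::real^2))\<^sup>2) \<partial>lborel \<partial>lborel)
     = (\<integral>\<^sup>+a. ennreal pi * (\<integral>\<^sup>+s. H (a, (norm a)\<^sup>2 + s) * indicator {0..} s \<partial>lborel) \<partial>lborel)"
    by (intro nn_integral_cong nn_integral_norm_sq) simp
  also have "\<dots> = ennreal pi * (\<integral>\<^sup>+a. \<integral>\<^sup>+s. H (a, (norm a)\<^sup>2 + s) * indicator {0..} s \<partial>lborel \<partial>lborel)"
    by (simp add: nn_integral_cmult)
  also have "(\<integral>\<^sup>+a. \<integral>\<^sup>+s. H (a, (norm a)\<^sup>2 + s) * indicator {0..} s \<partial>lborel \<partial>lborel)
     = (\<integral>\<^sup>+a. \<integral>\<^sup>+s. H (a, s) * indicator {(norm a)\<^sup>2..} s \<partial>lborel \<partial>lborel)"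
  proof (rule nn_integral_cong)
    fix a :: "real ^ 2"
    have "(\<integral>\<^sup>+s. H (a, s) * indicator {(norm a)\<^sup>2..} s \<partial>lborel)
       = (\<integral>\<^sup>+s. H (a, (norm a)\<^sup>2 + s) * indicator {(norm a)\<^sup>2..} ((norm a)\<^sup>2 + s) \<partial>lborel)"
      by (subst nn_integral_real_affine[where c = 1 and t = "(norm a)\<^sup>2"]) auto
    then show "(\<integral>\<^sup>+s. H (a, (norm a)\<^sup>2 + s) * indicator {0..} s \<partial>lborel)
       = (\<integral>\<^sup>+s. H (a, s) * indicator {(norm a)\<^sup>2..} s \<partial>lborel)"
      by (simp add: indicator_def)
  qed
  also have "\<dots> = (\<integral>\<^sup>+s. \<integral>\<^sup>+a. H (a, s) * indicator {(norm a)\<^sup>2..} s \<partial>lborel \<partial>lborel)"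
  proof -
    have [measurable]: "(\<lambda>x::(real^2)\<times>real. indicator {(norm (fst x))\<^sup>2..} (snd x) :: ennreal) \<in> borel_measurable (borel \<Otimes>\<^sub>M borel)"
    proof -
      have "(\<lambda>x::(real^2)\<times>real. indicator {(norm (fst x))\<^sup>2..} (snd x) :: ennreal) = (\<lambda>x. if (norm (fst x))\<^sup>2 \<le> snd x then 1 else 0)"
        by (auto simp: indicator_def)
      then show ?thesis by simp
    qed
    show ?thesis by (rule lborel_pair.Fubini'[symmetric]) (simp add: split_beta')
  qed
  also have "\<dots> = (\<integral>\<^sup>+s. (\<integral>\<^sup>+a. H (a, s) * (if (norm a)\<^sup>2 \<le> s then 1 else 0) \<partial>lborel) * indicator {0..} s \<partial>lborel)"
  proof (rule nn_integral_cong)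
    fix s :: real
    show "(\<integral>\<^sup>+a. H (a, s) * indicator {(norm a)\<^sup>2..} s \<partial>lborel)
       = (\<integral>\<^sup>+a. H (a, s) * (if (norm a)\<^sup>2 \<le> s then 1 else 0) \<partial>lborel) * indicator {0..} s"
    proof (cases "s \<ge> 0")
      case True then show ?thesis by (auto simp: indicator_def intro!: nn_integral_cong)
    next
      case False
      then have "\<not> (norm a)\<^sup>2 \<le> s" for a :: "real^2" using order_trans zero_le_power2 by blast
      then show ?thesis by (simp add: indicator_def)
    qed
  qed
  also have "ennreal pi * \<dots> = (\<integral>\<^sup>+y. (\<integral>\<^sup>+a. H (a, (norm (y::real^2))\<^sup>2) * (if (norm a)\<^sup>2 \<le> (norm y)\<^sup>2 then 1 else 0) \<partial>lborel) \<partial>lborel)"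
    by (rule nn_integral_norm_sq[symmetric]) simp
  also have "\<dots> = (\<integral>\<^sup>+y. \<integral>\<^sup>+a. H (a, (norm (y::real^2))\<^sup>2) * indicator {a. norm a \<le> norm y} a \<partial>lborel \<partial>lborel)"
    by (intro nn_integral_cong) (simp add: indicator_def power_mono_iff)
  finally show ?thesis .
qed

definition d5 :: "real ^ 5 \<Rightarrow> real" where
  "d5 y = sqrt ((y $ 1)\<^sup>2 + (y $ 2)\<^sup>2 + (y $ 4)\<^sup>2 + (y $ 5)\<^sup>2)"

lemma cyl_r_measurable [measurable]: "cyl_r \<in> borel_measurable borel"
  unfolding cyl_r_def[abs_def] by measurable

lemma d5_measurable [measurable]: "d5 \<in> borel_measurable borel"
  unfolding d5_def[abs_def] by measurable

lemma cyl_r_emb3 [simp]: "cyl_r (emb3 (a, t)) = norm a" "emb3 (a, t) $ 3 = t"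
  by (simp_all add: cyl_r_def emb3_def norm_vec2)

text \<open>At each height \<open>nn_integral_disc\<close> removes the second plane: the horizontal
  part of \<open>x\<close> carries only the radius \<open>d5 y\<close>, and the first plane shrinks
  to a disc of that radius. This is how a kernel on \<open>real ^ 5\<close> descends to
  \<open>real ^ 3\<close>.\<close>

lemma nn_integral_R5:
  fixes K :: "(real ^ 2) \<times> real \<times> real \<Rightarrow> ennreal"
  assumes [measurable]: "K \<in> borel_measurable borel"
  shows "(\<integral>\<^sup>+y. K (vector [y $ 1, y $ 2], y $ 3, d5 y) \<partial>lborel)
    = (\<integral>\<^sup>+x. \<integral>\<^sup>+a. K (a, x $ 3, cyl_r x) * indicator {a. norm a \<le> cyl_r x} a \<partial>lborel \<partial>lborel)"
proof -
  have [measurable]: "K \<in> borel_measurable (borel \<Otimes>\<^sub>M borel \<Otimes>\<^sub>M borel)" by (simp add: borel_prod)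
  have [simp]: "vector [a $ 1, a $ 2] = (a :: real ^ 2)" for a by (simp add: vec_eq_iff forall_2)
  have d5: "d5 (emb5 ((a, t), b)) = sqrt ((norm a)\<^sup>2 + (norm b)\<^sup>2)" for a t b
    by (simp add: d5_def emb5_def norm2_sq)
  have emb5: "emb5 ((a, t), b) $ 1 = a $ 1" "emb5 ((a, t), b) $ 2 = a $ 2" "emb5 ((a, t), b) $ 3 = t" for a t b
    by (simp_all add: emb5_def)
  have "(\<integral>\<^sup>+y. K (vector [y $ 1, y $ 2], y $ 3, d5 y) \<partial>lborel)
    = (\<integral>\<^sup>+a. \<integral>\<^sup>+t. \<integral>\<^sup>+b. K (a, t, sqrt ((norm a)\<^sup>2 + (norm (b::real^2))\<^sup>2)) \<partial>lborel \<partial>lborel \<partial>lborel)"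
    by (subst nn_integral_emb5) (simp_all add: d5 emb5)
  also have "\<dots> = (\<integral>\<^sup>+t. \<integral>\<^sup>+a. \<integral>\<^sup>+b. K (a, t, sqrt ((norm a)\<^sup>2 + (norm (b::real^2))\<^sup>2)) \<partial>lborel \<partial>lborel \<partial>lborel)"
    by (rule lborel_pair.Fubini'[symmetric]) simp
  also have "\<dots> = (\<integral>\<^sup>+t. \<integral>\<^sup>+y. \<integral>\<^sup>+a. K (a, t, sqrt ((norm (y::real^2))\<^sup>2)) * indicator {a. norm a \<le> norm y} a \<partial>lborel \<partial>lborel \<partial>lborel)"
  proof (rule nn_integral_cong)
    fix t :: real
    have "(\<lambda>p. K (fst p, t, sqrt (snd p))) \<in> borel_measurable borel" unfolding borel_prod[symmetric] by simp
    from nn_integral_disc[OF this]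
    show "(\<integral>\<^sup>+a. \<integral>\<^sup>+b. K (a, t, sqrt ((norm a)\<^sup>2 + (norm (b::real^2))\<^sup>2)) \<partial>lborel \<partial>lborel)
      = (\<integral>\<^sup>+y. \<integral>\<^sup>+a. K (a, t, sqrt ((norm (y::real^2))\<^sup>2)) * indicator {a. norm a \<le> norm y} a \<partial>lborel \<partial>lborel)"
      by simp
  qed
  also have "\<dots> = (\<integral>\<^sup>+y. \<integral>\<^sup>+t. \<integral>\<^sup>+a. K (a, t, norm (y::real^2)) * indicator {a. norm a \<le> norm y} a \<partial>lborel \<partial>lborel \<partial>lborel)"
    by (subst lborel_pair.Fubini') (simp_all add: indicator_def)
  also have "\<dots> = (\<integral>\<^sup>+x. \<integral>\<^sup>+a. K (a, x $ 3, cyl_r x) * indicator {a. norm a \<le> cyl_r x} a \<partial>lborel \<partial>lborel)"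
    by (subst nn_integral_emb3) (simp_all add: indicator_def)
  finally show ?thesis .
qed

text \<open>\<open>rot w\<close> rotates about the axis by the argument of \<open>w\<close>; \<open>sec w r z\<close> is the point of the orbit
  \<open>(r, z)\<close> in the direction \<open>w\<close>. Rotating \<open>w\<close> turns the first into the second, and averages over
  \<open>w\<close> in the unit disc replace averages over the angle.\<close>

definition rot :: "real ^ 2 \<Rightarrow> real ^ 3 \<Rightarrow> real ^ 3" where
  "rot w x = emb3 (cmul ((1 / norm w) *\<^sub>R w) (vector [x $ 1, x $ 2]), x $ 3)"

definition sec :: "real ^ 2 \<Rightarrow> real \<Rightarrow> real \<Rightarrow> real ^ 3" where
  "sec w r z = emb3 ((r / norm w) *\<^sub>R w, z)"

lemma emb3_comp [measurable (raw)]: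
  assumes [measurable]: "f \<in> borel_measurable M" "g \<in> borel_measurable M"
  shows "(\<lambda>x. emb3 (f x, g x)) \<in> borel_measurable M"
  unfolding emb3_def by simp

lemma rot_measurable [measurable (raw)]:
  assumes [measurable]: "f \<in> borel_measurable M" "g \<in> borel_measurable M"
  shows "(\<lambda>x. rot (f x) (g x)) \<in> borel_measurable M"
  unfolding rot_def by simp

lemma sec_measurable [measurable (raw)]:
  assumes [measurable]: "f \<in> borel_measurable M" "g \<in> borel_measurable M" "h \<in> borel_measurable M"
  shows "(\<lambda>x. sec (f x) (g x) (h x)) \<in> borel_measurable M"
  unfolding sec_def by simp

lemma lborel_rot:
  assumes "w \<noteq> 0"
  shows "distr lborel borel (rot w) = lborel"
proof (rule measure_eqI)
  fix A assume "A \<in> sets (distr lborel borel (rot w))"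
  then have [measurable]: "A \<in> sets borel" by simp
  let ?v = "(1 / norm w) *\<^sub>R w"
  have v: "?v \<noteq> 0" "norm ?v = 1" using assms by auto
  have [simp]: "vector [a $ 1, a $ 2] = (a :: real ^ 2)" for a by (simp add: vec_eq_iff forall_2)
  have [simp]: "rot w (emb3 (a, t)) = emb3 (cmul ?v a, t)" for a t
    by (simp add: rot_def) (simp add: emb3_def)
  have "emeasure (distr lborel borel (rot w)) A = (\<integral>\<^sup>+x. indicator A (rot w x) \<partial>lborel)"
  proof -
    have "emeasure (distr lborel borel (rot w)) A = (\<integral>\<^sup>+x. indicator A x \<partial>distr lborel borel (rot w))" by simp
    also have "\<dots> = (\<integral>\<^sup>+x. indicator A (rot w x) \<partial>lborel)" by (subst nn_integral_distr) simp_all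
    finally show ?thesis .
  qed
  also have "\<dots> = (\<integral>\<^sup>+a. \<integral>\<^sup>+t. indicator A (emb3 (cmul ?v a, t)) \<partial>lborel \<partial>lborel)"
    by (subst nn_integral_emb3) simp_all
  also have "\<dots> = (\<integral>\<^sup>+a. \<integral>\<^sup>+t. indicator A (emb3 (a, t)) \<partial>lborel \<partial>lborel)"
    using nn_integral_cmul[OF v(1), of "\<lambda>a. \<integral>\<^sup>+t. indicator A (emb3 (a, t)) \<partial>lborel"] unfolding v(2) by simp
  also have "\<dots> = emeasure lborel A"
    by (subst nn_integral_emb3[symmetric]) simp_all
  finally show "emeasure (distr lborel borel (rot w)) A = emeasure lborel A" .
qed simp

lemma cyl_r_rot: "w \<noteq> 0 \<Longrightarrow> cyl_r (rot w x) = cyl_r x"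
  by (simp add: rot_def norm_cmul) (simp add: norm_vec2 cyl_r_def)

lemma rot_3 [simp]: "rot w x $ 3 = x $ 3"
  by (simp add: rot_def)

text \<open>Fubini exchanges the quantifiers over \<open>w\<close> and \<open>x\<close>; for fixed
  \<open>x\<close> off the axis a further rotation of \<open>w\<close> turns \<open>rot\<close> into
  \<open>sec\<close>. Exceptional sets that depend on the rotation thus become null sets of
  directions on almost every orbit.\<close>

lemma AE_sec:
  assumes [measurable]: "Measurable.pred (borel \<Otimes>\<^sub>M borel) P"
    and P: "\<And>w. w \<noteq> 0 \<Longrightarrow> AE x in lborel. P (rot w x, x)"
  shows "AE x in lborel. AE w in lborel. P (sec w (cyl_r x) (x $ 3), x)"
proof -
  have "AE w::real^2 in lborel. w \<noteq> 0" by (rule AE_lborel_singleton)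
  then have "AE w in lborel. AE x in lborel. P (rot w x, x)" using P by (auto elim: eventually_mono)
  moreover have "{p \<in> space (lborel \<Otimes>\<^sub>M lborel). P (rot (fst p) (snd p), snd p)} \<in> sets (lborel \<Otimes>\<^sub>M lborel)"
  proof -
    have "Measurable.pred (borel \<Otimes>\<^sub>M borel) (\<lambda>p. P (rot (fst p) (snd p), snd p))"
      by (rule measurable_compose[OF _ assms(1)]) measurable
    then have 1: "{p \<in> space (borel \<Otimes>\<^sub>M borel). P (rot (fst p) (snd p), snd p)} \<in> sets (borel \<Otimes>\<^sub>M borel)"
      unfolding pred_def .
    have 2: "sets (borel \<Otimes>\<^sub>M borel) = sets ((lborel :: (real^2) measure) \<Otimes>\<^sub>M (lborel :: (real^3) measure))"
      by (rule sets_pair_measure_cong) simp_all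
    show ?thesis using 1 unfolding 2 by (simp only: space_pair_measure space_lborel space_borel)
  qed
  ultimately have "AE x in lborel. AE w in lborel. P (rot w x, x)"
    using lborel_pair.AE_commute[where P = "\<lambda>w x. P (rot w x, x)"] by blast
  moreover have "AE x::real^3 in lborel. (vector [x $ 1, x $ 2] :: real^2) \<noteq> 0"
  proof -
    have "AE a::real^2 in lborel. a \<noteq> 0" by (rule AE_lborel_singleton)
    then have "(\<integral>\<^sup>+a. \<integral>\<^sup>+t. indicator {x. (vector [x $ 1, x $ 2] :: real^2) = 0} (emb3 (a, t)) \<partial>lborel \<partial>lborel) = 0"
      by (intro iffD2[OF nn_integral_0_iff_AE]) (auto simp: emb3_def indicator_def vec_eq_iff forall_2 elim!: eventually_mono)
    then have "(\<integral>\<^sup>+x. indicator {x. (vector [x $ 1, x $ 2] :: real^2) = 0} x \<partial>(lborel :: (real^3) measure)) = 0"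
      by (subst nn_integral_emb3) simp_all
    then show ?thesis by (subst (asm) nn_integral_0_iff_AE) (auto simp: indicator_def elim!: eventually_mono)
  qed
  ultimately show ?thesis
  proof eventually_elim
    case (elim x)
    let ?a = "vector [x $ 1, x $ 2] :: real^2"
    \<comment> \<open>The conjugate of \<open>?a\<close>. The complex product of \<open>?v\<close>,
      \<open>w\<close> and \<open>?a\<close> is a positive multiple of \<open>w\<close>, so rotating
      \<open>x\<close> by \<open>cmul ?v w\<close> yields the point of its orbit in direction
      \<open>w\<close>.\<close>
    let ?v = "vector [?a $ 1, - ?a $ 2] :: real^2"
    have nv: "norm ?v = norm ?a" by (simp add: norm_vec2)
    have v0: "?v \<noteq> 0" using elim(2) nv by (metis norm_eq_zero)
    have eq: "rot (cmul ?v w) x = sec w (cyl_r x) (x $ 3)" for w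
    proof -
      have c: "cyl_r x = norm ?a" by (simp add: norm_vec2 cyl_r_def)
      have "cmul ((1 / norm (cmul ?v w)) *\<^sub>R cmul ?v w) ?a = (1 / (norm ?a * norm w)) *\<^sub>R cmul (cmul ?v w) ?a"
        unfolding norm_cmul nv by (simp add: linear_cmul[THEN linear_scale] cmul_commute[of _ ?a])
      also have "cmul (cmul ?v w) ?a = (norm ?a)\<^sup>2 *\<^sub>R w"
        unfolding norm2_sq by (simp add: vec_eq_iff forall_2 cmul_def algebra_simps power2_eq_square)
      also have "(1 / (norm ?a * norm w)) *\<^sub>R ((norm ?a)\<^sup>2 *\<^sub>R w) = (norm ?a / norm w) *\<^sub>R w"
        using elim(2) by (simp add: power2_eq_square)
      finally show ?thesis unfolding rot_def sec_def c by simp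
    qed
    have "AE w in lborel. P (rot (cmul ?v w) x, x)"
      by (rule AE_cmul[OF v0 _ elim(1)]) simp
    then show ?case unfolding eq .
  qed
qed

section \<open>Averages over orbits and Borel profiles\<close>

lemma sec_nz: "w \<noteq> 0 \<Longrightarrow> cyl_r (sec w r z) = \<bar>r\<bar>" "sec w r z $ 3 = z"
  by (simp_all add: sec_def)

lemma cyl_r_nonneg [simp]: "cyl_r x \<ge> 0"
  by (simp add: cyl_r_def)

text \<open>Evaluation in one fixed direction would see only a null half-plane; the mean over the
  unit disc, of area \<open>pi\<close>, ignores null sets of \<open>real ^ 3\<close> on almost every
  orbit.\<close>

definition disc_mean :: "(real ^ 3 \<Rightarrow> real) \<Rightarrow> real \<times> real \<Rightarrow> real" where
  "disc_mean u p = (LINT w|lborel. u (sec w (fst p) (snd p)) * indicator (ball 0 1) w) / pi"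

lemma disc_mean_measurable [measurable]:
  assumes [measurable]: "u \<in> borel_measurable borel"
  shows "disc_mean u \<in> borel_measurable borel"
proof -
  have [measurable]: "ball (0::real^2) 1 \<in> sets borel" by simp
  show ?thesis
  unfolding disc_mean_def[abs_def] borel_prod[symmetric]
  by (intro borel_measurable_divide lborel.borel_measurable_lebesgue_integral) (auto simp: split_beta')
qed

lemma disc_mean_eq:
  assumes [measurable]: "u \<in> borel_measurable borel"
    and "AE w in lborel. u (sec w (fst p) (snd p)) = c"
  shows "disc_mean u p = c"
proof -
  have [measurable]: "ball (0::real^2) 1 \<in> sets borel" by simp
  have "(LINT w|lborel. u (sec w (fst p) (snd p)) * indicator (ball 0 1) w)
      = (LINT w|lborel. c * indicator (ball (0::real^2) 1) w)"
    using assms(2) by (intro integral_cong_AE) auto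
  also have "\<dots> = c * pi"
    by (simp add: content_ball unit_ball_vol_2)
  finally show ?thesis by (simp add: disc_mean_def)
qed

text \<open>The null set in the hypothesis may depend on the rotation. \<open>AE_sec\<close>,
  applied to equality of \<open>u\<close> at two points, shows that on almost every orbit
  \<open>u\<close> equals \<open>u x\<close> in almost every direction.\<close>

lemma rot_invariant_rep:
  assumes [measurable]: "u \<in> borel_measurable borel"
    and "\<And>w. w \<noteq> 0 \<Longrightarrow> AE x in lborel. u (rot w x) = u x"
  shows "AE x in lborel. u x = disc_mean u (cyl_r x, x $ 3)"
proof -
  have "AE x in lborel. AE w in lborel. u (fst (sec w (cyl_r x) (x $ 3), x)) = u (snd (sec w (cyl_r x) (x $ 3), x))"
    by (rule AE_sec[where P = "\<lambda>p. u (fst p) = u (snd p)"]) (use assms(2) in auto)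
  then show ?thesis
    by eventually_elim (auto intro!: disc_mean_eq[symmetric])
qed

lemma lift5_d5: "lift5 u y = u (vector [d5 y, 0, y $ 3])"
  by (simp add: lift5_def d5_def)

text \<open>\<open>nn_integral_R5\<close> is applied to the indicator of the failure of
  \<open>P\<close>, which depends only on height and radius.\<close>

lemma AE_R5_of_R3:
  assumes [measurable]: "Measurable.pred (borel \<Otimes>\<^sub>M borel) P"
    and P: "AE x in lborel. P (cyl_r x, x $ 3)"
  shows "AE y in lborel. P (d5 y, y $ 3)"
proof -
  let ?K = "\<lambda>p::(real^2) \<times> real \<times> real. if P (snd (snd p), fst (snd p)) then 0 else 1::ennreal"
  have "(\<integral>\<^sup>+y. ?K (vector [y $ 1, y $ 2], y $ 3, d5 y) \<partial>lborel)
    = (\<integral>\<^sup>+x. \<integral>\<^sup>+a. ?K (a, x $ 3, cyl_r x) * indicator {a. norm a \<le> cyl_r x} a \<partial>lborel \<partial>lborel)"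
    by (rule nn_integral_R5) (simp add: borel_prod[symmetric])
  also have "\<dots> = (\<integral>\<^sup>+x. 0 \<partial>(lborel :: (real^3) measure))"
    by (rule nn_integral_cong_AE) (use P in eventually_elim, simp)
  finally have "(\<integral>\<^sup>+y. (if P (d5 y, y $ 3) then 0 else 1::ennreal) \<partial>lborel) = 0" by simp
  then show ?thesis by (subst (asm) nn_integral_0_iff_AE) (auto split: if_splits elim!: eventually_mono)
qed

text \<open>A Borel version \<open>u0\<close> may be wrong on the whole half-plane where
  \<open>lift5\<close> reads \<open>u\<close>. But on an orbit that meets the exceptional set in a
  null set of directions, the mean of \<open>u0\<close> is the exact value of \<open>u\<close>,
  which is constant there. The remaining orbits are negligible in \<open>real ^ 3\<close> and hence
  in \<open>real ^ 5\<close>.\<close>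

lemma axisymmetric_Borel_rep:
  assumes ax: "axisymmetric u" and u: "u \<in> borel_measurable lebesgue"
  obtains g where "g \<in> borel_measurable borel"
    "AE x in lborel. u x = g (cyl_r x, x $ 3)" "AE y in lborel. lift5 u y = g (d5 y, y $ 3)"
proof -
  from ax obtain f where f: "\<And>x. u x = f (cyl_r x) (x $ 3)" unfolding axisymmetric_def by auto
  obtain u0 where [measurable]: "u0 \<in> borel_measurable borel" and u0: "AE x in lborel. u x = u0 x"
    using completion_ex_borel_measurable_real[OF u] by auto
  obtain N where N: "{x. u x \<noteq> u0 x} \<subseteq> N" "emeasure lborel N = 0" and [measurable]: "N \<in> sets borel"
    using AE_E[OF u0] by auto
  have NAE: "AE x in lborel. x \<notin> N" using N(2) by (intro AE_not_in) (auto simp: null_sets_def)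
  have rotN: "AE x in lborel. rot w x \<notin> N" if "w \<noteq> 0" for w
  proof -
    have "AE x in distr lborel borel (rot w). x \<notin> N" unfolding lborel_rot[OF that] by (rule NAE)
    then show ?thesis by (subst (asm) AE_distr_iff) auto
  qed
  \<comment> \<open>The good orbits; their set must be measurable to be transferred to
    \<open>real ^ 5\<close>.\<close>
  define G where "G p \<longleftrightarrow> (AE w in lborel. sec w (fst p) (snd p) \<notin> N)" for p :: "real \<times> real"
  have [measurable]: "Measurable.pred (borel \<Otimes>\<^sub>M borel) G"
  proof -
    have "G p \<longleftrightarrow> (\<integral>\<^sup>+w. indicator N (sec w (fst p) (snd p)) \<partial>lborel) = 0" for p
      unfolding G_def by (subst nn_integral_0_iff_AE) (auto simp: indicator_def)
    then have eq: "G = (\<lambda>p. (\<integral>\<^sup>+w. indicator N (sec w (fst p) (snd p)) \<partial>lborel) = 0)" by (intro ext)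
    have [measurable]: "(\<lambda>p::real\<times>real. \<integral>\<^sup>+w. indicator N (sec w (fst p) (snd p)) \<partial>lborel) \<in> borel_measurable (borel \<Otimes>\<^sub>M borel)"
      by (rule lborel.borel_measurable_nn_integral) (simp add: split_beta')
    show ?thesis unfolding eq by measurable
  qed
  have G3: "AE x in lborel. G (cyl_r x, x $ 3)"
    using AE_sec[where P = "\<lambda>p. fst p \<notin> N"] rotN by (auto simp: G_def)
  have G5: "AE y in lborel. G (d5 y, y $ 3)"
    by (rule AE_R5_of_R3) (simp, rule G3)
  have good: "disc_mean u0 (r, z) = f r z" if "G (r, z)" "r \<ge> 0" for r z
  proof (rule disc_mean_eq)
    have "AE w::real^2 in lborel. w \<noteq> 0" by (rule AE_lborel_singleton)
    with that(1) show "AE w in lborel. u0 (sec w (fst (r, z)) (snd (r, z))) = f r z"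
      unfolding G_def
    proof eventually_elim
      case (elim w)
      then have "sec w r z \<notin> {x. u x \<noteq> u0 x}" using N(1) by auto
      then have "u0 (sec w r z) = u (sec w r z)" by simp
      also have "\<dots> = f r z" using elim(2) that(2) by (simp add: f sec_nz)
      finally show ?case by simp
    qed
  qed simp
  show thesis
  proof (rule that[of "disc_mean u0"])
    show "disc_mean u0 \<in> borel_measurable borel" by simp
    show "AE x in lborel. u x = disc_mean u0 (cyl_r x, x $ 3)"
      using G3 by eventually_elim (simp add: good f)
    show "AE y in lborel. lift5 u y = disc_mean u0 (d5 y, y $ 3)"
      using G5
    proof eventually_elim
      case (elim y)
      have "d5 y \<ge> 0" by (simp add: d5_def)
      with elim show ?case by (simp add: good lift5_d5 f cyl_r_def)
    qed
  qed
qed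

section \<open>The gravitational and magnetic kernels\<close>

text \<open>Since \<open>0 powr a = 0\<close>, the value at \<open>0\<close> is set by hand.\<close>

definition om :: "real \<Rightarrow> real \<Rightarrow> ennreal" where
  "om p t = (if t = 0 then \<infinity> else ennreal (\<bar>t\<bar> powr - p))"

lemma om_measurable [measurable (raw)]:
  assumes [measurable]: "f \<in> borel_measurable M"
  shows "(\<lambda>x. om p (f x)) \<in> borel_measurable M"
  unfolding om_def by measurable

lemma om_pos: "om p t > 0"
  by (simp add: om_def)

lemma om_minus: "om p (a - b) = om p (b - a)"
  by (simp add: om_def abs_minus_commute)

lemma om_sq: "om p t ^ 2 = om (2 * p) t"
  by (simp add: om_def power2_eq_square ennreal_mult[symmetric] powr_add[symmetric] ennreal_top_mult)

definition omI :: "real \<Rightarrow> real \<Rightarrow> ennreal" where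
  "omI p L = (\<integral>\<^sup>+t. om p t * indicator {-L..L} t \<partial>lborel)"

lemma omI_finite:
  assumes "p < 1" "L \<ge> 0"
  shows "omI p L < \<infinity>"
proof -
  have "((\<lambda>x. x powr (- p)) has_integral (L powr (- p + 1) / (- p + 1))) {0..L}"
    using assms by (intro has_integral_powr_from_0) auto
  then have 1: "(\<integral>\<^sup>+x. ennreal (indicator {0..L} x * x powr (- p)) \<partial>lborel) = ennreal (L powr (- p + 1) / (- p + 1))"
    by (intro nn_integral_has_integral_lebesgue) auto
  have 2: "(\<integral>\<^sup>+x. ennreal (indicator {0..L} (-x) * (-x) powr (- p)) \<partial>lborel)
       = (\<integral>\<^sup>+x. ennreal (indicator {0..L} x * x powr (- p)) \<partial>lborel)"
    using nn_integral_real_affine[of "\<lambda>x. ennreal (indicator {0..L} x * x powr (- p))" "-1" 0] by simp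
  have "AE t::real in lborel. t \<noteq> 0" by (rule AE_lborel_singleton)
  then have "omI p L \<le> (\<integral>\<^sup>+x. ennreal (indicator {0..L} x * x powr (- p)) + ennreal (indicator {0..L} (-x) * (-x) powr (- p)) \<partial>lborel)"
    unfolding omI_def
  proof (intro nn_integral_mono_AE, eventually_elim)
    case (elim t)
    then show ?case by (auto simp: om_def indicator_def abs_if)
  qed
  also have "\<dots> = ennreal (L powr (- p + 1) / (- p + 1)) + ennreal (L powr (- p + 1) / (- p + 1))"
    by (subst nn_integral_add) (simp_all add: 1 2)
  finally show ?thesis using ennreal_less_top le_less_trans by (auto simp: top_unique less_top[symmetric])
qed

lemma omI_shift: "(\<integral>\<^sup>+t. om p (t - c) * indicator {-L..L} (t - c) \<partial>lborel) = omI p L"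
  unfolding omI_def
  by (subst nn_integral_real_affine[where c = 1 and t = "- c"]) auto

lemma nn_integral_prod_vec:
  fixes f :: "'n::finite \<Rightarrow> real \<Rightarrow> ennreal"
  assumes [measurable]: "\<And>i. f i \<in> borel_measurable borel"
  shows "(\<integral>\<^sup>+x. (\<Prod>i\<in>UNIV. f i (x $ i)) \<partial>(lborel :: (real^'n) measure)) = (\<Prod>i\<in>UNIV. \<integral>\<^sup>+t. f i t \<partial>lborel)"
proof -
  \<comment> \<open>The product formula for \<open>lborel\<close> indexes its factors by basis
    vectors; \<open>F\<close> carries the index over.\<close>
  define F where "F b = f (SOME i. b = axis i (1::real))" for b :: "real ^ 'n"
  have F: "F (axis i 1) = f i" for i
    by (simp add: F_def axis_eq_axis)
  have "(\<integral>\<^sup>+x. (\<Prod>b\<in>Basis. F b (x \<bullet> b)) \<partial>(lborel :: (real^'n) measure)) = (\<Prod>b\<in>Basis. \<integral>\<^sup>+t. F b t \<partial>lborel)"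
    by (rule nn_integral_lborel_prod) (auto simp: F_def)
  then show ?thesis unfolding prod_Basis_vec F by (simp add: inner_axis)
qed

text \<open>The exponents 1/8, 1/8 and 5/4 add up to 3/2. The former are small enough for the square
  of the resulting kernel to be integrable across \<open>r = s\<close> and \<open>z = 0\<close>; the
  latter is below 3/2, the threshold for integrating a negative power of \<open>1 - w $ 1\<close>
  over the disc.\<close>

lemma powr_sum3_le:
  fixes A B C :: real
  assumes "A > 0" "B > 0" "C > 0"
  shows "1 / sqrt (A + B + C) ^ 3 \<le> A powr (-1/8) * B powr (-1/8) * C powr (-5/4)"
proof -
  let ?S = "A + B + C"
  have S: "?S > 0" using assms by simp
  have "sqrt ?S ^ 3 = ?S powr (3/2)"
    using S by (simp add: powr_half_sqrt[symmetric] powr_power)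
  then have "1 / sqrt ?S ^ 3 = ?S powr (-3/2)"
    using powr_minus_divide[of ?S "3/2"] by simp
  also have "\<dots> = ?S powr (-1/8) * ?S powr (-1/8) * ?S powr (-5/4)"
    by (simp add: powr_add[symmetric])
  also have "\<dots> \<le> A powr (-1/8) * B powr (-1/8) * C powr (-5/4)"
    using assms by (intro mult_mono powr_mono2') auto
  finally show ?thesis .
qed

text \<open>By the theorem of Archimedes the first two coordinates of a uniform point of the unit sphere of
  \<open>real ^ 4\<close> are uniform in the unit disc, so \<open>jj\<close> is up to a constant the mean of the kernel
  \<open>1 / |x - y| ^ 3\<close> of \<open>real ^ 5\<close> over an orbit, and \<open>k5e\<close> the resulting kernel of the magnetic energy
  on \<open>real ^ 3\<close>.\<close>

definition jj :: "real \<Rightarrow> real \<Rightarrow> ennreal" where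
  "jj P m = (\<integral>\<^sup>+w. ennreal (1 / sqrt (P - m * (w $ 1)) ^ 3) * indicator (cball (0::real^2) 1) w \<partial>lborel)"

definition k5e :: "real ^ 3 \<Rightarrow> real ^ 3 \<Rightarrow> ennreal" where
  "k5e x y = ennreal ((cyl_r x)\<^sup>2 * (cyl_r y)\<^sup>2) *
     jj ((cyl_r x)\<^sup>2 + (cyl_r y)\<^sup>2 + (x $ 3 - y $ 3)\<^sup>2) (2 * cyl_r x * cyl_r y)"

lemma jj_measurable [measurable (raw)]:
  assumes [measurable]: "f \<in> borel_measurable M" "g \<in> borel_measurable M"
  shows "(\<lambda>x. jj (f x) (g x)) \<in> borel_measurable M"
proof -
  have [measurable]: "cball (0::real^2) 1 \<in> sets borel" by simp
  have [measurable]: "(\<lambda>p. jj (fst p) (snd p)) \<in> borel_measurable (borel \<Otimes>\<^sub>M borel)"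
    unfolding jj_def by (rule lborel.borel_measurable_nn_integral) (simp add: split_beta')
  have "(\<lambda>x. jj (fst (f x, g x)) (snd (f x, g x))) \<in> borel_measurable M" by measurable
  then show ?thesis by simp
qed

lemma k5e_measurable [measurable (raw)]:
  assumes [measurable]: "f \<in> borel_measurable M" "g \<in> borel_measurable M"
  shows "(\<lambda>x. k5e (f x) (g x)) \<in> borel_measurable M"
  unfolding k5e_def by measurable

lemma k5e_sym: "k5e x y = k5e y x"
  by (simp add: k5e_def algebra_simps power2_commute)

text \<open>Complex multiplication by \<open>(s / norm x) *\<^sub>R x\<close> maps the unit disc
  onto the disc of radius \<open>s\<close> and turns the inner product with \<open>x\<close> into
  \<open>norm x * s * w $ 1\<close>. Its Jacobian is the factor in front.\<close>

lemma jj_scale: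
  assumes "s \<ge> 0" and x: "(x :: real ^ 2) \<noteq> 0"
  shows "(\<integral>\<^sup>+a. ennreal (1 / sqrt (P - 2 * (x \<bullet> a)) ^ 3) * indicator {a. norm a \<le> s} a \<partial>lborel)
    = ennreal (s\<^sup>2) * jj P (2 * norm x * s)"
proof (cases "s = 0")
  case True
  have "AE a::real^2 in lborel. a \<noteq> 0" by (rule AE_lborel_singleton)
  then have "(\<integral>\<^sup>+a. ennreal (1 / sqrt (P - 2 * (x \<bullet> a)) ^ 3) * indicator {a. norm a \<le> s} a \<partial>lborel) = (\<integral>\<^sup>+a. 0 \<partial>(lborel :: (real^2) measure))"
    by (intro nn_integral_cong_AE) (auto elim!: eventually_mono simp: True indicator_def)
  then show ?thesis using True by simp
next
  case False
  then have s: "s > 0" using assms by simp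
  have [measurable]: "cball (0::real^2) s \<in> sets borel" by simp
  have c: "{a::real^2. norm a \<le> s} = cball 0 s" by auto
  let ?v = "(s / norm x) *\<^sub>R x"
  have v: "?v \<noteq> 0" "norm ?v = s" using s x by auto
  have xw: "x \<bullet> cmul ?v w = norm x * s * w $ 1" for w
  proof -
    have "x \<bullet> cmul ?v w = (s / norm x) * (((x $ 1)\<^sup>2 + (x $ 2)\<^sup>2) * w $ 1)"
      by (simp add: inner_vec_def UNIV_2 cmul_def algebra_simps power2_eq_square)
    also have "\<dots> = norm x * s * w $ 1"
      using x unfolding norm2_sq[symmetric] by (simp add: power2_eq_square)
    finally show ?thesis .
  qed
  have "(\<integral>\<^sup>+a. ennreal (1 / sqrt (P - 2 * (x \<bullet> a)) ^ 3) * indicator (cball 0 s) a \<partial>lborel)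
    = ennreal (s\<^sup>2) * (\<integral>\<^sup>+w. ennreal (1 / sqrt (P - 2 * (x \<bullet> cmul ?v w)) ^ 3) * indicator (cball 0 s) (cmul ?v w) \<partial>lborel)"
    using nn_integral_cmul[OF v(1), of "\<lambda>a. ennreal (1 / sqrt (P - 2 * (x \<bullet> a)) ^ 3) * indicator (cball 0 s) a"]
    unfolding v(2) by simp
  also have "(\<integral>\<^sup>+w. ennreal (1 / sqrt (P - 2 * (x \<bullet> cmul ?v w)) ^ 3) * indicator (cball 0 s) (cmul ?v w) \<partial>lborel)
      = jj P (2 * norm x * s)"
    unfolding jj_def xw using s
    by (intro nn_integral_cong) (simp add: indicator_def norm_cmul v(2) mult_ac del: norm_scaleR)
  finally show ?thesis unfolding c .
qed

definition hat5 :: "real ^ 3 \<Rightarrow> real ^ 5" where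
  "hat5 x = vector [x $ 1, x $ 2, x $ 3, 0, 0]"

lemma sum_UNIV_5: "sum f (UNIV :: 5 set) = f 1 + f 2 + f 3 + f 4 + f 5"
  unfolding UNIV_5 by (simp add: add_ac)

text \<open>The last two coordinates of \<open>hat5 x\<close> vanish, so \<open>y\<close> enters
  only through its first plane, its height and \<open>d5 y\<close>: the three arguments that
  \<open>nn_integral_R5\<close> admits.\<close>

lemma norm_hat5_diff:
  "norm (hat5 x - y) = sqrt ((cyl_r x)\<^sup>2 + (d5 y)\<^sup>2 + (x $ 3 - y $ 3)\<^sup>2
      - 2 * ((vector [x $ 1, x $ 2] :: real^2) \<bullet> vector [y $ 1, y $ 2]))"
  by (simp add: norm_vec_def L2_set_def sum_UNIV_5 hat5_def cyl_r_def d5_def inner_vec_def UNIV_2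
      power2_eq_square algebra_simps)

text \<open>The squared radius of \<open>x\<close> in \<open>k5e\<close> is the factor
  \<open>r\<^sup>2\<close> of the magnetic potential, that of \<open>y\<close> is the Jacobian of
  \<open>jj_scale\<close>. Together they make the kernel symmetric.\<close>

lemma newton5_lift:
  assumes [measurable]: "g \<in> borel_measurable borel" and g: "\<And>p. g p \<ge> 0"
  shows "ennreal ((cyl_r x)\<^sup>2) * (\<integral>\<^sup>+y. ennreal (1 / norm (hat5 x - y) ^ 3 * g (d5 y, y $ 3)) \<partial>lborel)
    = (\<integral>\<^sup>+y. k5e x y * ennreal (g (cyl_r y, y $ 3)) \<partial>lborel)"
\<comment> \<open>On the axis both sides vanish; elsewhere the horizontal part of \<open>x\<close>
  is nonzero, as \<open>jj_scale\<close> demands.\<close>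
proof (cases "cyl_r x = 0")
  case True
  then show ?thesis by (simp add: k5e_def)
next
  case False
  let ?x = "vector [x $ 1, x $ 2] :: real^2"
  have x0: "?x \<noteq> 0" and nx: "norm ?x = cyl_r x"
    using False by (auto simp: cyl_r_def vec_eq_iff forall_2 norm_vec2)
  have [measurable]: "g \<in> borel_measurable (borel \<Otimes>\<^sub>M borel)" by (simp add: borel_prod)
  let ?P = "\<lambda>s t. (cyl_r x)\<^sup>2 + s\<^sup>2 + (x $ 3 - t)\<^sup>2"
  let ?K = "\<lambda>p::(real^2) \<times> real \<times> real. ennreal (1 / sqrt (?P (snd (snd p)) (fst (snd p)) - 2 * (?x \<bullet> fst p)) ^ 3
     * g (snd (snd p), fst (snd p)))"
  have "(\<integral>\<^sup>+y. ennreal (1 / norm (hat5 x - y) ^ 3 * g (d5 y, y $ 3)) \<partial>lborel)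
     = (\<integral>\<^sup>+y. ?K (vector [y $ 1, y $ 2], y $ 3, d5 y) \<partial>lborel)"
    unfolding norm_hat5_diff by simp
  also have "\<dots> = (\<integral>\<^sup>+y. \<integral>\<^sup>+a. ?K (a, y $ 3, cyl_r y) * indicator {a. norm a \<le> cyl_r y} a \<partial>lborel \<partial>lborel)"
    by (rule nn_integral_R5) (simp add: borel_prod[symmetric])
  also have "\<dots> = (\<integral>\<^sup>+y. ennreal (g (cyl_r y, y $ 3)) * (ennreal ((cyl_r y)\<^sup>2) * jj (?P (cyl_r y) (y $ 3)) (2 * norm ?x * cyl_r y)) \<partial>lborel)"
  proof (rule nn_integral_cong)
    fix y :: "real ^ 3"
    have [measurable]: "cball (0::real^2) (cyl_r y) \<in> sets borel" by simp
    have c: "{a::real^2. norm a \<le> cyl_r y} = cball 0 (cyl_r y)" by auto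
    have "(\<integral>\<^sup>+a. ?K (a, y $ 3, cyl_r y) * indicator {a. norm a \<le> cyl_r y} a \<partial>lborel)
      = (\<integral>\<^sup>+a. ennreal (g (cyl_r y, y $ 3)) * (ennreal (1 / sqrt (?P (cyl_r y) (y $ 3) - 2 * (?x \<bullet> a)) ^ 3) * indicator {a. norm a \<le> cyl_r y} a) \<partial>lborel)"
    proof (rule nn_integral_cong)
      have *: "ennreal (c * g p) = ennreal (g p) * ennreal c" for c p
        using ennreal_mult'[OF g, of p c] by (simp add: mult.commute)
      show "?K (a, y $ 3, cyl_r y) * indicator {a. norm a \<le> cyl_r y} a
        = ennreal (g (cyl_r y, y $ 3)) * (ennreal (1 / sqrt (?P (cyl_r y) (y $ 3) - 2 * (?x \<bullet> a)) ^ 3) * indicator {a. norm a \<le> cyl_r y} a)" for a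
        unfolding * fst_conv snd_conv by (simp only: mult.assoc)
    qed
    also have "\<dots> = ennreal (g (cyl_r y, y $ 3)) * (\<integral>\<^sup>+a. ennreal (1 / sqrt (?P (cyl_r y) (y $ 3) - 2 * (?x \<bullet> a)) ^ 3) * indicator {a. norm a \<le> cyl_r y} a \<partial>lborel)"
      unfolding c by (rule nn_integral_cmult) simp
    finally show "(\<integral>\<^sup>+a. ?K (a, y $ 3, cyl_r y) * indicator {a. norm a \<le> cyl_r y} a \<partial>lborel)
      = ennreal (g (cyl_r y, y $ 3)) * (ennreal ((cyl_r y)\<^sup>2) * jj (?P (cyl_r y) (y $ 3)) (2 * norm ?x * cyl_r y))"
      by (simp only: jj_scale[OF cyl_r_nonneg x0])
  qed
  finally show ?thesis
    by (simp add: nn_integral_cmult[symmetric] k5e_def nx ennreal_mult' mult_ac)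
qed

section \<open>Bounds for the magnetic and the Newtonian kernel\<close>

definition C0 :: ennreal where
  "C0 = (\<integral>\<^sup>+w. om (7/8) (1 - w $ 1) * om (3/4) (w $ 2) * indicator (cball (0::real^2) 1) w \<partial>lborel)"

text \<open>\<open>C0\<close> is what remains of the disc integral once the singularities in radius
  and height are pulled out. Enlarging the disc to a box separates the variables, and both exponents
  are below 1.\<close>

lemma C0_finite: "C0 < \<infinity>"
proof -
  define f where "f i t = (if i = (1::2) then om (7/8) (1 - t) * indicator {-2..2} (1 - t) else om (3/4) t * indicator {-1..1} t)" for i t
  have [measurable]: "f i \<in> borel_measurable borel" for i
    unfolding f_def by (cases "i = 1") auto
  have "C0 \<le> (\<integral>\<^sup>+w. (\<Prod>i\<in>UNIV. f i (w $ i)) \<partial>(lborel :: (real^2) measure))"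
    unfolding C0_def
  proof (rule nn_integral_mono)
    fix w :: "real^2"
    have "\<bar>w $ 1\<bar> \<le> 1 \<and> \<bar>w $ 2\<bar> \<le> 1" if "w \<in> cball 0 1"
      using component_le_norm_cart[of w 1] component_le_norm_cart[of w 2] that by auto
    then show "om (7/8) (1 - w $ 1) * om (3/4) (w $ 2) * indicator (cball 0 1) w \<le> (\<Prod>i\<in>UNIV. f i (w $ i))"
      by (auto simp: UNIV_2 f_def indicator_def)
  qed
  also have "\<dots> = omI (7/8) 2 * omI (3/4) 1"
  proof -
    have 1: "(\<integral>\<^sup>+t. om (7/8) (1 - t) * indicator {-2..2} (1 - t) \<partial>lborel) = omI (7/8) 2"
      unfolding omI_def using nn_integral_real_affine[of "\<lambda>t. om (7/8) t * indicator {-2..2} t" "-1" 1] by simp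
    show ?thesis
    proof (subst nn_integral_prod_vec)
      have "f 1 = (\<lambda>t. om (7/8) (1 - t) * indicator {-2..2} (1 - t))" "f 2 = (\<lambda>t. om (3/4) t * indicator {-1..1} t)"
        by (auto simp: f_def)
      then have "integral\<^sup>N lborel (f 1) = omI (7/8) 2" "integral\<^sup>N lborel (f 2) = omI (3/4) 1"
        by (simp_all only: 1) (simp add: omI_def)
      then show "(\<Prod>i\<in>UNIV. integral\<^sup>N lborel (f i)) = omI (7/8) 2 * omI (3/4) 1"
        by (simp add: UNIV_2)
    qed simp
  qed
  also have "\<dots> < \<infinity>" using omI_finite[of "7/8" 2] omI_finite[of "3/4" 1] by (simp add: ennreal_mult_less_top)
  finally show ?thesis .
qed

text \<open>The squared distance is
  \<open>(r - s)\<^sup>2 + z\<^sup>2 + 2 * r * s * (1 - w $ 1)\<close>, to which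
  \<open>powr_sum3_le\<close> applies. The factor \<open>(r * s)\<^sup>2\<close> absorbs the
  negative power of \<open>r * s\<close>, so the bound is uniform up to the axis.\<close>

lemma k5_pointwise:
  fixes r s :: real
  assumes r: "0 \<le> r" "r < R" and s: "0 \<le> s" "s < R" and w: "norm (w :: real^2) \<le> 1"
  shows "ennreal (r\<^sup>2 * s\<^sup>2) * ennreal (1 / sqrt (r\<^sup>2 + s\<^sup>2 + z\<^sup>2 - 2 * r * s * w $ 1) ^ 3)
    \<le> ennreal ((2 * R) powr (1/4) * (R\<^sup>2) powr (3/4)) * om (1/4) (r\<^sup>2 - s\<^sup>2) * om (1/4) z * (om (7/8) (1 - w $ 1) * om (3/4) (w $ 2))"
    (is "_ \<le> ennreal ?D * _ * _ * _")
proof -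
  have D: "?D > 0" using r by simp
  \<comment> \<open>If \<open>r * s = 0\<close> the left side is zero; in the other degenerate cases
    a factor \<open>om\<close> makes the right side infinite, so the default value of division by
    zero does no harm.\<close>
  consider "r * s = 0" | "r\<^sup>2 = s\<^sup>2 \<or> z = 0 \<or> w $ 1 = 1 \<or> w $ 2 = 0" | "r * s \<noteq> 0" "r\<^sup>2 \<noteq> s\<^sup>2" "z \<noteq> 0" "w $ 1 \<noteq> 1" "w $ 2 \<noteq> 0" by blast
  then show ?thesis
  proof cases
    case 1 then show ?thesis by auto
  next
    case 2
    have "om p 0 = \<infinity>" for p by (simp add: om_def)
    with 2 have "ennreal ?D * om (1/4) (r\<^sup>2 - s\<^sup>2) * om (1/4) z * (om (7/8) (1 - w $ 1) * om (3/4) (w $ 2)) = \<infinity>"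
      using D om_pos by (auto simp: ennreal_top_mult ennreal_mult_top ennreal_mult_eq_top_iff zero_less_iff_neq_zero)
    then show ?thesis by simp
  next
    case 3
    have pos: "r > 0" "s > 0" "r * s > 0" using 3 r s by auto
    have w2: "(w $ 1)\<^sup>2 + (w $ 2)\<^sup>2 \<le> 1" using w by (simp add: norm_vec2)
    have w1: "\<bar>w $ 1\<bar> \<le> 1" using component_le_norm_cart[of w 1] w by linarith
    then have u: "1 - w $ 1 > 0" using 3 by auto
    \<comment> \<open>On the disc \<open>1 - w $ 1\<close> is at least half the square of
      \<open>w $ 2\<close>. The exponent 5/4, too large for one variable, is split accordingly: 7/8
      stays, and 3/8 becomes the exponent 3/4 of \<open>w $ 2\<close>.\<close>
    have "(1 - w $ 1) * (1 + w $ 1) \<le> (1 - w $ 1) * 2" using u w1 by (intro mult_left_mono) auto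
    then have w2b: "(w $ 2)\<^sup>2 / 2 \<le> 1 - w $ 1" using w2 by (simp add: power2_eq_square algebra_simps)
    have rs: "r \<noteq> s" using 3 by auto
    let ?A = "(r - s)\<^sup>2" and ?B = "z\<^sup>2" and ?C = "2 * r * s * (1 - w $ 1)"
    have ABC: "?A > 0" "?B > 0" "?C > 0" using rs 3 pos u by auto
    have sq8: "(t\<^sup>2) powr (-1/8) = \<bar>t\<bar> powr (-1/4)" if "t \<noteq> 0" for t :: real
    proof -
      have "t\<^sup>2 = \<bar>t\<bar> powr 2" using that by simp
      then show ?thesis by (simp only: powr_powr) simp
    qed
    have "r\<^sup>2 + s\<^sup>2 + z\<^sup>2 - 2 * r * s * w $ 1 = ?A + ?B + ?C"
      by (simp add: power2_eq_square algebra_simps)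
    then have eq: "1 / sqrt (r\<^sup>2 + s\<^sup>2 + z\<^sup>2 - 2 * r * s * w $ 1) ^ 3 = 1 / sqrt (?A + ?B + ?C) ^ 3"
      by (simp only:)
    have "r\<^sup>2 * s\<^sup>2 * (1 / sqrt (r\<^sup>2 + s\<^sup>2 + z\<^sup>2 - 2 * r * s * w $ 1) ^ 3)
      \<le> (r * s)\<^sup>2 * (?A powr (-1/8) * ?B powr (-1/8) * ?C powr (-5/4))"
      unfolding eq power_mult_distrib by (intro mult_left_mono powr_sum3_le ABC) simp
    also have "?A powr (-1/8) = \<bar>r - s\<bar> powr (-1/4)" using sq8[of "r - s"] rs by simp
    also have "?B powr (-1/8) = \<bar>z\<bar> powr (-1/4)" using sq8[of z] 3 by simp
    also have "?C powr (-5/4) = 2 powr (-5/4) * (r * s) powr (-5/4) * (1 - w $ 1) powr (-5/4)"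
      using pos u by (simp add: powr_mult mult.assoc)
    also have "(r * s)\<^sup>2 * (\<bar>r - s\<bar> powr (-1/4) * \<bar>z\<bar> powr (-1/4) * (2 powr (-5/4) * (r * s) powr (-5/4) * (1 - w $ 1) powr (-5/4)))
      = 2 powr (-5/4) * (((r * s) powr 2 * (r * s) powr (-5/4)) * \<bar>r - s\<bar> powr (-1/4) * \<bar>z\<bar> powr (-1/4) * (1 - w $ 1) powr (-5/4))"
      using pos by simp
    also have "(r * s) powr 2 * (r * s) powr (-5/4) = (r * s) powr (3/4)"
      by (simp add: powr_add[symmetric])
    also have "2 powr (-5/4) * ((r * s) powr (3/4) * \<bar>r - s\<bar> powr (-1/4) * \<bar>z\<bar> powr (-1/4) * (1 - w $ 1) powr (-5/4))
       \<le> 2 powr (-5/4) * ((R\<^sup>2) powr (3/4) * ((2 * R) powr (1/4) * \<bar>r\<^sup>2 - s\<^sup>2\<bar> powr (-1/4)) * \<bar>z\<bar> powr (-1/4)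
           * ((1 - w $ 1) powr (-7/8) * (2 powr (3/8) * \<bar>w $ 2\<bar> powr (-3/4))))"
    proof (intro mult_mono order_refl mult_nonneg_nonneg powr_ge_zero)
      show "(r * s) powr (3/4) \<le> (R\<^sup>2) powr (3/4)"
        using pos r s by (intro powr_mono2) (auto simp: power2_eq_square intro!: mult_mono)
      \<comment> \<open>The difference of radii is traded for that of their squares, at the cost of
        a power of \<open>2 * R\<close>, because planar measure is uniform in the squared
        radius.\<close>
      have "\<bar>r\<^sup>2 - s\<^sup>2\<bar> = \<bar>r - s\<bar> * (r + s)"
        using pos by (simp add: power2_eq_square square_diff_square_factored abs_mult)
      then have "\<bar>r\<^sup>2 - s\<^sup>2\<bar> powr (-1/4) = \<bar>r - s\<bar> powr (-1/4) * (r + s) powr (-1/4)"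
        using pos by (simp add: powr_mult)
      then have "\<bar>r - s\<bar> powr (-1/4) = (r + s) powr (1/4) * \<bar>r\<^sup>2 - s\<^sup>2\<bar> powr (-1/4)"
        using pos by (simp add: powr_add[symmetric] mult.left_commute)
      also have "\<dots> \<le> (2 * R) powr (1/4) * \<bar>r\<^sup>2 - s\<^sup>2\<bar> powr (-1/4)"
        using pos r s by (intro mult_right_mono powr_mono2) auto
      finally show "\<bar>r - s\<bar> powr (-1/4) \<le> (2 * R) powr (1/4) * \<bar>r\<^sup>2 - s\<^sup>2\<bar> powr (-1/4)" .
      have "(1 - w $ 1) powr (-5/4) = (1 - w $ 1) powr (-7/8) * (1 - w $ 1) powr (-3/8)"
        by (simp add: powr_add[symmetric])
      also have "\<dots> \<le> (1 - w $ 1) powr (-7/8) * ((w $ 2)\<^sup>2 / 2) powr (-3/8)"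
        using w2b 3 by (intro mult_left_mono powr_mono2') auto
      also have "((w $ 2)\<^sup>2 / 2) powr (-3/8) = 2 powr (3/8) * \<bar>w $ 2\<bar> powr (-3/4)"
      proof -
        have "(w $ 2)\<^sup>2 / 2 = \<bar>w $ 2\<bar> powr 2 * 2 powr (-1)" using 3 by (simp add: powr_minus_divide)
        also have "\<dots> powr (-3/8) = 2 powr (3/8) * \<bar>w $ 2\<bar> powr (-3/4)"
          unfolding powr_mult powr_powr by (simp add: mult.commute)
        finally show ?thesis .
      qed
      finally show "(1 - w $ 1) powr (-5/4) \<le> (1 - w $ 1) powr (-7/8) * (2 powr (3/8) * \<bar>w $ 2\<bar> powr (-3/4))" .
    qed
    also have "\<dots> = (2 powr (-5/4) * 2 powr (3/8)) * (?D * \<bar>r\<^sup>2 - s\<^sup>2\<bar> powr (-1/4) * \<bar>z\<bar> powr (-1/4)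
           * ((1 - w $ 1) powr (-7/8) * \<bar>w $ 2\<bar> powr (-3/4)))" by (simp only: mult_ac)
    also have "\<dots> \<le> 1 * (?D * \<bar>r\<^sup>2 - s\<^sup>2\<bar> powr (-1/4) * \<bar>z\<bar> powr (-1/4)
           * ((1 - w $ 1) powr (-7/8) * \<bar>w $ 2\<bar> powr (-3/4)))"
    proof (rule mult_right_mono)
      have "2 powr (-5/4) * 2 powr (3/8) = (2::real) powr (-7/8)" by (simp add: powr_add[symmetric])
      also have "\<dots> \<le> 2 powr 0" by (intro powr_mono) auto
      finally show "2 powr (-5/4) * 2 powr (3/8) \<le> (1::real)" by simp
    qed (use D in auto)
    finally have "r\<^sup>2 * s\<^sup>2 * (1 / sqrt (r\<^sup>2 + s\<^sup>2 + z\<^sup>2 - 2 * r * s * w $ 1) ^ 3)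
       \<le> ?D * \<bar>r\<^sup>2 - s\<^sup>2\<bar> powr (-1/4) * \<bar>z\<bar> powr (-1/4) * ((1 - w $ 1) powr (-7/8) * \<bar>w $ 2\<bar> powr (-3/4))"
      by simp
    then have le: "ennreal (r\<^sup>2 * s\<^sup>2 * (1 / sqrt (r\<^sup>2 + s\<^sup>2 + z\<^sup>2 - 2 * r * s * w $ 1) ^ 3))
       \<le> ennreal (?D * \<bar>r\<^sup>2 - s\<^sup>2\<bar> powr (-1/4) * \<bar>z\<bar> powr (-1/4) * ((1 - w $ 1) powr (-7/8) * \<bar>w $ 2\<bar> powr (-3/4)))"
      by (rule ennreal_leI)
    show ?thesis
    proof -
      have om': "om (1/4) (r\<^sup>2 - s\<^sup>2) = ennreal (\<bar>r\<^sup>2 - s\<^sup>2\<bar> powr (-1/4))" "om (1/4) z = ennreal (\<bar>z\<bar> powr (-1/4))"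
        "om (7/8) (1 - w $ 1) = ennreal ((1 - w $ 1) powr (-7/8))" "om (3/4) (w $ 2) = ennreal (\<bar>w $ 2\<bar> powr (-3/4))"
        using 3 u by (simp_all add: om_def)
      show ?thesis
        unfolding om' using le
        by (simp only: ennreal_mult'[symmetric] mult_nonneg_nonneg powr_ge_zero zero_le_power2)
    qed
  qed
qed

lemma k5e_bound:
  assumes x: "cyl_r x < R" and y: "cyl_r y < R"
  shows "k5e x y \<le> ennreal ((2 * R) powr (1/4) * (R\<^sup>2) powr (3/4)) * C0 *
     (om (1/4) ((cyl_r x)\<^sup>2 - (cyl_r y)\<^sup>2) * om (1/4) (x $ 3 - y $ 3))" (is "_ \<le> ?D * C0 * ?o")
proof -
  have [measurable]: "cball (0::real^2) 1 \<in> sets borel" by simp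
  let ?r = "cyl_r x" and ?s = "cyl_r y" and ?z = "x $ 3 - y $ 3"
  have "k5e x y = (\<integral>\<^sup>+w. ennreal (?r\<^sup>2 * ?s\<^sup>2) * (ennreal (1 / sqrt (?r\<^sup>2 + ?s\<^sup>2 + ?z\<^sup>2 - 2 * ?r * ?s * (w $ 1)) ^ 3) * indicator (cball (0::real^2) 1) w) \<partial>lborel)"
    unfolding k5e_def jj_def by (rule nn_integral_cmult[symmetric]) simp
  also have "\<dots> \<le> (\<integral>\<^sup>+w. ?D * ?o * (om (7/8) (1 - w $ 1) * om (3/4) (w $ 2) * indicator (cball (0::real^2) 1) w) \<partial>lborel)"
  proof (rule nn_integral_mono)
    fix w :: "real^2"
    show "ennreal (?r\<^sup>2 * ?s\<^sup>2) * (ennreal (1 / sqrt (?r\<^sup>2 + ?s\<^sup>2 + ?z\<^sup>2 - 2 * ?r * ?s * (w $ 1)) ^ 3) * indicator (cball (0::real^2) 1) w)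
      \<le> ?D * ?o * (om (7/8) (1 - w $ 1) * om (3/4) (w $ 2) * indicator (cball (0::real^2) 1) w)"
    proof (cases "norm w \<le> 1")
      case True
      then show ?thesis
        using k5_pointwise[OF cyl_r_nonneg x cyl_r_nonneg y True, of ?z] by (simp add: mult.assoc)
    qed (simp add: indicator_def)
  qed
  also have "\<dots> = ?D * ?o * C0"
    unfolding C0_def by (rule nn_integral_cmult) simp
  finally show ?thesis by (simp add: mult_ac)
qed

text \<open>The distance is at least the height difference, which is at least 1, so its cube may be
  replaced by the first power; this weaker decay is the one that the Newtonian kernel shares. The
  constant is \<open>R ^ 4\<close>, from the squared radii, times the area of the disc.\<close>

lemma k5e_far:
  assumes x: "cyl_r x < R" and y: "cyl_r y < R" and z: "\<bar>x $ 3 - y $ 3\<bar> \<ge> 1"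
  shows "k5e x y \<le> ennreal (R ^ 4 * pi / \<bar>x $ 3 - y $ 3\<bar>)"
proof -
  have [measurable]: "cball (0::real^2) 1 \<in> sets borel" by simp
  let ?r = "cyl_r x" and ?s = "cyl_r y" and ?z = "x $ 3 - y $ 3"
  have R: "0 < R" using x cyl_r_nonneg[of x] by linarith
  have "jj (?r\<^sup>2 + ?s\<^sup>2 + ?z\<^sup>2) (2 * ?r * ?s) \<le> (\<integral>\<^sup>+w. ennreal (1 / \<bar>?z\<bar>) * indicator (cball (0::real^2) 1) w \<partial>lborel)"
    unfolding jj_def
  proof (intro nn_integral_mono)
    fix w :: "real^2" assume "w \<in> space lborel"
    show "ennreal (1 / sqrt (?r\<^sup>2 + ?s\<^sup>2 + ?z\<^sup>2 - 2 * ?r * ?s * w $ 1) ^ 3) * indicator (cball 0 1) w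
      \<le> ennreal (1 / \<bar>?z\<bar>) * indicator (cball 0 1) w"
    proof (cases "norm w \<le> 1")
      case True
      have "w $ 1 \<le> 1" using component_le_norm_cart[of w 1] True by linarith
      then have "?r * ?s * w $ 1 \<le> ?r * ?s * 1" by (intro mult_left_mono) auto
      moreover have "?r\<^sup>2 + ?s\<^sup>2 - 2 * (?r * ?s) \<ge> 0" using zero_le_power2[of "?r - ?s"] by (simp add: power2_diff)
      ultimately have "?z\<^sup>2 \<le> ?r\<^sup>2 + ?s\<^sup>2 + ?z\<^sup>2 - 2 * ?r * ?s * w $ 1" by simp
      then have le: "\<bar>?z\<bar> \<le> sqrt (?r\<^sup>2 + ?s\<^sup>2 + ?z\<^sup>2 - 2 * ?r * ?s * w $ 1)" (is "_ \<le> ?q") by (metis real_sqrt_abs real_sqrt_le_mono)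
      then have "\<bar>?z\<bar> \<le> ?q ^ 1" by simp
      also have "\<dots> \<le> ?q ^ 3" by (rule power_increasing[OF _ order_trans[OF z le]]) simp
      finally have q3: "\<bar>?z\<bar> \<le> ?q ^ 3" .
      have "1 / ?q ^ 3 \<le> 1 / \<bar>?z\<bar>"
        by (rule divide_left_mono[OF q3 _ mult_pos_pos]) (use z q3 in linarith)+
      then show ?thesis using True by (simp add: ennreal_leI)
    qed (simp add: indicator_def)
  qed
  also have "\<dots> = ennreal (1 / \<bar>?z\<bar>) * ennreal pi"
    by (simp add: nn_integral_cmult_indicator emeasure_cball unit_ball_vol_2)
  finally have "k5e x y \<le> ennreal (?r\<^sup>2 * ?s\<^sup>2) * (ennreal (1 / \<bar>?z\<bar>) * ennreal pi)"
    unfolding k5e_def by (intro mult_left_mono) auto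
  also have "\<dots> \<le> ennreal (R\<^sup>2 * R\<^sup>2) * (ennreal (1 / \<bar>?z\<bar>) * ennreal pi)"
    using x y by (intro mult_right_mono ennreal_leI mult_mono power_mono) auto
  also have "\<dots> = ennreal (R ^ 4 * pi / \<bar>?z\<bar>)"
    using R by (simp add: ennreal_mult[symmetric] power2_eq_square power4_eq_xxxx mult_ac)
  finally show ?thesis .
qed

definition cyl :: "real \<Rightarrow> (real ^ 3) set" where
  "cyl R = {x. cyl_r x < R}"

definition slab :: "real ^ 3 \<Rightarrow> (real ^ 3) set" where
  "slab x = {y. \<bar>x $ 3 - y $ 3\<bar> < 1}"

lemma cyl_sets [measurable]: "cyl R \<in> sets borel"
  unfolding cyl_def by measurable

lemma slab_sets [measurable]: "slab x \<in> sets borel"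
  unfolding slab_def by measurable

text \<open>Squaring turns the exponents 1/4 of \<open>k5e_bound\<close> into 1/2, still integrable
  in one variable. In cylindrical coordinates the integral factors into one over the height and one
  over the squared radius.\<close>

lemma k5e_near:
  assumes x: "x \<in> cyl R"
  shows "(\<integral>\<^sup>+y. (k5e x y)\<^sup>2 * indicator (cyl R \<inter> slab x) y \<partial>lborel)
    \<le> (ennreal ((2 * R) powr (1/4) * (R\<^sup>2) powr (3/4)) * C0)\<^sup>2 * (ennreal pi * omI (1/2) (R\<^sup>2) * omI (1/2) 1)"
    (is "_ \<le> ?D\<^sup>2 * _")
proof -
  have R: "R > 0" using x le_less_trans[OF cyl_r_nonneg[of x]] by (simp add: cyl_def)
  let ?r = "cyl_r x"
  have "(\<integral>\<^sup>+y. (k5e x y)\<^sup>2 * indicator (cyl R \<inter> slab x) y \<partial>lborel)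
    \<le> (\<integral>\<^sup>+y. ?D\<^sup>2 * (om (1/2) (?r\<^sup>2 - (cyl_r y)\<^sup>2) * om (1/2) (x $ 3 - y $ 3) * indicator (cyl R \<inter> slab x) y) \<partial>lborel)"
  proof (rule nn_integral_mono)
    fix y
    show "(k5e x y)\<^sup>2 * indicator (cyl R \<inter> slab x) y \<le> ?D\<^sup>2 * (om (1/2) (?r\<^sup>2 - (cyl_r y)\<^sup>2) * om (1/2) (x $ 3 - y $ 3) * indicator (cyl R \<inter> slab x) y)"
    proof (cases "y \<in> cyl R \<inter> slab x")
      case True
      then have "k5e x y \<le> ?D * (om (1/4) (?r\<^sup>2 - (cyl_r y)\<^sup>2) * om (1/4) (x $ 3 - y $ 3))"
        using x by (intro k5e_bound) (auto simp: cyl_def)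
      then have "(k5e x y)\<^sup>2 \<le> (?D * (om (1/4) (?r\<^sup>2 - (cyl_r y)\<^sup>2) * om (1/4) (x $ 3 - y $ 3)))\<^sup>2"
        by (intro power_mono) auto
      also have "\<dots> = ?D\<^sup>2 * (om (1/2) (?r\<^sup>2 - (cyl_r y)\<^sup>2) * om (1/2) (x $ 3 - y $ 3))"
        unfolding power_mult_distrib om_sq by simp
      finally show ?thesis using True by simp
    qed simp
  qed
  also have "\<dots> = ?D\<^sup>2 * (\<integral>\<^sup>+y. om (1/2) (?r\<^sup>2 - (cyl_r y)\<^sup>2) * om (1/2) (x $ 3 - y $ 3) * indicator (cyl R \<inter> slab x) y \<partial>lborel)"
    by (rule nn_integral_cmult) simp
  also have "(\<integral>\<^sup>+y. om (1/2) (?r\<^sup>2 - (cyl_r y)\<^sup>2) * om (1/2) (x $ 3 - y $ 3) * indicator (cyl R \<inter> slab x) y \<partial>lborel)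
    \<le> (\<integral>\<^sup>+a. \<integral>\<^sup>+t. (om (1/2) ((norm (a::real^2))\<^sup>2 - ?r\<^sup>2) * indicator {-R\<^sup>2..R\<^sup>2} ((norm a)\<^sup>2 - ?r\<^sup>2)) *
          (om (1/2) (t - x $ 3) * indicator {-1..1} (t - x $ 3)) \<partial>lborel \<partial>lborel)"
  proof (subst nn_integral_emb3)
    show "(\<integral>\<^sup>+a. \<integral>\<^sup>+t. om (1/2) (?r\<^sup>2 - (cyl_r (emb3 (a, t)))\<^sup>2) * om (1/2) (x $ 3 - emb3 (a, t) $ 3) * indicator (cyl R \<inter> slab x) (emb3 (a, t)) \<partial>lborel \<partial>lborel)
      \<le> (\<integral>\<^sup>+a. \<integral>\<^sup>+t. (om (1/2) ((norm (a::real^2))\<^sup>2 - ?r\<^sup>2) * indicator {-R\<^sup>2..R\<^sup>2} ((norm a)\<^sup>2 - ?r\<^sup>2)) *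
          (om (1/2) (t - x $ 3) * indicator {-1..1} (t - x $ 3)) \<partial>lborel \<partial>lborel)"
    proof (intro nn_integral_mono)
      fix a :: "real^2" and t :: real
      have "(norm a)\<^sup>2 - ?r\<^sup>2 \<in> {-R\<^sup>2..R\<^sup>2} \<and> t - x $ 3 \<in> {-1..1}" if "emb3 (a, t) \<in> cyl R \<inter> slab x"
      proof -
        have "norm a < R" "\<bar>x $ 3 - t\<bar> < 1" using that by (auto simp: cyl_def slab_def)
        moreover have "?r\<^sup>2 \<le> R\<^sup>2" using x by (intro power_mono) (auto simp: cyl_def)
        moreover have "(norm a)\<^sup>2 \<le> R\<^sup>2" using \<open>norm a < R\<close> by (intro power_mono) auto
        moreover have "0 \<le> ?r\<^sup>2" "0 \<le> (norm a)\<^sup>2" by auto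
        ultimately show ?thesis unfolding atLeastAtMost_iff by (intro conjI; linarith)
      qed
      then show "om (1/2) (?r\<^sup>2 - (cyl_r (emb3 (a, t)))\<^sup>2) * om (1/2) (x $ 3 - emb3 (a, t) $ 3) * indicator (cyl R \<inter> slab x) (emb3 (a, t))
       \<le> (om (1/2) ((norm (a::real^2))\<^sup>2 - ?r\<^sup>2) * indicator {-R\<^sup>2..R\<^sup>2} ((norm a)\<^sup>2 - ?r\<^sup>2)) *
          (om (1/2) (t - x $ 3) * indicator {-1..1} (t - x $ 3))"
        by (cases "emb3 (a, t) \<in> cyl R \<inter> slab x")
           (simp_all add: om_minus[of "1/2" "?r\<^sup>2"] om_minus[of "1/2" "x $ 3"])
    qed
  qed simp
  also have "\<dots> = (\<integral>\<^sup>+a. (om (1/2) ((norm (a::real^2))\<^sup>2 - ?r\<^sup>2) * indicator {-R\<^sup>2..R\<^sup>2} ((norm a)\<^sup>2 - ?r\<^sup>2)) * omI (1/2) 1 \<partial>lborel)"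
    by (simp add: nn_integral_cmult omI_shift)
  also have "\<dots> = (\<integral>\<^sup>+a. om (1/2) ((norm (a::real^2))\<^sup>2 - ?r\<^sup>2) * indicator {-R\<^sup>2..R\<^sup>2} ((norm a)\<^sup>2 - ?r\<^sup>2) \<partial>lborel) * omI (1/2) 1"
    by (rule nn_integral_multc) simp
  also have "(\<integral>\<^sup>+a. om (1/2) ((norm (a::real^2))\<^sup>2 - ?r\<^sup>2) * indicator {-R\<^sup>2..R\<^sup>2} ((norm a)\<^sup>2 - ?r\<^sup>2) \<partial>lborel)
     = ennreal pi * (\<integral>\<^sup>+s. om (1/2) (s - ?r\<^sup>2) * indicator {-R\<^sup>2..R\<^sup>2} (s - ?r\<^sup>2) * indicator {0..} s \<partial>lborel)"
    by (rule nn_integral_norm_sq[of "\<lambda>s. om (1/2) (s - ?r\<^sup>2) * indicator {-R\<^sup>2..R\<^sup>2} (s - ?r\<^sup>2)"]) simp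
  also have "\<dots> \<le> ennreal pi * (\<integral>\<^sup>+s. om (1/2) (s - ?r\<^sup>2) * indicator {-R\<^sup>2..R\<^sup>2} (s - ?r\<^sup>2) \<partial>lborel)"
    by (intro mult_left_mono nn_integral_mono) (auto simp: indicator_def)
  also have "\<dots> = ennreal pi * omI (1/2) (R\<^sup>2)" by (simp only: omI_shift)
  finally show ?thesis by (simp add: mult_left_mono mult_right_mono)
qed

text \<open>The norm dominates each of the three coordinates, so its power -2 is at most a product
  of three powers -2/3, each integrable in one variable.\<close>

lemma k3_near:
  assumes x: "x \<in> cyl R"
  shows "(\<integral>\<^sup>+y. ennreal ((1 / norm (x - y))\<^sup>2) * indicator (cyl R \<inter> slab x) y \<partial>lborel) \<le> omI (2/3) (2 * R + 1) ^ 3"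
proof -
  have R: "R > 0" using x le_less_trans[OF cyl_r_nonneg[of x]] by (simp add: cyl_def)
  \<comment> \<open>Inside the cylinder horizontal coordinates differ by less than
    \<open>2 * R\<close>, inside the slab heights differ by less than 1.\<close>
  let ?L = "2 * R + 1"
  let ?f = "\<lambda>i t. om (2/3) (t - x $ i) * indicator {-?L..?L} (t - x $ i)"
  have "(\<integral>\<^sup>+y. ennreal ((1 / norm (x - y))\<^sup>2) * indicator (cyl R \<inter> slab x) y \<partial>lborel)
     \<le> (\<integral>\<^sup>+y. (\<Prod>i\<in>UNIV. ?f i (y $ i)) \<partial>(lborel :: (real^3) measure))"
  proof (rule nn_integral_mono)
    fix y :: "real^3"
    show "ennreal ((1 / norm (x - y))\<^sup>2) * indicator (cyl R \<inter> slab x) y \<le> (\<Prod>i\<in>UNIV. ?f i (y $ i))"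
    proof (cases "y \<in> cyl R \<inter> slab x")
      case True
      have c: "\<bar>v $ 1\<bar> < R \<and> \<bar>v $ 2\<bar> < R" if "v \<in> cyl R" for v :: "real^3"
      proof -
        have "\<bar>v $ 1\<bar> \<le> cyl_r v" "\<bar>v $ 2\<bar> \<le> cyl_r v" unfolding cyl_r_def by (auto intro!: real_le_rsqrt)
        then show ?thesis using that by (auto simp: cyl_def)
      qed
      have in_: "y $ i - x $ i \<in> {-?L..?L}" for i
        using c[OF x] c[of y] True R exhaust_3[of i] by (auto simp: slab_def)
      have "ennreal ((1 / norm (x - y))\<^sup>2) \<le> (\<Prod>i\<in>UNIV. om (2/3) (y $ i - x $ i))"
      proof (cases "\<forall>i. y $ i \<noteq> x $ i")
        case nz: True
        have "y \<noteq> x" using nz by auto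
        then have n: "norm (x - y) > 0" by simp
        have "(1 / norm (x - y))\<^sup>2 = norm (x - y) powr (-2)"
          using n by (simp add: powr_minus_divide power_divide)
        also have "\<dots> = norm (x - y) powr (-2/3) * norm (x - y) powr (-2/3) * norm (x - y) powr (-2/3)"
          by (simp add: powr_add[symmetric])
        also have "\<dots> \<le> \<bar>y $ 1 - x $ 1\<bar> powr (-2/3) * \<bar>y $ 2 - x $ 2\<bar> powr (-2/3) * \<bar>y $ 3 - x $ 3\<bar> powr (-2/3)"
        proof -
          have "norm (x - y) powr (-2/3) \<le> \<bar>y $ i - x $ i\<bar> powr (-2/3)" for i
            using nz[rule_format, of i] component_le_norm_cart[of "x - y" i] by (intro powr_mono2') (auto simp: abs_minus_commute)
          then show ?thesis by (intro mult_mono) auto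
        qed
        finally have "ennreal ((1 / norm (x - y))\<^sup>2) \<le> ennreal (\<bar>y $ 1 - x $ 1\<bar> powr (-2/3) * \<bar>y $ 2 - x $ 2\<bar> powr (-2/3) * \<bar>y $ 3 - x $ 3\<bar> powr (-2/3))"
          by (rule ennreal_leI)
        then show ?thesis unfolding UNIV_3 using nz by (simp add: om_def ennreal_mult' mult.assoc)
      next
        case False
        then obtain i where "om (2/3) (y $ i - x $ i) = \<infinity>" by (auto simp: om_def)
        moreover have "om (2/3) (y $ j - x $ j) \<noteq> 0" for j using om_pos[of "2/3" "y $ j - x $ j"] by auto
        ultimately have "(\<Prod>i\<in>UNIV. om (2/3) (y $ i - x $ i)) = \<infinity>"
          using exhaust_3[of i] unfolding UNIV_3 by (auto simp: ennreal_mult_eq_top_iff)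
        then show ?thesis by simp
      qed
      then show ?thesis using True in_ by simp
    qed simp
  qed
  also have "\<dots> = (\<Prod>i\<in>(UNIV :: 3 set). omI (2/3) ?L)"
    by (subst nn_integral_prod_vec, simp) (simp only: omI_shift)
  also have "\<dots> = omI (2/3) ?L ^ 3" by simp
  finally show ?thesis .
qed

section \<open>Weak compactness of tight sequences\<close>

lemma convergent_approx:
  fixes f :: "nat \<Rightarrow> real"
  assumes "\<And>\<epsilon>. \<epsilon> > 0 \<Longrightarrow> \<exists>g. convergent g \<and> (\<forall>i. \<bar>f i - g i\<bar> \<le> \<epsilon>)"
  shows "convergent f"
proof -
  have "Cauchy f"
  proof (rule metric_CauchyI)
    fix e :: real assume e: "e > 0"
    obtain g where g: "convergent g" "\<And>i. \<bar>f i - g i\<bar> \<le> e / 4" using assms[of "e / 4"] e by auto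
    have "Cauchy g" using g(1) by (simp add: Cauchy_convergent_iff)
    then obtain N where N: "\<And>m n. m \<ge> N \<Longrightarrow> n \<ge> N \<Longrightarrow> dist (g m) (g n) < e / 4"
      using e metric_CauchyD[of g "e / 4"] by auto
    have "dist (f m) (f n) < e" if "m \<ge> N" "n \<ge> N" for m n
      using N[OF that] g(2)[of m] g(2)[of n] e unfolding dist_real_def by linarith
    then show "\<exists>N. \<forall>m\<ge>N. \<forall>n\<ge>N. dist (f m) (f n) < e" by blast
  qed
  then show ?thesis by (simp add: Cauchy_convergent_iff)
qed

lemma tendsto_approx:
  fixes f :: "nat \<Rightarrow> real"
  assumes "\<And>\<epsilon>. \<epsilon> > 0 \<Longrightarrow> \<exists>g l. g \<longlonglongrightarrow> l \<and> (\<forall>i. \<bar>f i - g i\<bar> \<le> \<epsilon>) \<and> \<bar>L - l\<bar> \<le> \<epsilon>"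
  shows "f \<longlonglongrightarrow> L"
proof (rule metric_LIMSEQ_I)
  fix e :: real assume e: "e > 0"
  obtain g l where g: "g \<longlonglongrightarrow> l" "\<And>i. \<bar>f i - g i\<bar> \<le> e / 4" "\<bar>L - l\<bar> \<le> e / 4"
    using assms[of "e / 4"] e by auto
  obtain N where N: "\<And>n. n \<ge> N \<Longrightarrow> dist (g n) l < e / 4"
    using metric_LIMSEQ_D[OF g(1), of "e / 4"] e by auto
  have "dist (f n) L < e" if "n \<ge> N" for n
    using N[OF that] g(2)[of n] g(3) e unfolding dist_real_def by linarith
  then show "\<exists>N. \<forall>n\<ge>N. dist (f n) L < e" by blast
qed

lemma mult_le_weighted_squares:
  fixes a b t :: real
  assumes "t > 0" shows "a * b \<le> t / 2 * a\<^sup>2 + 1 / (2 * t) * b\<^sup>2"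
proof -
  have "0 \<le> (t * a - b)\<^sup>2" by simp
  then have "2 * t * (a * b) \<le> t\<^sup>2 * a\<^sup>2 + b\<^sup>2" by (simp add: power2_eq_square algebra_simps)
  then have "a * b \<le> (t\<^sup>2 * a\<^sup>2 + b\<^sup>2) / (2 * t)"
    using assms by (subst pos_le_divide_eq) (auto simp: mult_ac)
  also have "\<dots> = t / 2 * a\<^sup>2 + 1 / (2 * t) * b\<^sup>2"
    using assms by (simp add: add_divide_distrib power2_eq_square)
  finally show ?thesis .
qed

text \<open>Young's inequality with a free weight takes the place of Cauchy-Schwarz:
  \<open>t\<close> is chosen so that the term with the merely bounded L2 norm becomes small, and the
  other factor is made small afterwards.\<close>

lemma L2_product_bound:
  fixes f g :: "'a \<Rightarrow> real"
  assumes [measurable]: "f \<in> borel_measurable M" "g \<in> borel_measurable M"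
    and f: "integrable M (\<lambda>x. (f x)\<^sup>2)" and g: "integrable M (\<lambda>x. (g x)\<^sup>2)"
  shows "integrable M (\<lambda>x. f x * g x)"
    and "t > 0 \<Longrightarrow> (LINT x|M. \<bar>f x * g x\<bar>) \<le> t / 2 * (LINT x|M. (f x)\<^sup>2) + 1 / (2 * t) * (LINT x|M. (g x)\<^sup>2)"
proof -
  have le: "\<bar>f x * g x\<bar> \<le> t / 2 * (f x)\<^sup>2 + 1 / (2 * t) * (g x)\<^sup>2" if "t > 0" for x t
    using mult_le_weighted_squares[OF that, of "\<bar>f x\<bar>" "\<bar>g x\<bar>"] by (simp add: abs_mult)
  have i: "integrable M (\<lambda>x. t / 2 * (f x)\<^sup>2 + 1 / (2 * t) * (g x)\<^sup>2)" for t
    using f g by (intro Bochner_Integration.integrable_add integrable_mult_right) auto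
  show fg: "integrable M (\<lambda>x. f x * g x)"
    using le[of 1] by (intro Bochner_Integration.integrable_bound[OF i[of 1]]) (auto intro!: AE_I2 order_trans[OF _ abs_ge_self])
  show "(LINT x|M. \<bar>f x * g x\<bar>) \<le> t / 2 * (LINT x|M. (f x)\<^sup>2) + 1 / (2 * t) * (LINT x|M. (g x)\<^sup>2)" if "t > 0"
  proof -
    have "(LINT x|M. \<bar>f x * g x\<bar>) \<le> (LINT x|M. t / 2 * (f x)\<^sup>2 + 1 / (2 * t) * (g x)\<^sup>2)"
      using fg i le[OF that] by (intro integral_mono) auto
    also have "\<dots> = t / 2 * (LINT x|M. (f x)\<^sup>2) + 1 / (2 * t) * (LINT x|M. (g x)\<^sup>2)"
      using f g by (subst Bochner_Integration.integral_add) (auto intro!: integrable_mult_right)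
    finally show ?thesis .
  qed
qed

text \<open>Tightness is phrased with sets of finite measure; together with the L2 bound it gives
  equi-integrability.\<close>

locale tight_L2 =
  fixes u :: "nat \<Rightarrow> 'a::euclidean_space \<Rightarrow> real" and B m :: real
  assumes u_meas [measurable]: "\<And>i. u i \<in> borel_measurable borel"
    and u_nonneg: "\<And>i x. 0 \<le> u i x"
    and u_int: "\<And>i. integrable lborel (u i)"
    and u_mass: "\<And>i. (LINT x|lborel. u i x) = m"
    and u_sq: "\<And>i. integrable lborel (\<lambda>x. (u i x)\<^sup>2)"
    and u_nrm: "\<And>i. (LINT x|lborel. (u i x)\<^sup>2) \<le> B"
    and tight: "\<And>\<epsilon>. \<epsilon> > 0 \<Longrightarrow> \<exists>S. S \<in> sets borel \<and> emeasure lborel S < \<infinity> \<and>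
        (\<forall>i. (LINT x|lborel. u i x * indicator (- S) x) \<le> \<epsilon>)"
begin

definition U :: "nat \<Rightarrow> 'a set \<Rightarrow> real" where
  "U i A = (LINT x|lborel. u i x * indicator A x)"

lemma U_int: "A \<in> sets borel \<Longrightarrow> integrable lborel (\<lambda>x. u i x * indicator A x)"
  using u_int[of i] by (rule Bochner_Integration.integrable_bound) (auto simp: indicator_def)

lemma B_nonneg: "B \<ge> 0"
  using u_nrm[of 0] order_trans[OF Bochner_Integration.integral_nonneg[of lborel "\<lambda>x. (u 0 x)\<^sup>2"]] by simp

lemma U_nonneg: "U i A \<ge> 0"
  unfolding U_def using u_nonneg by (intro Bochner_Integration.integral_nonneg) auto

lemma U_mono: "A \<subseteq> A' \<Longrightarrow> A \<in> sets borel \<Longrightarrow> A' \<in> sets borel \<Longrightarrow> U i A \<le> U i A'"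
  unfolding U_def using u_nonneg by (intro integral_mono U_int) (auto simp: indicator_def)

lemma U_le: "A \<in> sets borel \<Longrightarrow> U i A \<le> m"
  using U_mono[of A UNIV i] u_mass[of i] by (simp add: U_def)

lemma U_disjoint:
  "A \<in> sets borel \<Longrightarrow> A' \<in> sets borel \<Longrightarrow> A \<inter> A' = {} \<Longrightarrow> U i (A \<union> A') = U i A + U i A'"
proof -
  assume A: "A \<in> sets borel" "A' \<in> sets borel" "A \<inter> A' = {}"
  then have "U i (A \<union> A') = (LINT x|lborel. u i x * indicator A x + u i x * indicator A' x)"
    unfolding U_def by (intro Bochner_Integration.integral_cong) (auto simp: indicator_def)
  then show ?thesis using U_int[OF A(1)] U_int[OF A(2)] by (simp add: U_def)
qed

lemma U_compl: "A \<in> sets borel \<Longrightarrow> U i (UNIV - A) = m - U i A"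
  using U_disjoint[of A "UNIV - A" i] u_mass[of i] by (simp add: U_def)

text \<open>Equi-integrability: outside a set \<open>S\<close> of finite measure the mass is small
  by tightness; inside, the measure of \<open>A n \<inter> S\<close> tends to zero, and the L2 bound
  turns small measure into small mass, uniformly in \<open>i\<close>.\<close>

lemma uniform_decay:
  assumes A: "range A \<subseteq> sets borel" "decseq A" "(\<Inter>n. A n) = {}" and e: "\<epsilon> > 0"
  shows "\<exists>n. \<forall>i. U i (A n) \<le> \<epsilon>"
proof -
  obtain S where [measurable]: "S \<in> sets borel" and fS: "emeasure lborel S < \<infinity>"
    and S: "\<And>i. (LINT x|lborel. u i x * indicator (- S) x) \<le> \<epsilon> / 3"
    using tight[of "\<epsilon> / 3"] e by auto
  have [measurable]: "A n \<in> sets borel" for n using A(1) by auto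
  \<comment> \<open>The mass on \<open>A n \<inter> S\<close> is at most \<open>t / 2 * B\<close>
    plus the measure over \<open>2 * t\<close>. This \<open>t\<close> keeps the former within a
    third of \<epsilon>; a measure of at most \<open>2 * t * \<epsilon> / 3\<close> does so for the
    latter.\<close>
  define t where "t = \<epsilon> / (3 * (B + 1))"
  have t: "t > 0" using e B_nonneg by (simp add: t_def)
  have tB: "t / 2 * B \<le> \<epsilon> / 3"
    using e B_nonneg t by (simp add: t_def field_simps)
  have fm: "emeasure lborel (A n \<inter> S) < \<infinity>" for n
    using fS emeasure_mono[of "A n \<inter> S" S lborel] by (simp add: le_less_trans)
  have "(\<lambda>n. emeasure lborel (A n \<inter> S)) \<longlonglongrightarrow> emeasure lborel (\<Inter>n. A n \<inter> S)"
    using A(2) fm by (intro Lim_emeasure_decseq) (auto simp: decseq_def less_top[symmetric])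
  moreover have "(\<Inter>n. A n \<inter> S) = {}" using A(3) by auto
  ultimately have "(\<lambda>n. emeasure lborel (A n \<inter> S)) \<longlonglongrightarrow> 0" by simp
  then have "eventually (\<lambda>n. emeasure lborel (A n \<inter> S) < ennreal (2 * t * \<epsilon> / 3)) sequentially"
    using t e by (intro order_tendstoD(2)[of _ 0]) auto
  then obtain n where n: "emeasure lborel (A n \<inter> S) < ennreal (2 * t * \<epsilon> / 3)"
    by (auto simp: eventually_sequentially)
  have mn: "measure lborel (A n \<inter> S) \<le> 2 * t * \<epsilon> / 3"
    using n t e unfolding measure_def by (intro enn2real_leI) auto
  show ?thesis
  proof (intro exI[of _ n] allI)
    fix i
    have ind: "(indicat_real (A n \<inter> S) x)\<^sup>2 = indicat_real (A n \<inter> S) x" for x by (simp add: indicator_def)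
    have ii: "integrable lborel (\<lambda>x. (indicat_real (A n \<inter> S) x)\<^sup>2)"
      unfolding ind using fm[of n] by simp
    have "U i (A n) \<le> U i ((A n \<inter> S) \<union> (- S))"
      by (rule U_mono) auto
    also have "\<dots> = U i (A n \<inter> S) + U i (- S)" by (rule U_disjoint) auto
    also have "U i (- S) \<le> \<epsilon> / 3" using S by (simp add: U_def)
    also have "U i (A n \<inter> S) \<le> (LINT x|lborel. \<bar>u i x * indicator (A n \<inter> S) x\<bar>)"
      unfolding U_def by (intro integral_mono U_int integrable_abs) auto
    also have "\<dots> \<le> t / 2 * (LINT x|lborel. (u i x)\<^sup>2) + 1 / (2 * t) * (LINT x|lborel. (indicat_real (A n \<inter> S) x)\<^sup>2)"
      by (rule L2_product_bound(2)[OF _ _ u_sq ii t]) auto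
    also have "(LINT x|lborel. (indicat_real (A n \<inter> S) x)\<^sup>2) = measure lborel (A n \<inter> S)"
      unfolding ind by simp
    also have "t / 2 * (LINT x|lborel. (u i x)\<^sup>2) \<le> t / 2 * B" using t u_nrm by (intro mult_left_mono) auto
    also note tB
    also have "1 / (2 * t) * measure lborel (A n \<inter> S) \<le> 1 / (2 * t) * (2 * t * \<epsilon> / 3)"
      using t mn by (intro mult_left_mono) auto
    also have "1 / (2 * t) * (2 * t * \<epsilon> / 3) = \<epsilon> / 3" using t by simp
    finally show "U i (A n) \<le> \<epsilon>" by simp
  qed
qed

text \<open>A diagonal subsequence converges on a countable generator. The sets on which the masses
  converge are closed under complements and, by \<open>uniform_decay\<close> applied to the tails,
  under countable disjoint unions, so Dynkin's theorem gives all Borel sets.\<close>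

lemma U_convergent_subseq:
  obtains s where "strict_mono (s :: nat \<Rightarrow> nat)" "\<And>A. A \<in> sets borel \<Longrightarrow> convergent (\<lambda>i. U (s i) A)"
proof -
  obtain Bs :: "'a set set" where Bs: "countable Bs" "topological_basis Bs" using ex_countable_basis by blast
  \<comment> \<open>Finite intersections of basic open sets: still countable, but now stable under
    intersection, as the Dynkin argument requires.\<close>
  define G where "G = Inter ` {F. finite F \<and> F \<subseteq> Bs}"
  have cG: "countable G" unfolding G_def using Bs(1) by (intro countable_image countable_Collect_finite_subset)
  have neG: "G \<noteq> {}" unfolding G_def by auto
  have sB: "Bs \<subseteq> G" unfolding G_def by (auto intro!: image_eqI[of _ _ "{b}" for b])
  have Gb: "G \<subseteq> sets borel"
  proof
    fix A assume "A \<in> G"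
    then obtain F where F: "A = \<Inter>F" "finite F" "F \<subseteq> Bs" by (auto simp: G_def)
    have "open b" if "b \<in> F" for b using that F(3) Bs(2) by (auto simp: topological_basis_open)
    then have "open A" unfolding F(1) using F(2) by (intro open_Inter) auto
    then show "A \<in> sets borel" by simp
  qed
  have sG: "sets borel = sigma_sets UNIV G"
  proof
    have "sets borel = sigma_sets UNIV Bs"
      by (subst borel_eq_countable_basis[OF Bs]) simp
    then show "sets borel \<subseteq> sigma_sets UNIV G" using sigma_sets_mono'[OF sB] by simp
    show "sigma_sets UNIV G \<subseteq> sets borel" using Gb sets.sigma_sets_subset[of G borel] by simp
  qed
  have st: "Int_stable G"
  proof (rule Int_stableI)
    fix a b assume "a \<in> G" "b \<in> G"
    then obtain F F' where "a = \<Inter>F" "finite F" "F \<subseteq> Bs" "b = \<Inter>F'" "finite F'" "F' \<subseteq> Bs" by (auto simp: G_def)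
    then show "a \<inter> b \<in> G" unfolding G_def by (auto intro!: image_eqI[of _ _ "F \<union> F'"])
  qed
  define P where "P n s \<longleftrightarrow> convergent (\<lambda>i. U (s i) (from_nat_into G n))" for n and s :: "nat \<Rightarrow> nat"
  interpret subseqs P
  proof
    fix n and s :: "nat \<Rightarrow> nat" assume "strict_mono s"
    have "from_nat_into G n \<in> sets borel" using Gb from_nat_into[OF neG] by auto
    then have "bounded (range (\<lambda>i. U (s i) (from_nat_into G n)))"
      using U_nonneg U_le by (intro boundedI[of _ m]) (auto simp: abs_of_nonneg)
    then obtain l r where "strict_mono r" "((\<lambda>i. U (s i) (from_nat_into G n)) \<circ> r) \<longlonglongrightarrow> l"
      using bounded_imp_convergent_subsequence by blast
    then show "\<exists>r'. strict_mono r' \<and> P n (s \<circ> r')"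
      unfolding P_def convergent_def by (auto simp: o_def)
  qed
  define s where "s = diagseq"
  have sm: "strict_mono s" unfolding s_def by (rule subseq_diagseq)
  have basic: "convergent (\<lambda>i. U (s i) A)" if AG: "A \<in> G" for A
  proof -
    obtain n where n: "A = from_nat_into G n" using from_nat_into_surj[OF cG AG] by auto
    have "P n (diagseq \<circ> (+) (Suc n))"
      by (rule diagseq_holds)
         (auto simp: P_def o_def dest: convergent_subseq_convergent)
    then have "convergent (\<lambda>i. U (s (i + Suc n)) A)" unfolding P_def n s_def by (simp add: o_def add.commute)
    then show ?thesis using convergent_ignore_initial_segment[of "\<lambda>i. U (s i) A" "Suc n"] by simp
  qed
  have "convergent (\<lambda>i. U (s i) A)" if "A \<in> sets borel" for A
  proof -
    have GP: "G \<subseteq> Pow UNIV" by simp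
    have "A \<in> sigma_sets UNIV G" using that unfolding sG .
    with st GP show ?thesis
  proof (induction rule: sigma_sets_induct_disjoint)
    case (basic A) then show ?case using \<open>\<And>A. A \<in> G \<Longrightarrow> convergent (\<lambda>i. U (s i) A)\<close> by simp
  next
    case empty show ?case by (simp add: U_def convergent_const)
  next
    case (compl A)
    then have "A \<in> sets borel" unfolding sG by simp
    then show ?case using compl by (simp add: U_compl convergent_diff convergent_const)
  next
    case (union A)
    have Ab: "A j \<in> sets borel" for j using union(2) unfolding sG by auto
    have dis: "i = j" if "x \<in> A i" "x \<in> A j" for i j x
      using union(1) that by (auto simp: disjoint_family_on_def)
    have conv: "convergent (\<lambda>i. U (s i) (\<Union>j<n. A j))" for n
    proof (induction n)
      case 0 show ?case by (simp add: U_def convergent_const)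
    next
      case (Suc n)
      have "(\<Union>j<Suc n. A j) = (\<Union>j<n. A j) \<union> A n" by (auto simp: less_Suc_eq)
      moreover have "(\<Union>j<n. A j) \<inter> A n = {}" using dis by fastforce
      ultimately have "U (s i) (\<Union>j<Suc n. A j) = U (s i) (\<Union>j<n. A j) + U (s i) (A n)" for i
        using Ab by (simp add: U_disjoint)
      then show ?case using Suc union(3)[of n] by (simp add: convergent_add)
    qed
    show ?case
    proof (rule convergent_approx)
      fix \<epsilon> :: real assume e: "\<epsilon> > 0"
      define D where "D n = (\<Union>j\<in>{n..}. A j)" for n
      have D: "D n \<in> sets borel" for n unfolding D_def using Ab by auto
      have "(\<Inter>n. D n) = {}"
      proof (rule ccontr)
        assume "(\<Inter>n. D n) \<noteq> {}"
        then obtain x where x: "\<And>n. x \<in> D n" by auto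
        obtain j where j: "x \<in> A j" using x[of 0] by (auto simp: D_def)
        obtain l where "l \<ge> Suc j" "x \<in> A l" using x[of "Suc j"] by (auto simp: D_def)
        then show False using dis[OF j, of l] by simp
      qed
      moreover have "decseq D" unfolding D_def decseq_def by (intro allI impI UN_mono) auto
      ultimately obtain n where n: "\<And>i. U i (D n) \<le> \<epsilon>"
        using uniform_decay[of D \<epsilon>] D e by auto
      have un: "(\<Union>j. A j) = (\<Union>j<n. A j) \<union> D n" unfolding D_def by (fastforce simp: not_le)
      have "(\<Union>j<n. A j) \<inter> D n = {}" using dis by (fastforce simp: D_def)
      then have "U i (\<Union>j. A j) = U i (\<Union>j<n. A j) + U i (D n)" for i
        unfolding un using Ab D by (intro U_disjoint) auto
      then show "\<exists>g. convergent g \<and> (\<forall>i. \<bar>U (s i) (\<Union>j. A j) - g i\<bar> \<le> \<epsilon>)"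
        using conv[of n] n U_nonneg by (intro exI[of _ "\<lambda>i. U (s i) (\<Union>j<n. A j)"]) (auto simp: abs_of_nonneg)
    qed
  qed
  qed
  with sm show thesis by (rule that)
qed


text \<open>The limit of the set functions is clearly finitely additive;
  \<open>uniform_decay\<close> adds continuity at the empty set, hence a measure. It vanishes on
  null sets, and Radon-Nikodym yields the density.\<close>

lemma limit_density:
  assumes conv: "\<And>A. A \<in> sets borel \<Longrightarrow> convergent (\<lambda>i. U (s i) A)"
  obtains v where "v \<in> borel_measurable borel" "\<And>x. 0 \<le> v x" "integrable lborel v"
    "\<And>A. A \<in> sets borel \<Longrightarrow> (\<lambda>i. U (s i) A) \<longlonglongrightarrow> (LINT x|lborel. v x * indicator A x)"
proof -
  define \<nu> where "\<nu> A = lim (\<lambda>i. U (s i) A)" for A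
  have lim: "(\<lambda>i. U (s i) A) \<longlonglongrightarrow> \<nu> A" if "A \<in> sets borel" for A
    using conv[OF that] unfolding \<nu>_def by (simp add: convergent_LIMSEQ_iff)
  have nn: "\<nu> A \<ge> 0" if "A \<in> sets borel" for A
    using LIMSEQ_le_const[OF lim[OF that], of 0] U_nonneg by auto
  have add: "\<nu> (A \<union> A') = \<nu> A + \<nu> A'" if "A \<in> sets borel" "A' \<in> sets borel" "A \<inter> A' = {}" for A A'
  proof -
    have "(\<lambda>i. U (s i) (A \<union> A')) \<longlonglongrightarrow> \<nu> A + \<nu> A'"
      unfolding U_disjoint[OF that] using that by (intro tendsto_add lim)
    moreover have "(\<lambda>i. U (s i) (A \<union> A')) \<longlonglongrightarrow> \<nu> (A \<union> A')" using that by (intro lim) auto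
    ultimately show ?thesis using LIMSEQ_unique by blast
  qed
  have empty: "\<nu> {} = 0"
    using LIMSEQ_unique[OF lim[of "{}"], of 0] by (simp add: U_def)
  interpret B: sigma_algebra UNIV "sets (borel :: 'a measure)"
    using sets.sigma_algebra_axioms[of "borel :: 'a measure"] by simp
  let ?f = "\<lambda>A. ennreal (\<nu> A)"
  have pos: "positive (sets borel) ?f" by (simp add: positive_def empty)
  have "countably_additive (sets borel) ?f"
  proof (rule B.empty_continuous_imp_countably_additive[OF pos])
    show "additive (sets borel) ?f"
      unfolding additive_def by (auto simp: add nn)
    show "\<forall>A\<in>sets borel. ?f A \<noteq> \<infinity>" by simp
    fix A :: "nat \<Rightarrow> 'a set" assume A: "range A \<subseteq> sets borel" "decseq A" "(\<Inter>i. A i) = {}"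
    have Ab: "A n \<in> sets borel" for n using A(1) by auto
    have "(\<lambda>n. \<nu> (A n)) \<longlonglongrightarrow> 0"
    proof (rule LIMSEQ_I)
      fix r :: real assume r: "r > 0"
      obtain n where n: "\<And>i. U i (A n) \<le> r / 2" using uniform_decay[OF A, of "r / 2"] r by auto
      have "norm (\<nu> (A k) - 0) < r" if "k \<ge> n" for k
      proof -
        have "U (s i) (A k) \<le> r / 2" for i
          using U_mono[of "A k" "A n" "s i"] Ab that A(2) n[of "s i"] by (auto simp: decseq_def intro: order_trans)
        then have "\<nu> (A k) \<le> r / 2" by (intro LIMSEQ_le_const2[OF lim[OF Ab]]) auto
        then show ?thesis using nn[OF Ab, of k] r by simp
      qed
      then show "\<exists>no. \<forall>n\<ge>no. norm (\<nu> (A n) - 0) < r" by blast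
    qed
    then show "(\<lambda>n. ?f (A n)) \<longlonglongrightarrow> 0" using tendsto_ennrealI by fastforce
  qed
  note ca = this
  define N where "N = measure_of UNIV (sets (borel :: 'a measure)) ?f"
  have sN: "sets N = sets (borel :: 'a measure)" "space N = UNIV"
    unfolding N_def by (simp_all add: B.sets_measure_of_eq)
  have eN: "emeasure N A = ?f A" if "A \<in> sets borel" for A
    unfolding N_def by (rule emeasure_measure_of_sigma[OF B.sigma_algebra_axioms pos ca that])
  have "absolutely_continuous lborel N"
    unfolding absolutely_continuous_def
  proof
    fix A :: "'a set" assume A: "A \<in> null_sets lborel"
    then have Ab: "A \<in> sets borel" by auto
    have "U i A = 0" for i
    proof -
      have "AE x in lborel. x \<notin> A" using A by (rule AE_not_in)
      then have "U i A = (LINT x|(lborel :: 'a measure). 0)"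
        unfolding U_def using Ab by (intro integral_cong_AE) (auto elim!: eventually_mono)
      then show ?thesis by simp
    qed
    then have "\<nu> A = 0" using lim[OF Ab] LIMSEQ_unique[of "\<lambda>i. 0::real"] by auto
    then show "A \<in> null_sets N" using Ab sN eN by (auto simp: null_sets_def)
  qed
  then obtain f where [measurable]: "f \<in> borel_measurable lborel" and f: "density lborel f = N"
    using sigma_finite_measure.Radon_Nikodym[OF sigma_finite_lborel, of N] sN by auto
  have fA: "(\<integral>\<^sup>+x. f x * indicator A x \<partial>lborel) = ennreal (\<nu> A)" if "A \<in> sets borel" for A
    using eN[OF that] that unfolding f[symmetric] by (simp add: emeasure_density)
  have "(\<integral>\<^sup>+x. f x \<partial>lborel) \<noteq> \<infinity>" using fA[of UNIV] by simp
  then have fin: "AE x in lborel. f x \<noteq> \<infinity>" by (intro nn_integral_PInf_AE) auto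
  define v where "v x = enn2real (f x)" for x
  have [measurable]: "v \<in> borel_measurable borel" unfolding v_def by simp
  have vA: "(\<integral>\<^sup>+x. ennreal (v x * indicator A x) \<partial>lborel) = ennreal (\<nu> A)" if [measurable]: "A \<in> sets borel" for A
  proof -
    have "(\<integral>\<^sup>+x. ennreal (v x * indicator A x) \<partial>lborel) = (\<integral>\<^sup>+x. f x * indicator A x \<partial>lborel)"
      using fin by (intro nn_integral_cong_AE) (auto elim!: eventually_mono simp: v_def indicator_def less_top)
    then show ?thesis using fA[OF that] by simp
  qed
  have vi: "(LINT x|lborel. v x * indicator A x) = \<nu> A" if [measurable]: "A \<in> sets borel" for A
    by (subst integral_eq_nn_integral) (auto simp: vA v_def[symmetric] nn that intro!: AE_I2, auto simp: v_def)
  show thesis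
  proof (rule that[of v])
    show "integrable lborel v"
      using vA[of UNIV] by (intro integrableI_nonneg) (auto simp: v_def)
    show "(\<lambda>i. U (s i) A) \<longlonglongrightarrow> (LINT x|lborel. v x * indicator A x)" if "A \<in> sets borel" for A
      using lim[OF that] vi[OF that] by simp
  qed (auto simp: v_def)
qed

end

text \<open>Passing from convergence on sets to bounded test functions: round \<open>h\<close> down to multiples of \<open>1 / n\<close>.\<close>

lemma tendsto_bounded_test:
  fixes w :: "nat \<Rightarrow> 'a::euclidean_space \<Rightarrow> real"
  assumes [measurable]: "h \<in> borel_measurable borel" and hb: "\<And>x. \<bar>h x\<bar> \<le> H"
    and w: "\<And>i. integrable lborel (w i)" "\<And>i x. 0 \<le> w i x" "\<And>i. (LINT x|lborel. w i x) \<le> m"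
    and v: "integrable lborel v" "\<And>x. 0 \<le> v x"
    and lim: "\<And>A. A \<in> sets borel \<Longrightarrow> (\<lambda>i. LINT x|lborel. w i x * indicator A x) \<longlonglongrightarrow> (LINT x|lborel. v x * indicator A x)"
  shows "(\<lambda>i. LINT x|lborel. w i x * h x) \<longlonglongrightarrow> (LINT x|lborel. v x * h x)"
proof (rule tendsto_approx)
  fix \<epsilon> :: real assume e: "\<epsilon> > 0"
  define mm where "mm = \<bar>m\<bar> + (LINT x|lborel. v x) + 1"
  have mm: "mm > 0" "m \<le> mm" "(LINT x|lborel. v x) \<le> mm"
  proof -
    have "0 \<le> (LINT x|lborel. v x)" using v(2) by (intro Bochner_Integration.integral_nonneg)
    then show "mm > 0" "m \<le> mm" "(LINT x|lborel. v x) \<le> mm" unfolding mm_def by linarith+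
  qed
  obtain n :: nat where n: "mm / \<epsilon> < real n" using reals_Archimedean2 by blast
  then have n0: "real n > 0" using mm e by (smt (verit) divide_pos_pos)
  have mn: "mm / real n \<le> \<epsilon>" using n n0 e by (simp add: field_simps)
  define K where "K = {\<lfloor>real n * (- H)\<rfloor> .. \<lfloor>real n * H\<rfloor>}"
  define A where "A k = {x. \<lfloor>real n * h x\<rfloor> = k}" for k
  have [measurable]: "A k \<in> sets borel" for k unfolding A_def by measurable
  define hn where "hn x = (\<Sum>k\<in>K. (of_int k / real n) * indicator (A k) x)" for x
  have hn: "hn x = of_int \<lfloor>real n * h x\<rfloor> / real n" for x
  proof -
    have hx: "h x \<le> H" "- H \<le> h x" using hb[of x] by auto
    have "real n * (- H) \<le> real n * h x" "real n * h x \<le> real n * H"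
      using n0 by (rule mult_left_mono[OF hx(2) less_imp_le] mult_left_mono[OF hx(1) less_imp_le])+
    then have "\<lfloor>real n * h x\<rfloor> \<in> K" unfolding K_def by (auto intro!: floor_mono simp del: mult_minus_right)
    moreover have "hn x = (\<Sum>k\<in>K. if k = \<lfloor>real n * h x\<rfloor> then of_int k / real n else 0)"
      unfolding hn_def by (intro sum.cong) (auto simp: A_def)
    ultimately show ?thesis by (simp add: K_def)
  qed
  have close: "\<bar>h x - hn x\<bar> \<le> 1 / real n" for x
  proof -
    have "\<bar>real n * h x - of_int \<lfloor>real n * h x\<rfloor>\<bar> \<le> 1" by linarith
    then have "\<bar>(real n * h x - of_int \<lfloor>real n * h x\<rfloor>) / real n\<bar> \<le> 1 / real n"
      using n0 unfolding abs_divide by (simp add: divide_right_mono)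
    then show ?thesis using n0 unfolding hn by (simp add: diff_divide_distrib)
  qed
  have [measurable]: "hn \<in> borel_measurable borel" unfolding hn_def by measurable
  have hnb: "\<bar>hn x\<bar> \<le> H + 1 / real n" for x using close[of x] hb[of x] by linarith
  have ih: "integrable lborel (\<lambda>x. f x * g x)" if "integrable lborel f" "g \<in> borel_measurable borel" "\<And>x. \<bar>g x\<bar> \<le> C"
    for f g :: "'a \<Rightarrow> real" and C
  proof (rule Bochner_Integration.integrable_bound)
    show "integrable lborel (\<lambda>x. C * f x)" using that by simp
    have "\<bar>f x\<bar> * \<bar>g x\<bar> \<le> \<bar>C\<bar> * \<bar>f x\<bar>" for x
      using that(3)[of x] by (subst mult.commute) (intro mult_right_mono, auto)
    then show "AE x in lborel. norm (f x * g x) \<le> norm (C * f x)" by (simp add: abs_mult)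
  qed (use that in auto)
  have err: "\<bar>(LINT x|lborel. f x * h x) - (LINT x|lborel. f x * hn x)\<bar> \<le> \<epsilon>"
    if f: "integrable lborel f" "\<And>x. 0 \<le> f x" "(LINT x|lborel. f x) \<le> mm" for f
  proof -
    have "\<bar>(LINT x|lborel. f x * h x) - (LINT x|lborel. f x * hn x)\<bar> = \<bar>LINT x|lborel. f x * h x - f x * hn x\<bar>"
      using ih[OF f(1) _ hb] ih[OF f(1) _ hnb] by simp
    also have "\<dots> \<le> (LINT x|lborel. \<bar>f x * h x - f x * hn x\<bar>)" by (rule integral_abs_bound)
    also have "\<dots> \<le> (LINT x|lborel. f x * (1 / real n))"
    proof (rule integral_mono)
      show "integrable lborel (\<lambda>x. \<bar>f x * h x - f x * hn x\<bar>)"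
        using ih[OF f(1) _ hb] ih[OF f(1) _ hnb] by (intro integrable_abs Bochner_Integration.integrable_diff) auto
      show "integrable lborel (\<lambda>x. f x * (1 / real n))" using f by simp
      fix x
      have "\<bar>f x * h x - f x * hn x\<bar> = f x * \<bar>h x - hn x\<bar>"
        using f(2)[of x] by (simp add: abs_mult right_diff_distrib[symmetric])
      then show "\<bar>f x * h x - f x * hn x\<bar> \<le> f x * (1 / real n)"
        using mult_left_mono[OF close[of x] f(2)[of x]] by simp
    qed
    also have "\<dots> = (LINT x|lborel. f x) * (1 / real n)" by (rule integral_mult_left_zero)
    also have "\<dots> \<le> mm * (1 / real n)" using f n0 by (intro mult_right_mono) auto
    finally show ?thesis using mn by simp
  qed
  have expand: "(LINT x|lborel. f x * hn x) = (\<Sum>k\<in>K. (of_int k / real n) * (LINT x|lborel. f x * indicator (A k) x))"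
    if f: "integrable lborel f" for f
  proof -
    have i: "integrable lborel (\<lambda>x. f x * indicator (A k) x)" for k
      by (rule ih[OF f, of _ 1]) (auto simp: indicator_def)
    have "(LINT x|lborel. f x * hn x) = (LINT x|lborel. (\<Sum>k\<in>K. (of_int k / real n) * (f x * indicator (A k) x)))"
      unfolding hn_def by (simp add: sum_distrib_left mult_ac)
    also have "\<dots> = (\<Sum>k\<in>K. LINT x|lborel. (of_int k / real n) * (f x * indicator (A k) x))"
      using i by (intro Bochner_Integration.integral_sum integrable_mult_right) auto
    finally show ?thesis by simp
  qed
  have "(\<lambda>i. LINT x|lborel. w i x * hn x) \<longlonglongrightarrow> (LINT x|lborel. v x * hn x)"
    unfolding expand[OF w(1)] expand[OF v(1)] by (intro tendsto_sum tendsto_mult tendsto_const lim) simp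
  then show "\<exists>g l. g \<longlonglongrightarrow> l \<and> (\<forall>i. \<bar>(LINT x|lborel. w i x * h x) - g i\<bar> \<le> \<epsilon>) \<and> \<bar>(LINT x|lborel. v x * h x) - l\<bar> \<le> \<epsilon>"
    using err[OF w(1,2)] err[OF v(1,2)] w(3) mm order_trans by blast
qed

context tight_L2 begin

text \<open>Convergence on sets extends to bounded test functions, and by truncation to square
  integrable ones once \<open>v\<close> is known to be in L2. The mass survives because the whole
  space is one of the sets on which the masses converge.\<close>

lemma weak_limit:
  obtains s v where "strict_mono (s :: nat \<Rightarrow> nat)" "v \<in> borel_measurable borel" "\<And>x. 0 \<le> v x" "integrable lborel v"
    "integrable lborel (\<lambda>x. (v x)\<^sup>2)" "(LINT x|lborel. v x) = m"
    "\<And>g. g \<in> borel_measurable borel \<Longrightarrow> integrable lborel (\<lambda>x. (g x)\<^sup>2) \<Longrightarrow>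
      (\<lambda>i. LINT x|lborel. u (s i) x * g x) \<longlonglongrightarrow> (LINT x|lborel. v x * g x)"
proof -
  obtain s where s: "strict_mono (s :: nat \<Rightarrow> nat)" "\<And>A. A \<in> sets borel \<Longrightarrow> convergent (\<lambda>i. U (s i) A)"
    using U_convergent_subseq by blast
  obtain v where v [measurable]: "v \<in> borel_measurable borel" and vn: "\<And>x. 0 \<le> v x" and vi: "integrable lborel v"
    and vl: "\<And>A. A \<in> sets borel \<Longrightarrow> (\<lambda>i. U (s i) A) \<longlonglongrightarrow> (LINT x|lborel. v x * indicator A x)"
    using limit_density[OF s(2)] by metis
  have bdd: "(\<lambda>i. LINT x|lborel. u (s i) x * h x) \<longlonglongrightarrow> (LINT x|lborel. v x * h x)"
    if "h \<in> borel_measurable borel" "\<And>x. \<bar>h x\<bar> \<le> H" for h H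
    using vl u_mass by (intro tendsto_bounded_test[OF that u_int u_nonneg _ vi vn]) (auto simp: U_def)
  have vm: "(LINT x|lborel. v x) = m"
    using LIMSEQ_unique[OF vl[of UNIV], of m] u_mass by (simp add: U_def)
  define vt where "vt n x = min (v x) (real n)" for n x
  have vt: "0 \<le> vt n x" "vt n x \<le> real n" "vt n x \<le> v x" for n x using vn[of x] by (auto simp: vt_def)
  have [measurable]: "vt n \<in> borel_measurable borel" for n unfolding vt_def[abs_def] by measurable
  have vti: "integrable lborel (\<lambda>x. (vt n x)\<^sup>2)" for n
  proof (rule Bochner_Integration.integrable_bound)
    show "integrable lborel (\<lambda>x. real n * v x)" using vi by simp
    show "AE x in lborel. norm ((vt n x)\<^sup>2) \<le> norm (real n * v x)"
      using vt vn by (auto simp: power2_eq_square abs_mult intro!: mult_mono AE_I2)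
  qed simp
  \<comment> \<open>The left side is at most the integral of \<open>v x * vt n x\<close>, which, as
    a limit, is at most \<open>B / 2\<close> plus half the left side. That half can be absorbed
    because the truncation has made it finite.\<close>
  have vtB: "(LINT x|lborel. (vt n x)\<^sup>2) \<le> B" for n
  proof -
    have "(LINT x|lborel. (vt n x)\<^sup>2) \<le> (LINT x|lborel. v x * vt n x)"
    proof (rule integral_mono[OF vti])
      have "\<bar>v x * vt n x\<bar> \<le> \<bar>real n * v x\<bar>" for x
        using vt[of n x] vn[of x] mult_left_mono[OF vt(2) vn, of x n x] by (simp add: abs_mult mult.commute)
      then have ae: "AE x in lborel. norm (v x * vt n x) \<le> norm (real n * v x)"
        unfolding real_norm_def by (intro AE_I2)
      have "integrable lborel (\<lambda>x. real n * v x)" using vi by simp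
      then show "integrable lborel (\<lambda>x. v x * vt n x)"
        by (rule Bochner_Integration.integrable_bound[OF _ _ ae]) measurable
      show "(vt n x)\<^sup>2 \<le> v x * vt n x" for x using vt[of n x] by (simp add: power2_eq_square mult_right_mono)
    qed
    also have "\<dots> \<le> 1 / 2 * B + 1 / 2 * (LINT x|lborel. (vt n x)\<^sup>2)"
    proof (rule LIMSEQ_le_const2)
      show "(\<lambda>i. LINT x|lborel. u (s i) x * vt n x) \<longlonglongrightarrow> (LINT x|lborel. v x * vt n x)"
        using vt by (intro bdd[of _ "real n"]) (auto simp: abs_of_nonneg)
      have "(LINT x|lborel. u (s i) x * vt n x) \<le> 1 / 2 * B + 1 / 2 * (LINT x|lborel. (vt n x)\<^sup>2)" for i
      proof -
        have "(LINT x|lborel. u (s i) x * vt n x) \<le> (LINT x|lborel. \<bar>u (s i) x * vt n x\<bar>)"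
          using L2_product_bound(1)[OF _ _ u_sq vti, of "s i"] by (intro integral_mono) auto
        also have "\<dots> \<le> 1 / 2 * (LINT x|lborel. (u (s i) x)\<^sup>2) + 1 / (2 * 1) * (LINT x|lborel. (vt n x)\<^sup>2)"
          by (rule L2_product_bound(2)[OF _ _ u_sq vti]) auto
        finally show ?thesis using u_nrm[of "s i"] by simp
      qed
      then show "\<exists>N. \<forall>i\<ge>N. (LINT x|lborel. u (s i) x * vt n x) \<le> 1 / 2 * B + 1 / 2 * (LINT x|lborel. (vt n x)\<^sup>2)" by blast
    qed
    finally show ?thesis by simp
  qed
  have vtlim: "(\<lambda>n. vt n x) \<longlonglongrightarrow> v x" for x
  proof -
    obtain N where N: "v x < real N" using reals_Archimedean2 by blast
    have "vt n x = v x" if "n \<ge> N" for n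
    proof -
      have "real N \<le> real n" using that by simp
      then show ?thesis using N by (simp add: vt_def)
    qed
    then have "eventually (\<lambda>n. vt n x = v x) sequentially" by (rule eventually_sequentiallyI)
    then show ?thesis by (rule tendsto_eventually)
  qed
  have vB: "(\<integral>\<^sup>+x. ennreal ((v x)\<^sup>2) \<partial>lborel) \<le> ennreal B"
  proof -
    have "(\<integral>\<^sup>+x. ennreal ((v x)\<^sup>2) \<partial>lborel) = (\<integral>\<^sup>+x. liminf (\<lambda>n. ennreal ((vt n x)\<^sup>2)) \<partial>lborel)"
    proof (rule nn_integral_cong)
      fix x
      have "(\<lambda>n. ennreal ((vt n x)\<^sup>2)) \<longlonglongrightarrow> ennreal ((v x)\<^sup>2)"
        by (intro tendsto_ennrealI tendsto_power vtlim)
      then show "ennreal ((v x)\<^sup>2) = liminf (\<lambda>n. ennreal ((vt n x)\<^sup>2))"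
        by (metis lim_imp_Liminf sequentially_bot)
    qed
    also have "\<dots> \<le> liminf (\<lambda>n. \<integral>\<^sup>+x. ennreal ((vt n x)\<^sup>2) \<partial>lborel)"
      by (rule nn_integral_liminf) simp
    also have "\<dots> \<le> limsup (\<lambda>n. \<integral>\<^sup>+x. ennreal ((vt n x)\<^sup>2) \<partial>lborel)" by (rule Liminf_le_Limsup) simp
    also have "\<dots> \<le> ennreal B"
    proof (intro Limsup_bounded always_eventually allI)
      show "(\<integral>\<^sup>+x. ennreal ((vt n x)\<^sup>2) \<partial>lborel) \<le> ennreal B" for n
        using vtB[of n] by (subst nn_integral_eq_integral[OF vti]) (auto intro: ennreal_leI)
    qed
    finally show ?thesis .
  qed
  have v2: "integrable lborel (\<lambda>x. (v x)\<^sup>2)"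
    using vB by (intro integrableI_bounded) (auto intro: le_less_trans)
  have v2B: "(LINT x|lborel. (v x)\<^sup>2) \<le> B"
    using vB nn_integral_eq_integral[OF v2] B_nonneg by simp
  have "(\<lambda>i. LINT x|lborel. u (s i) x * g x) \<longlonglongrightarrow> (LINT x|lborel. v x * g x)"
    if g [measurable]: "g \<in> borel_measurable borel" and g2: "integrable lborel (\<lambda>x. (g x)\<^sup>2)" for g
  proof (rule tendsto_approx)
    fix \<epsilon> :: real assume e: "\<epsilon> > 0"
    \<comment> \<open>The weight keeps \<open>t / 2 * B\<close> below half of \<epsilon>; the
      truncation level is then taken so high that the squared L2 error is below
      \<open>t * \<epsilon>\<close>.\<close>
    define t where "t = \<epsilon> / (B + 1)"
    have t: "t > 0" using e B_nonneg by (simp add: t_def)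
    have tB: "t / 2 * B \<le> \<epsilon> / 2" using e B_nonneg by (simp add: t_def field_simps)
    define gt where "gt n x = max (- real n) (min (real n) (g x))" for n x
    have [measurable]: "gt n \<in> borel_measurable borel" for n unfolding gt_def[abs_def] by measurable
    have gle: "(g x - gt n x)\<^sup>2 \<le> (g x)\<^sup>2" for n x
    proof -
      have "\<bar>g x - gt n x\<bar> \<le> \<bar>g x\<bar>" by (auto simp: gt_def max_def min_def)
      then show ?thesis by (rule abs_le_square_iff[THEN iffD1])
    qed
    have gi: "integrable lborel (\<lambda>x. (g x - gt n x)\<^sup>2)" for n
      using gle by (intro Bochner_Integration.integrable_bound[OF g2]) auto
    have "(\<lambda>n. LINT x|lborel. (g x - gt n x)\<^sup>2) \<longlonglongrightarrow> (LINT x|(lborel :: 'a measure). 0)"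
    proof (rule integral_dominated_convergence[OF _ _ g2])
      have "(\<lambda>n. (g x - gt n x)\<^sup>2) \<longlonglongrightarrow> 0" for x
      proof -
        obtain N where N: "\<bar>g x\<bar> < real N" using reals_Archimedean2 by blast
        have "(g x - gt n x)\<^sup>2 = 0" if "n \<ge> N" for n
        proof -
          have "real N \<le> real n" using that by simp
          then show ?thesis using N by (simp add: gt_def)
        qed
        then have "eventually (\<lambda>n. (g x - gt n x)\<^sup>2 = 0) sequentially" by (rule eventually_sequentiallyI)
        then show ?thesis by (rule tendsto_eventually)
      qed
      then show "AE x in lborel. (\<lambda>n. (g x - gt n x)\<^sup>2) \<longlonglongrightarrow> 0" by simp
      show "AE x in lborel. norm ((g x - gt n x)\<^sup>2) \<le> (g x)\<^sup>2" for n using gle by simp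
    qed auto
    then have "eventually (\<lambda>n. (LINT x|lborel. (g x - gt n x)\<^sup>2) < t * \<epsilon>) sequentially"
      using t e by (intro order_tendstoD(2)[of _ 0]) auto
    then obtain n where n: "(LINT x|lborel. (g x - gt n x)\<^sup>2) < t * \<epsilon>" by (auto simp: eventually_sequentially)
    have err: "\<bar>(LINT x|lborel. f x * g x) - (LINT x|lborel. f x * gt n x)\<bar> \<le> \<epsilon>"
      if [measurable]: "f \<in> borel_measurable borel" and fi: "integrable lborel f" and f: "integrable lborel (\<lambda>x. (f x)\<^sup>2)" and fB: "(LINT x|lborel. (f x)\<^sup>2) \<le> B" for f
    proof -
      have i1: "integrable lborel (\<lambda>x. f x * g x)" by (rule L2_product_bound(1)[OF _ _ f g2]) auto
      have i2: "integrable lborel (\<lambda>x. f x * (g x - gt n x))" by (rule L2_product_bound(1)[OF _ _ f gi]) auto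
      have i3: "integrable lborel (\<lambda>x. f x * gt n x)"
        using Bochner_Integration.integrable_diff[OF i1 i2] by (simp add: right_diff_distrib)
      have "\<bar>(LINT x|lborel. f x * g x) - (LINT x|lborel. f x * gt n x)\<bar> = \<bar>LINT x|lborel. f x * (g x - gt n x)\<bar>"
        using i1 i3 by (simp add: right_diff_distrib)
      also have "\<dots> \<le> (LINT x|lborel. \<bar>f x * (g x - gt n x)\<bar>)" by (rule integral_abs_bound)
      also have "\<dots> \<le> t / 2 * (LINT x|lborel. (f x)\<^sup>2) + 1 / (2 * t) * (LINT x|lborel. (g x - gt n x)\<^sup>2)"
        by (rule L2_product_bound(2)[OF _ _ f gi t]) auto
      also have "\<dots> \<le> t / 2 * B + 1 / (2 * t) * (t * \<epsilon>)"
        using t fB n by (intro add_mono mult_left_mono) auto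
      also have "1 / (2 * t) * (t * \<epsilon>) = \<epsilon> / 2" using t by simp
      finally show ?thesis using tB by simp
    qed
    have "(\<lambda>i. LINT x|lborel. u (s i) x * gt n x) \<longlonglongrightarrow> (LINT x|lborel. v x * gt n x)"
      by (rule bdd[of _ "real n"]) (auto simp: gt_def)
    then show "\<exists>ga l. ga \<longlonglongrightarrow> l \<and> (\<forall>i. \<bar>(LINT x|lborel. u (s i) x * g x) - ga i\<bar> \<le> \<epsilon>) \<and> \<bar>(LINT x|lborel. v x * g x) - l\<bar> \<le> \<epsilon>"
      using err[OF u_meas u_int u_sq u_nrm] err[OF v vi v2 v2B] by blast
  qed
  then show thesis by (rule that[OF s(1) v vn vi v2 vm])
qed

end

section \<open>Energies with a kernel on a cylinder\<close>

text \<open>Borel representatives whose sign and support conditions hold at every point, which frees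
  the energy estimates from null sets. The mass is left open because pieces and multiples of
  densities occur; axisymmetry is required separately.\<close>

definition adm :: "real \<Rightarrow> (real ^ 3 \<Rightarrow> real) \<Rightarrow> bool" where
  "adm R u \<longleftrightarrow> u \<in> borel_measurable borel \<and> (\<forall>x. 0 \<le> u x) \<and> (\<forall>x. x \<notin> cyl R \<longrightarrow> u x = 0) \<and>
     integrable lborel u \<and> integrable lborel (\<lambda>x. (u x)\<^sup>2)"

lemma admD:
  assumes "adm R u"
  shows "u \<in> borel_measurable borel" "\<And>x. 0 \<le> u x" "\<And>x. x \<notin> cyl R \<Longrightarrow> u x = 0"
    "integrable lborel u" "integrable lborel (\<lambda>x. (u x)\<^sup>2)"
  using assms by (auto simp: adm_def)

abbreviation mass :: "(real ^ 3 \<Rightarrow> real) \<Rightarrow> real" where "mass u \<equiv> LINT x|lborel. u x"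
abbreviation nrm2 :: "(real ^ 3 \<Rightarrow> real) \<Rightarrow> real" where "nrm2 u \<equiv> LINT x|lborel. (u x)\<^sup>2"

lemma adm_restrict:
  assumes u: "adm R u" and A [measurable]: "A \<in> sets borel"
  shows "adm R (\<lambda>x. u x * indicator A x)"
proof -
  note [measurable] = admD(1)[OF u]
  have "integrable lborel (\<lambda>x. u x * indicator A x)"
    using admD(4)[OF u] by (rule Bochner_Integration.integrable_bound) (auto simp: indicator_def)
  moreover have "integrable lborel (\<lambda>x. (u x * indicator A x)\<^sup>2)"
    using admD(5)[OF u] by (rule Bochner_Integration.integrable_bound) (auto simp: indicator_def)
  ultimately show ?thesis using admD[OF u] by (auto simp: adm_def)
qed

lemma adm_scale:
  assumes "adm R u" "c \<ge> 0"
  shows "adm R (\<lambda>x. c * u x)"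
  using assms by (auto simp: adm_def power_mult_distrib)

lemma mass_nonneg: "adm R u \<Longrightarrow> mass u \<ge> 0"
  by (auto simp: adm_def)

text \<open>The variational argument sees the kernel only through these properties.
  \<open>near\<close> controls a potential by the L2 norm of the density, \<open>far\<close> by its
  mass; the decay in \<open>far\<close> makes widely separated pieces almost independent.\<close>

locale cyl_kernel =
  fixes k :: "real ^ 3 \<Rightarrow> real ^ 3 \<Rightarrow> real" and R Cn Cf :: real
  assumes k_pair_measurable: "(\<lambda>p. k (fst p) (snd p)) \<in> borel_measurable (borel \<Otimes>\<^sub>M borel)"
    and k_nonneg: "k x y \<ge> 0"
    and k_sym: "k x y = k y x"
    and k_shift: "k (x + c *\<^sub>R e3) (y + c *\<^sub>R e3) = k x y"
    and near: "x \<in> cyl R \<Longrightarrow>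
      (\<integral>\<^sup>+y. ennreal ((k x y)\<^sup>2) * indicator (cyl R \<inter> slab x) y \<partial>lborel) \<le> ennreal Cn"
    and far: "x \<in> cyl R \<Longrightarrow> y \<in> cyl R \<Longrightarrow> \<bar>x $ 3 - y $ 3\<bar> \<ge> 1 \<Longrightarrow> k x y \<le> Cf / \<bar>x $ 3 - y $ 3\<bar>"
    and const_pos: "R > 0" "Cn \<ge> 0" "Cf \<ge> 0"
begin

lemma k_measurable [measurable (raw)]:
  assumes [measurable]: "f \<in> borel_measurable M" "g \<in> borel_measurable M"
  shows "(\<lambda>x. k (f x) (g x)) \<in> borel_measurable M"
proof -
  have "(\<lambda>x. (f x, g x)) \<in> M \<rightarrow>\<^sub>M borel \<Otimes>\<^sub>M borel" by simp
  from measurable_compose[OF this k_pair_measurable] show ?thesis by simp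
qed

definition pot :: "(real ^ 3 \<Rightarrow> real) \<Rightarrow> real ^ 3 \<Rightarrow> real" where
  "pot u x = (LINT y|lborel. k x y * u y)"

definition Q :: "(real ^ 3 \<Rightarrow> real) \<Rightarrow> (real ^ 3 \<Rightarrow> real) \<Rightarrow> real" where
  "Q u w = (LINT x|lborel. u x * pot w x)"

definition en :: "(real ^ 3 \<Rightarrow> real) \<Rightarrow> real" where
  "en u = nrm2 u - Q u u"

lemma k_near_sq:
  assumes "x \<in> cyl R"
  shows "integrable lborel (\<lambda>y. (k x y)\<^sup>2 * indicator (cyl R \<inter> slab x) y)" (is ?int)
    and "(LINT y|lborel. (k x y)\<^sup>2 * indicator (cyl R \<inter> slab x) y) \<le> Cn"
proof -
  have eq: "(\<integral>\<^sup>+y. ennreal ((k x y)\<^sup>2 * indicator (cyl R \<inter> slab x) y) \<partial>lborel)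
    = (\<integral>\<^sup>+y. ennreal ((k x y)\<^sup>2) * indicator (cyl R \<inter> slab x) y \<partial>lborel)"
    by (intro nn_integral_cong) (auto simp: indicator_def)
  have le: "(\<integral>\<^sup>+y. ennreal ((k x y)\<^sup>2 * indicator (cyl R \<inter> slab x) y) \<partial>lborel) \<le> ennreal Cn"
    unfolding eq by (rule near[OF assms])
  show i: ?int
    using le by (intro integrableI_bounded) (auto simp: le_less_trans ennreal_less_top abs_mult)
  have "ennreal (LINT y|lborel. (k x y)\<^sup>2 * indicator (cyl R \<inter> slab x) y) \<le> ennreal Cn"
    using nn_integral_eq_integral[OF i] le by simp
  then show "(LINT y|lborel. (k x y)\<^sup>2 * indicator (cyl R \<inter> slab x) y) \<le> Cn"
    using const_pos by simp
qed

text \<open>The slab part is handled by Young's inequality, the rest by the bound \<open>Cf\<close>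
  for the kernel. The weight stays free: \<open>en_lower\<close> takes the inverse of the mass,
  \<open>Pb\<close> takes 1.\<close>

lemma pot_bound:
  assumes u: "adm R u" and x: "x \<in> cyl R" and t: "t > 0"
  shows "integrable lborel (\<lambda>y. k x y * u y)" and "pot u x \<le> Cn / (2 * t) + t / 2 * nrm2 u + Cf * mass u"
proof -
  note [measurable] = admD(1)[OF u]
  let ?g = "\<lambda>y. (1 / (2 * t)) * ((k x y)\<^sup>2 * indicator (cyl R \<inter> slab x) y) + t / 2 * (u y)\<^sup>2 + Cf * u y"
  have ig: "integrable lborel ?g"
    using k_near_sq(1)[OF x] admD(4,5)[OF u] by (intro Bochner_Integration.integrable_add integrable_mult_right) auto
  have le: "k x y * u y \<le> ?g y" for y
  proof -
    consider "y \<notin> cyl R" | "y \<in> cyl R" "y \<in> slab x" | "y \<in> cyl R" "y \<notin> slab x" by blast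
    then show ?thesis
    proof cases
      case 1 then show ?thesis using admD(3)[OF u] by simp
    next
      case 2
      have "k x y * u y \<le> (1 / (2 * t)) * (k x y)\<^sup>2 + t / 2 * (u y)\<^sup>2"
        using mult_le_weighted_squares[OF t, of "u y" "k x y"] by (simp add: mult.commute)
      moreover have "0 \<le> Cf * u y" using const_pos admD(2)[OF u, of y] by simp
      ultimately show ?thesis using 2 by simp
    next
      case 3
      then have z: "\<bar>x $ 3 - y $ 3\<bar> \<ge> 1" by (auto simp: slab_def)
      have "k x y \<le> Cf / \<bar>x $ 3 - y $ 3\<bar>" using far x 3 z by auto
      also have "\<dots> \<le> Cf" using z const_pos by (simp add: divide_le_eq) (metis mult_left_mono mult.right_neutral)
      finally have "k x y * u y \<le> Cf * u y" using admD(2)[OF u] by (intro mult_right_mono)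
      moreover have "0 \<le> t / 2 * (u y)\<^sup>2" using t by simp
      ultimately show ?thesis using 3 by simp
    qed
  qed
  show i: "integrable lborel (\<lambda>y. k x y * u y)"
    using le k_nonneg[of x] admD(2)[OF u]
    by (intro Bochner_Integration.integrable_bound[OF ig]) (auto simp: abs_mult intro!: order_trans[OF _ abs_ge_self])
  have "pot u x \<le> (LINT y|lborel. ?g y)" unfolding pot_def by (rule integral_mono[OF i ig le])
  also have "\<dots> = (1 / (2 * t)) * (LINT y|lborel. (k x y)\<^sup>2 * indicator (cyl R \<inter> slab x) y) + t / 2 * nrm2 u + Cf * mass u"
    using k_near_sq(1)[OF x] admD(4,5)[OF u]
    by (subst Bochner_Integration.integral_add, (intro Bochner_Integration.integrable_add integrable_mult_right; simp), simp,
        subst Bochner_Integration.integral_add) (auto simp: integrable_mult_right)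
  also have "(1 / (2 * t)) * (LINT y|lborel. (k x y)\<^sup>2 * indicator (cyl R \<inter> slab x) y) \<le> (1 / (2 * t)) * Cn"
    using t k_near_sq(2)[OF x] by (intro mult_left_mono) auto
  finally show "pot u x \<le> Cn / (2 * t) + t / 2 * nrm2 u + Cf * mass u" by simp
qed

lemma pot_nonneg: "adm R u \<Longrightarrow> pot u x \<ge> 0"
  unfolding pot_def using k_nonneg admD(2) by (intro Bochner_Integration.integral_nonneg mult_nonneg_nonneg) auto

lemma pot_measurable:
  assumes "adm R u" shows "pot u \<in> borel_measurable borel"
proof -
  note [measurable] = admD(1)[OF assms]
  have "(\<lambda>x. LINT y|lborel. k x y * u y) \<in> borel_measurable borel"
    by (rule lborel.borel_measurable_lebesgue_integral) (simp add: split_beta')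
  then show ?thesis by (simp add: pot_def[abs_def])
qed

definition Pb :: "(real ^ 3 \<Rightarrow> real) \<Rightarrow> real" where
  "Pb u = Cn / 2 + 1 / 2 * nrm2 u + Cf * mass u"

lemma pot_le_Pb: "adm R u \<Longrightarrow> x \<in> cyl R \<Longrightarrow> pot u x \<le> Pb u"
  using pot_bound(2)[of u x 1] by (simp add: Pb_def)

lemma Q_integrable:
  assumes u: "adm R u" and w: "adm R w"
  shows "integrable lborel (\<lambda>x. u x * pot w x)"
proof -
  note [measurable] = admD(1)[OF u] pot_measurable[OF w]
  show ?thesis
  proof (rule Bochner_Integration.integrable_bound)
    show "integrable lborel (\<lambda>x. u x * Pb w)" using admD(4)[OF u] by simp
    show "AE x in lborel. norm (u x * pot w x) \<le> norm (u x * Pb w)"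
    proof (rule AE_I2)
      fix x
      have "\<bar>pot w x\<bar> \<le> \<bar>Pb w\<bar>" if "x \<in> cyl R"
        using pot_le_Pb[OF w that] pot_nonneg[OF w, of x] by linarith
      then show "norm (u x * pot w x) \<le> norm (u x * Pb w)"
        using admD(3)[OF u, of x] by (cases "x \<in> cyl R") (auto simp: abs_mult mult_left_mono)
    qed
  qed simp
qed

lemma Q_nonneg: "adm R u \<Longrightarrow> adm R w \<Longrightarrow> Q u w \<ge> 0"
  unfolding Q_def by (intro Bochner_Integration.integral_nonneg mult_nonneg_nonneg pot_nonneg admD)

lemma Q_le:
  assumes u: "adm R u" and w: "adm R w" and P: "\<And>x. x \<in> cyl R \<Longrightarrow> u x \<noteq> 0 \<Longrightarrow> pot w x \<le> P"
  shows "Q u w \<le> P * mass u"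
proof -
  have "Q u w \<le> (LINT x|lborel. u x * P)"
    unfolding Q_def
  proof (rule integral_mono[OF Q_integrable[OF u w]])
    show "integrable lborel (\<lambda>x. u x * P)" using admD(4)[OF u] by simp
    show "u x * pot w x \<le> u x * P" for x
      using P[of x] admD(2,3)[OF u, of x] by (cases "u x = 0") (auto intro!: mult_left_mono)
  qed
  then show ?thesis by (simp add: mult.commute)
qed

lemma Q_commute:
  assumes u: "adm R u" and w: "adm R w"
  shows "Q u w = Q w u"
proof -
  note [measurable] = admD(1)[OF u] admD(1)[OF w]
  have int: "integrable (lborel \<Otimes>\<^sub>M lborel) (\<lambda>(x, y). u x * (k x y * w y))"
  proof (rule lborel_pair.Fubini_integrable)
    show "(\<lambda>(x, y). u x * (k x y * w y)) \<in> borel_measurable (lborel \<Otimes>\<^sub>M lborel)" by (simp add: split_beta')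
    have "(LINT y|lborel. norm (case (x, y) of (x, y) \<Rightarrow> u x * (k x y * w y))) = u x * pot w x" for x
      using k_nonneg admD(2)[OF u] admD(2)[OF w] by (simp add: pot_def abs_mult)
    then show "integrable lborel (\<lambda>x. LINT y|lborel. norm (case (x, y) of (x, y) \<Rightarrow> u x * (k x y * w y)))"
      using Q_integrable[OF u w] by simp
    show "AE x in lborel. integrable lborel (\<lambda>y. case (x, y) of (x, y) \<Rightarrow> u x * (k x y * w y))"
    proof (rule AE_I2)
      fix x
      show "integrable lborel (\<lambda>y. case (x, y) of (x, y) \<Rightarrow> u x * (k x y * w y))"
        using pot_bound(1)[OF w, of x 1] admD(3)[OF u, of x] by (cases "x \<in> cyl R") auto
    qed
  qed
  have "Q u w = (LINT x|lborel. LINT y|lborel. u x * (k x y * w y))"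
    by (simp add: Q_def pot_def)
  also have "\<dots> = (LINT y|lborel. LINT x|lborel. u x * (k x y * w y))"
    using lborel_pair.Fubini_integral[OF int] by simp
  also have "\<dots> = (LINT y|lborel. w y * (LINT x|lborel. k y x * u x))"
    by (simp add: k_sym[of _ _] mult_ac flip: integral_mult_right_zero)
  finally show ?thesis by (simp add: Q_def pot_def)
qed

lemma pot_add:
  assumes "adm R u" "adm R w" "x \<in> cyl R"
  shows "pot (\<lambda>y. u y + w y) x = pot u x + pot w x"
  unfolding pot_def
  using pot_bound(1)[of u x 1] pot_bound(1)[of w x 1] assms by (simp add: distrib_left)

lemma adm_add:
  assumes u: "adm R u" and w: "adm R w"
  shows "adm R (\<lambda>x. u x + w x)"
proof -
  note [measurable] = admD(1)[OF u] admD(1)[OF w]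
  have "integrable lborel (\<lambda>x. (u x + w x)\<^sup>2)"
  proof (rule Bochner_Integration.integrable_bound)
    show "integrable lborel (\<lambda>x. 2 * (u x)\<^sup>2 + 2 * (w x)\<^sup>2)"
      using admD(5)[OF u] admD(5)[OF w] by auto
    have "(u x + w x)\<^sup>2 \<le> 2 * (u x)\<^sup>2 + 2 * (w x)\<^sup>2" for x
      using zero_le_power2[of "u x - w x"] by (simp add: power2_eq_square algebra_simps)
    then show "AE x in lborel. norm ((u x + w x)\<^sup>2) \<le> norm (2 * (u x)\<^sup>2 + 2 * (w x)\<^sup>2)" by simp
  qed simp
  then show ?thesis using u w by (auto simp: adm_def)
qed

lemma Q_add_right:
  assumes "adm R u" "adm R v" "adm R w"
  shows "Q u (\<lambda>x. v x + w x) = Q u v + Q u w"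
proof -
  have "Q u (\<lambda>x. v x + w x) = (LINT x|lborel. u x * pot v x + u x * pot w x)"
    unfolding Q_def using pot_add[OF assms(2,3)] admD(3)[OF assms(1)]
    by (intro Bochner_Integration.integral_cong) (auto simp: distrib_left, metis mult_zero_left add_0 distrib_left)
  then show ?thesis using Q_integrable assms by (simp add: Q_def)
qed

lemma Q_add_left:
  assumes "adm R u" "adm R v" "adm R w"
  shows "Q (\<lambda>x. v x + w x) u = Q v u + Q w u"
  using Q_add_right[OF assms] Q_commute adm_add assms by simp

lemma en_scale: "en (\<lambda>x. c * u x) = c\<^sup>2 * en u"
proof -
  have "pot (\<lambda>x. c * u x) y = c * pot u y" for y
    unfolding pot_def by (simp add: mult.left_commute)
  then have "Q (\<lambda>x. c * u x) (\<lambda>x. c * u x) = c\<^sup>2 * Q u u"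
    unfolding Q_def by (simp add: power2_eq_square mult_ac flip: integral_mult_right_zero)
  then show ?thesis by (simp add: en_def power_mult_distrib right_diff_distrib)
qed

text \<open>Coercivity: with the weight \<open>1 / mass u\<close>, multiplying the potential bound
  by the mass leaves exactly half of \<open>nrm2 u\<close> and a term quadratic in the mass.\<close>

lemma en_lower:
  assumes u: "adm R u"
  shows "en u \<ge> 1 / 2 * nrm2 u - (Cn / 2 * (mass u)\<^sup>2 + Cf * (mass u)\<^sup>2)"
proof (cases "mass u = 0")
  case True
  have "Q u u \<le> Pb u * mass u" by (rule Q_le[OF u u]) (rule pot_le_Pb[OF u])
  then have "Q u u \<le> 0" using True by simp
  moreover have "nrm2 u \<ge> 0" by (rule Bochner_Integration.integral_nonneg) simp
  moreover have "Cn / 2 * (mass u)\<^sup>2 + Cf * (mass u)\<^sup>2 = 0" using True by simp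
  ultimately show ?thesis unfolding en_def by linarith
next
  case False
  let ?m = "mass u"
  have m: "?m > 0" using False mass_nonneg[OF u] by simp
  have "Q u u \<le> (Cn / (2 * (1 / ?m)) + (1 / ?m) / 2 * nrm2 u + Cf * ?m) * ?m"
    by (rule Q_le[OF u u], rule pot_bound(2)[OF u]) (use m in auto)
  also have "\<dots> = Cn / 2 * ?m\<^sup>2 + 1 / 2 * nrm2 u + Cf * ?m\<^sup>2"
    using m by (simp add: algebra_simps power2_eq_square)
  finally show ?thesis by (simp add: en_def)
qed

end

section \<open>Tightness of minimizing sequences\<close>

text \<open>The distribution function of the mass along the axis. Cutting at a height preserves
  axisymmetry.\<close>

definition below :: "(real ^ 3 \<Rightarrow> real) \<Rightarrow> real \<Rightarrow> real" where
  "below u b = (LINT x|lborel. u x * indicator {x. x $ 3 < b} x)"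

lemma below_mono:
  assumes u: "adm R u" and "b \<le> c"
  shows "below u b \<le> below u c"
  unfolding below_def
proof (rule integral_mono)
  have i: "integrable lborel (\<lambda>x. u x * indicator {x. x $ 3 < b} x)" for b
    by (rule admD(4)[OF adm_restrict[OF u]]) simp
  show "integrable lborel (\<lambda>x. u x * indicator {x. x $ 3 < b} x)" "integrable lborel (\<lambda>x. u x * indicator {x. x $ 3 < c} x)"
    by (rule i)+
  show "u x * indicator {x. x $ 3 < b} x \<le> u x * indicator {x. x $ 3 < c} x" for x
    using assms(2) admD(2)[OF u, of x] by (auto simp: indicator_def)
qed

lemma below_le_mass:
  assumes u: "adm R u" shows "below u b \<le> mass u" "below u b \<ge> 0"
proof -
  show "below u b \<le> mass u" unfolding below_def
    by (rule integral_mono[OF admD(4)[OF adm_restrict[OF u]] admD(4)[OF u]])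
       (use admD(2)[OF u] in \<open>auto simp: indicator_def\<close>)
  show "below u b \<ge> 0" unfolding below_def
    using admD(2)[OF u] by (intro Bochner_Integration.integral_nonneg) auto
qed

lemma below_diff:
  assumes u: "adm R u" and "b \<le> c"
  shows "(LINT x|lborel. u x * indicator {x. b \<le> x $ 3 \<and> x $ 3 < c} x) = below u c - below u b"
proof -
  have i: "integrable lborel (\<lambda>x. u x * indicator {x. x $ 3 < b} x)" for b
    by (rule admD(4)[OF adm_restrict[OF u]]) simp
  have "below u c - below u b = (LINT x|lborel. u x * indicator {x. x $ 3 < c} x - u x * indicator {x. x $ 3 < b} x)"
    unfolding below_def using i by simp
  also have "\<dots> = (LINT x|lborel. u x * indicator {x. b \<le> x $ 3 \<and> x $ 3 < c} x)"
    using assms(2) by (intro Bochner_Integration.integral_cong) (auto simp: indicator_def)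
  finally show ?thesis by simp
qed

lemma above_eq:
  assumes u: "adm R u"
  shows "(LINT x|lborel. u x * indicator {x. b \<le> x $ 3} x) = mass u - below u b"
proof -
  have i: "integrable lborel (\<lambda>x. u x * indicator {x. x $ 3 < b} x)" for b
    by (rule admD(4)[OF adm_restrict[OF u]]) simp
  have "mass u - below u b = (LINT x|lborel. u x - u x * indicator {x. x $ 3 < b} x)"
    unfolding below_def using i admD(4)[OF u] by simp
  also have "\<dots> = (LINT x|lborel. u x * indicator {x. b \<le> x $ 3} x)"
    by (intro Bochner_Integration.integral_cong) (auto simp: indicator_def)
  finally show ?thesis by simp
qed

lemma below_tendsto:
  assumes u: "adm R u"
  shows "(\<lambda>n. below u (a + real n)) \<longlonglongrightarrow> mass u" "(\<lambda>n. below u (a - real n)) \<longlonglongrightarrow> 0"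
proof -
  note [measurable] = admD(1)[OF u]
  show "(\<lambda>n. below u (a + real n)) \<longlonglongrightarrow> mass u"
    unfolding below_def
  proof (rule integral_dominated_convergence)
    show "integrable lborel u" by (rule admD(4)[OF u])
    show "AE x in lborel. (\<lambda>n. u x * indicator {x. x $ 3 < a + real n} x) \<longlonglongrightarrow> u x"
    proof (rule AE_I2)
      fix x :: "real^3"
      obtain N where N: "x $ 3 - a < real N" using reals_Archimedean2 by blast
      have "eventually (\<lambda>n. u x * indicator {x. x $ 3 < a + real n} x = u x) sequentially"
        using eventually_ge_at_top[of N]
      proof eventually_elim
        case (elim n)
        then have "real N \<le> real n" by simp
        then have "x $ 3 < a + real n" using N by linarith
        then show ?case by simp
      qed
      then show "(\<lambda>n. u x * indicator {x. x $ 3 < a + real n} x) \<longlonglongrightarrow> u x" by (rule tendsto_eventually)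
    qed
  qed (use admD(2)[OF u] in \<open>auto simp: indicator_def\<close>)
  have "(\<lambda>n. LINT x|lborel. u x * indicator {x. x $ 3 < a - real n} x) \<longlonglongrightarrow> (LINT x|(lborel::(real^3) measure). 0)"
  proof (rule integral_dominated_convergence)
    show "integrable lborel u" by (rule admD(4)[OF u])
    show "AE x in lborel. (\<lambda>n. u x * indicator {x. x $ 3 < a - real n} x) \<longlonglongrightarrow> 0"
    proof (rule AE_I2)
      fix x :: "real^3"
      obtain N where N: "a - x $ 3 < real N" using reals_Archimedean2 by blast
      have "eventually (\<lambda>n. u x * indicator {x. x $ 3 < a - real n} x = 0) sequentially"
        using eventually_ge_at_top[of N]
      proof eventually_elim
        case (elim n)
        then have "real N \<le> real n" by simp
        then have "\<not> x $ 3 < a - real n" using N by linarith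
        then show ?case by simp
      qed
      then show "(\<lambda>n. u x * indicator {x. x $ 3 < a - real n} x) \<longlonglongrightarrow> 0" by (rule tendsto_eventually)
    qed
  qed (use admD(2)[OF u] in \<open>auto simp: indicator_def\<close>)
  then show "(\<lambda>n. below u (a - real n)) \<longlonglongrightarrow> 0" by (simp add: below_def)
qed

lemma axisymmetric_restrict_slab:
  assumes "axisymmetric u"
  shows "axisymmetric (\<lambda>x. u x * indicator {x. P (x $ 3)} x)"
proof -
  obtain f where "\<And>x. u x = f (cyl_r x) (x $ 3)" using assms by (auto simp: axisymmetric_def)
  then show ?thesis unfolding axisymmetric_def
    by (intro exI[of _ "\<lambda>r z. f r z * indicator {z. P z} z"]) (auto simp: indicator_def)
qed

text \<open>The least integer step at which more than half of the mass lies below locates the median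
  up to an error of 1, with no appeal to continuity of \<open>below\<close>.\<close>

lemma mass_median:
  assumes u: "adm R u" and "mass u > 0"
  shows "\<exists>a. below u a \<le> mass u / 2 \<and> mass u / 2 \<le> below u (a + 1)"
proof -
  have "eventually (\<lambda>n. below u (0 - real n) < mass u / 2) sequentially"
    using below_tendsto(2)[OF u, of 0] assms(2) by (intro order_tendstoD(2)[of _ 0]) auto
  then obtain N where N: "below u (- real N) < mass u / 2" by (auto simp: eventually_sequentially)
  have "eventually (\<lambda>n. below u (- real N + real n) > mass u / 2) sequentially"
    using order_tendstoD(1)[OF below_tendsto(1)[OF u, of "- real N"], of "mass u / 2"] assms(2) by simp
  then have ex: "\<exists>n. below u (- real N + real n) > mass u / 2" by (auto simp: eventually_sequentially)
  define j where "j = (LEAST n. below u (- real N + real n) > mass u / 2)"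
  have j: "below u (- real N + real j) > mass u / 2" unfolding j_def by (rule LeastI_ex[OF ex])
  have "j \<noteq> 0" using j N by (cases "j = 0") auto
  then obtain i where i: "j = Suc i" by (cases j) auto
  have "\<not> below u (- real N + real i) > mass u / 2"
    using not_less_Least[of i "\<lambda>n. below u (- real N + real n) > mass u / 2"] i j_def by simp
  then show ?thesis using j i by (intro exI[of _ "- real N + real i"]) (auto simp: add_ac)
qed

context cyl_kernel begin

text \<open>The parts below and above the layer \<open>b \<le> z < b + h\<close> interact by at most \<open>Cf / h\<close>, and the layer
  itself costs at most its mass times a bound for the potential.\<close>

lemma en_split:
  fixes b h :: real
  assumes u: "adm R u" and h: "h \<ge> 1" and P: "\<And>x. x \<in> cyl R \<Longrightarrow> pot u x \<le> P"
  defines "u1 \<equiv> \<lambda>x. u x * indicator {x. x $ 3 < b} x" and "u3 \<equiv> \<lambda>x. u x * indicator {x. b + h \<le> x $ 3} x"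
  shows "en u \<ge> en u1 + en u3 - 2 * (Cf / h * (mass u)\<^sup>2) - 2 * (P * (below u (b + h) - below u b))"
proof -
  define u2 where "u2 = (\<lambda>x. u x * indicator {x. b \<le> x $ 3 \<and> x $ 3 < b + h} x)"
  have a1: "adm R u1" and a2: "adm R u2" and a3: "adm R u3"
    unfolding u1_def u2_def u3_def by (auto intro!: adm_restrict[OF u])
  define v where "v = (\<lambda>x. u1 x + u3 x)"
  have av: "adm R v" unfolding v_def by (rule adm_add[OF a1 a3])
  have uv: "u = (\<lambda>x. v x + u2 x)"
    using h by (auto simp: v_def u1_def u2_def u3_def indicator_def fun_eq_iff)
  have m2: "mass u2 = below u (b + h) - below u b"
    unfolding u2_def using below_diff[OF u, of b "b + h"] h by simp
  have m1: "mass u1 \<le> mass u" and m3: "mass u3 \<le> mass u"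
    using below_le_mass[OF u] above_eq[OF u] by (auto simp: u1_def u3_def below_def[symmetric])
  \<comment> \<open>The layer \<open>u2\<close> enters twice, against \<open>v\<close> and against
    \<open>u\<close>. Both terms are at most \<open>Q u2 u\<close>, whence the factor 2 in front of
    its cost.\<close>
  have "Q u u = Q v v + Q v u2 + Q u2 u"
    using Q_add_left[OF u av a2] Q_add_right[OF av av a2] uv[symmetric] by simp
  moreover have "Q v u2 \<le> Q u2 u"
  proof -
    have "Q u2 u = Q u2 v + Q u2 u2" using Q_add_right[OF a2 av a2] uv[symmetric] by simp
    then show ?thesis using Q_nonneg[OF a2 a2] Q_commute[OF av a2] by simp
  qed
  moreover have "Q u2 u \<le> P * mass u2" by (rule Q_le[OF a2 u]) (rule P)
  moreover have "Q v v = Q u1 u1 + Q u3 u3 + 2 * Q u1 u3"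
    using Q_add_left[OF av a1 a3] Q_add_right[OF a1 a1 a3] Q_add_right[OF a3 a1 a3] Q_commute[OF a1 a3]
    unfolding v_def[symmetric] by simp
  moreover have "Q u1 u3 \<le> Cf / h * (mass u)\<^sup>2"
  proof -
    have "Q u1 u3 \<le> (Cf / h * mass u3) * mass u1"
    proof (rule Q_le[OF a1 a3])
      fix x assume x: "x \<in> cyl R" and "u1 x \<noteq> 0"
      then have z: "x $ 3 < b" by (auto simp: u1_def indicator_def)
      have "pot u3 x \<le> (LINT y|lborel. Cf / h * u3 y)"
        unfolding pot_def
      proof (rule integral_mono)
        show "integrable lborel (\<lambda>y. k x y * u3 y)" by (rule pot_bound(1)[OF a3 x, of 1]) simp
        show "integrable lborel (\<lambda>y. Cf / h * u3 y)" using admD(4)[OF a3] by simp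
        fix y
        show "k x y * u3 y \<le> Cf / h * u3 y"
        proof (cases "u3 y = 0")
          case False
          then have y: "y \<in> cyl R" "b + h \<le> y $ 3" using admD(3)[OF a3] by (auto simp: u3_def indicator_def)
          then have d: "\<bar>x $ 3 - y $ 3\<bar> \<ge> h" using z by simp
          have "k x y \<le> Cf / \<bar>x $ 3 - y $ 3\<bar>" using far[OF x y(1)] d h by simp
          also have "\<dots> \<le> Cf / h" using d h const_pos by (intro divide_left_mono mult_pos_pos) auto
          finally show ?thesis using admD(2)[OF a3] by (intro mult_right_mono)
        qed simp
      qed
      then show "pot u3 x \<le> Cf / h * mass u3" by simp
    qed
    also have "\<dots> = Cf / h * (mass u3 * mass u1)" by simp
    also have "\<dots> \<le> Cf / h * (mass u * mass u)"
      using m1 m3 mass_nonneg[OF a1] mass_nonneg[OF a3] const_pos h by (intro mult_left_mono mult_mono) auto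
    finally show ?thesis by (simp add: power2_eq_square)
  qed
  moreover have "nrm2 u \<ge> nrm2 u1 + nrm2 u3"
  proof -
    have "nrm2 u1 + nrm2 u3 = (LINT x|lborel. (u1 x)\<^sup>2 + (u3 x)\<^sup>2)"
      using admD(5)[OF a1] admD(5)[OF a3] by simp
    also have "\<dots> \<le> nrm2 u"
      using admD(5)[OF a1] admD(5)[OF a3] admD(5)[OF u] h
      by (intro integral_mono) (auto simp: u1_def u3_def indicator_def)
    finally show ?thesis .
  qed
  ultimately show ?thesis unfolding en_def m2 by linarith
qed

end

text \<open>\<open>I\<close> will be the infimum of the energy over \<open>W_star\<close>, restated
  for Borel representatives.\<close>

locale en_bounded = cyl_kernel +
  fixes M I :: real
  assumes M_pos: "M > 0" and I_neg: "I < 0"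
    and I_le: "adm R u \<Longrightarrow> axisymmetric u \<Longrightarrow> mass u = M \<Longrightarrow> I \<le> en u"
begin

text \<open>The energy is homogeneous of degree two because \<open>\<gamma> = 2\<close>.\<close>

lemma en_ge_mass:
  assumes u: "adm R u" and ax: "axisymmetric u"
  shows "en u \<ge> I * (mass u / M)\<^sup>2"
proof (cases "mass u = 0")
  case True
  have "Q u u \<le> Pb u * mass u" by (rule Q_le[OF u u]) (rule pot_le_Pb[OF u])
  then have "Q u u \<le> 0" using True by simp
  moreover have "nrm2 u \<ge> 0" by (rule Bochner_Integration.integral_nonneg) simp
  moreover have "I * (mass u / M)\<^sup>2 = 0" using True by simp
  ultimately show ?thesis unfolding en_def by linarith
next
  case False
  let ?m = "mass u"
  have m: "?m > 0" using False mass_nonneg[OF u] by simp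
  have "axisymmetric (\<lambda>x. M / ?m * u x)"
    using ax unfolding axisymmetric_def by (auto intro: exI[of _ "\<lambda>r z. M / ?m * f r z" for f])
  moreover have "adm R (\<lambda>x. M / ?m * u x)" using m M_pos by (intro adm_scale[OF u]) auto
  moreover have "mass (\<lambda>x. M / ?m * u x) = M" using m by simp
  ultimately have "I \<le> en (\<lambda>x. M / ?m * u x)" by (intro I_le)
  then have "I \<le> (M / ?m)\<^sup>2 * en u" unfolding en_scale .
  then have "(?m / M)\<^sup>2 * I \<le> (?m / M)\<^sup>2 * ((M / ?m)\<^sup>2 * en u)" by (intro mult_left_mono) auto
  also have "\<dots> = en u" using m M_pos by (simp add: field_simps)
  finally show ?thesis by (simp add: mult.commute)
qed

text \<open>Pieces of masses \<open>p\<close> and \<open>q\<close> have total energy at least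
  \<open>I * (p\<^sup>2 + q\<^sup>2) / M\<^sup>2\<close>. As \<open>p + q \<le> M\<close> and
  \<open>I < 0\<close>, this exceeds \<open>I\<close> by at least
  \<open>2 * (- I) * p * q / M\<^sup>2\<close>, and \<open>en_split\<close> compares it with the
  energy of \<open>u\<close>.\<close>

lemma cut_excess:
  assumes u: "adm R u" and ax: "axisymmetric u" and M: "mass u = M" and h: "h \<ge> 1"
    and P: "\<And>x. x \<in> cyl R \<Longrightarrow> pot u x \<le> P"
  shows "2 * (- I / M\<^sup>2) * (below u b * (M - below u (b + h)))
    \<le> en u - I + 2 * (Cf / h * M\<^sup>2) + 2 * (P * (below u (b + h) - below u b))"
proof -
  let ?u1 = "\<lambda>x. u x * indicator {x. x $ 3 < b} x" and ?u3 = "\<lambda>x. u x * indicator {x. b + h \<le> x $ 3} x"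
  have m1: "mass ?u1 = below u b" and m3: "mass ?u3 = M - below u (b + h)"
    using above_eq[OF u] M by (auto simp: below_def)
  have 1: "en ?u1 \<ge> I * (below u b / M)\<^sup>2"
    using en_ge_mass[OF adm_restrict[OF u] axisymmetric_restrict_slab[OF ax], of "\<lambda>z. z < b"] m1 by simp
  have 3: "en ?u3 \<ge> I * ((M - below u (b + h)) / M)\<^sup>2"
    using en_ge_mass[OF adm_restrict[OF u] axisymmetric_restrict_slab[OF ax], of "\<lambda>z. b + h \<le> z"] m3 by simp
  let ?p = "below u b" and ?q = "M - below u (b + h)"
  have p: "?p \<ge> 0" "?q \<ge> 0" "?p + ?q \<le> M"
    using below_le_mass[OF u] below_mono[OF u, of b "b + h"] h M by auto
  have "2 * (- I / M\<^sup>2) * (p * q) \<le> I * (p / M)\<^sup>2 + I * (q / M)\<^sup>2 - I" if "p \<ge> 0" "q \<ge> 0" "p + q \<le> M" for p q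
  proof -
    have "p\<^sup>2 + q\<^sup>2 + 2 * (p * q) = (p + q)\<^sup>2" by (simp add: power2_sum)
    also have "\<dots> \<le> M\<^sup>2" using that by (intro power_mono) auto
    finally have "(p\<^sup>2 + q\<^sup>2 + 2 * (p * q)) / M\<^sup>2 \<le> 1" using M_pos by simp
    then have "(- I) * ((p\<^sup>2 + q\<^sup>2 + 2 * (p * q)) / M\<^sup>2) \<le> (- I) * 1"
      using I_neg by (intro mult_left_mono) auto
    then show ?thesis by (simp add: power_divide add_divide_distrib algebra_simps)
  qed
  from this[OF p] have "2 * (- I / M\<^sup>2) * (?p * ?q) \<le> I * (?p / M)\<^sup>2 + I * (?q / M)\<^sup>2 - I" .
  then show ?thesis using 1 3 en_split[OF u h P, of b] M by simp
qed

text \<open>Pigeonhole: the masses of the \<open>K\<close> consecutive layers telescope to at most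
  \<open>M\<close>.\<close>

lemma thin_layer:
  assumes u: "adm R u" and M: "mass u = M" and K: "K > 0" and h: "h \<ge> 0"
  shows "\<exists>j<K. below u (c + real (Suc j) * h) - below u (c + real j * h) \<le> M / real K"
proof (rule ccontr)
  assume "\<not> ?thesis"
  then have "below u (c + real (Suc j) * h) - below u (c + real j * h) > M / real K" if "j < K" for j
    using that by (auto simp: not_le)
  then have "(\<Sum>j<K. M / real K) < (\<Sum>j<K. below u (c + real (Suc j) * h) - below u (c + real j * h))"
    using K by (intro sum_strict_mono) auto
  also have "\<dots> = below u (c + real K * h) - below u (c + real 0 * h)"
    by (rule sum_lessThan_telescope)
  also have "\<dots> \<le> M" using below_le_mass[OF u] M by (smt (verit))
  finally show False using K by simp
qed

text \<open>For a cut between the median and the tail, the piece on the side of the median has mass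
  at least \<open>M / 2\<close>, so the product in \<open>cut_excess\<close> is at least
  \<open>M / 2\<close> times the tail. Solving for the tail gives the prefactor
  \<open>M / - I\<close>.\<close>

lemma tails_bound:
  assumes u: "adm R u" and ax: "axisymmetric u" and M: "mass u = M" and h: "h \<ge> 1" and K: "K > 0"
    and P: "\<And>x. x \<in> cyl R \<Longrightarrow> pot u x \<le> P" and P0: "P \<ge> 0"
    and a: "below u a \<le> M / 2" "M / 2 \<le> below u (a + 1)"
  defines "\<eta> \<equiv> (M / - I) * (en u - I + 2 * (Cf / h * M\<^sup>2) + 2 * (P * (M / real K)))"
  shows "below u (a - real K * h) \<le> \<eta>" and "M - below u (a + 1 + real K * h) \<le> \<eta>"
proof -
  have key: "M / 2 * T \<le> M\<^sup>2 / (2 * - I) * (en u - I + 2 * (Cf / h * M\<^sup>2) + 2 * (P * (M / real K)))"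
    if "M / 2 * T \<le> below u b * (M - below u (b + h))" "below u (b + h) - below u b \<le> M / real K" for T b
  proof -
    have "2 * (- I / M\<^sup>2) * (M / 2 * T) \<le> 2 * (- I / M\<^sup>2) * (below u b * (M - below u (b + h)))"
    proof (rule mult_left_mono[OF that(1)])
      have "0 \<le> - I / M\<^sup>2" using I_neg by (intro divide_nonneg_nonneg) auto
      then show "0 \<le> 2 * (- I / M\<^sup>2)" by (rule mult_nonneg_nonneg[rotated]) simp
    qed
    also have "\<dots> \<le> en u - I + 2 * (Cf / h * M\<^sup>2) + 2 * (P * (below u (b + h) - below u b))"
      by (rule cut_excess[OF u ax M h P])
    also have "\<dots> \<le> en u - I + 2 * (Cf / h * M\<^sup>2) + 2 * (P * (M / real K))"
      using that P0 by (intro add_left_mono mult_left_mono) auto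
    finally have "M\<^sup>2 / (2 * - I) * (2 * (- I / M\<^sup>2) * (M / 2 * T)) \<le> M\<^sup>2 / (2 * - I) * \<dots>"
      using I_neg by (intro mult_left_mono divide_nonneg_pos) auto
    moreover have "M\<^sup>2 / (2 * - I) * (2 * (- I / M\<^sup>2) * (M / 2 * T)) = M / 2 * T"
      using I_neg M_pos by (simp add: field_simps)
    ultimately show ?thesis by argo
  qed
  have fin: "T \<le> \<eta>" if "M / 2 * T \<le> M\<^sup>2 / (2 * - I) * (en u - I + 2 * (Cf / h * M\<^sup>2) + 2 * (P * (M / real K)))" for T
  proof -
    have "2 / M * (M / 2 * T) \<le> 2 / M * (M\<^sup>2 / (2 * - I) * (en u - I + 2 * (Cf / h * M\<^sup>2) + 2 * (P * (M / real K))))"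
      using that M_pos by (intro mult_left_mono) auto
    also have "\<dots> = \<eta>" unfolding \<eta>_def using M_pos I_neg by (simp add: field_simps power2_eq_square)
    finally show ?thesis using M_pos by simp
  qed
  have h0: "h \<ge> 0" using h by simp
  \<comment> \<open>The layers start at \<open>a + 1\<close>, below which at least half of the mass
    lies; whichever of them is thin, the lower piece is heavy.\<close>
  obtain j where j: "j < K" "below u (a + 1 + real (Suc j) * h) - below u (a + 1 + real j * h) \<le> M / real K"
    using thin_layer[OF u M K h0, of "a + 1"] by auto
  let ?b = "a + 1 + real j * h"
  have bh: "?b + h = a + 1 + real (Suc j) * h" by (simp add: algebra_simps)
  have "real (Suc j) * h \<le> real K * h" using j(1) h0 by (intro mult_right_mono) auto
  then have "below u (?b + h) \<le> below u (a + 1 + real K * h)" unfolding bh by (intro below_mono[OF u]) simp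
  moreover have "below u (a + 1) \<le> below u ?b" using h0 by (intro below_mono[OF u]) simp
  ultimately have "M / 2 * (M - below u (a + 1 + real K * h)) \<le> below u ?b * (M - below u (?b + h))"
    using a below_le_mass[OF u] M M_pos by (intro mult_mono) (auto intro: order_trans)
  then show "M - below u (a + 1 + real K * h) \<le> \<eta>"
    using key[of _ ?b] j(2) fin unfolding bh by blast
  \<comment> \<open>For the lower tail the layers end at \<open>a\<close>, below which at most half
    of the mass lies, and the roles of the two pieces are exchanged.\<close>
  obtain j where j: "j < K" "below u (a - real K * h + real (Suc j) * h) - below u (a - real K * h + real j * h) \<le> M / real K"
    using thin_layer[OF u M K h0, of "a - real K * h"] by auto
  let ?b = "a - real K * h + real j * h"
  have bh: "?b + h = a - real K * h + real (Suc j) * h" by (simp add: algebra_simps)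
  have "real (Suc j) * h \<le> real K * h" using j(1) h0 by (intro mult_right_mono) auto
  then have "below u (?b + h) \<le> below u a" unfolding bh by (intro below_mono[OF u]) simp
  moreover have "below u (a - real K * h) \<le> below u ?b" using h0 by (intro below_mono[OF u]) simp
  ultimately have "below u (a - real K * h) * (M / 2) \<le> below u ?b * (M - below u (?b + h))"
    using a below_le_mass[OF u] M M_pos by (intro mult_mono) auto
  then have "M / 2 * below u (a - real K * h) \<le> below u ?b * (M - below u (?b + h))" by (simp only: mult.commute)
  then show "below u (a - real K * h) \<le> \<eta>"
    using key[of _ ?b] j(2) fin unfolding bh by blast
qed

end

lemma norm3_sq: "(norm (x :: real^3))\<^sup>2 = (cyl_r x)\<^sup>2 + (x $ 3)\<^sup>2"
  by (simp add: norm_vec_def L2_set_def sum_3 cyl_r_def)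

lemma cyl_segment_finite: "emeasure lborel (cyl R \<inter> {x. \<bar>x $ 3 - c\<bar> \<le> L}) < \<infinity>"
proof -
  have "cyl R \<inter> {x. \<bar>x $ 3 - c\<bar> \<le> L} \<subseteq> cball 0 (\<bar>R\<bar> + (\<bar>c\<bar> + \<bar>L\<bar>))"
  proof
    fix x assume "x \<in> cyl R \<inter> {x. \<bar>x $ 3 - c\<bar> \<le> L}"
    then have "cyl_r x \<le> \<bar>R\<bar>" "\<bar>x $ 3\<bar> \<le> \<bar>c\<bar> + \<bar>L\<bar>" by (auto simp: cyl_def)
    then have "(cyl_r x)\<^sup>2 \<le> \<bar>R\<bar>\<^sup>2" "\<bar>x $ 3\<bar>\<^sup>2 \<le> (\<bar>c\<bar> + \<bar>L\<bar>)\<^sup>2" by (intro power_mono; simp)+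
    then have "(norm x)\<^sup>2 \<le> \<bar>R\<bar>\<^sup>2 + (\<bar>c\<bar> + \<bar>L\<bar>)\<^sup>2" by (simp add: norm3_sq)
    also have "\<dots> \<le> (\<bar>R\<bar> + (\<bar>c\<bar> + \<bar>L\<bar>))\<^sup>2" unfolding power2_sum[of "\<bar>R\<bar>"] by simp
    finally show "x \<in> cball 0 (\<bar>R\<bar> + (\<bar>c\<bar> + \<bar>L\<bar>))"
      using power2_le_imp_le[of "norm x" "\<bar>R\<bar> + (\<bar>c\<bar> + \<bar>L\<bar>)"] by simp
  qed
  then have "emeasure lborel (cyl R \<inter> {x. \<bar>x $ 3 - c\<bar> \<le> L}) \<le> emeasure lborel (cball (0::real^3) (\<bar>R\<bar> + (\<bar>c\<bar> + \<bar>L\<bar>)))"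
    by (rule emeasure_mono) simp
  also have "\<dots> < \<infinity>" using emeasure_bounded_finite[of "cball (0::real^3) (\<bar>R\<bar> + (\<bar>c\<bar> + \<bar>L\<bar>))"] by simp
  finally show ?thesis .
qed

lemma segment_sets [measurable]: "{x::real^3. \<bar>x $ 3 - c\<bar> \<le> L} \<in> sets borel"
  by measurable

section \<open>Convergence of potentials and lower semicontinuity of the energy\<close>

context cyl_kernel begin

lemma k_far_le:
  assumes "x \<in> cyl R" "y \<in> cyl R" "\<bar>x $ 3 - y $ 3\<bar> \<ge> h" "h \<ge> 1"
  shows "k x y \<le> Cf / h"
proof -
  have "k x y \<le> Cf / \<bar>x $ 3 - y $ 3\<bar>" using far assms by auto
  also have "\<dots> \<le> Cf / h" using assms const_pos by (intro divide_left_mono mult_pos_pos) auto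
  finally show ?thesis .
qed

text \<open>For fixed \<open>x\<close> the kernel, cut off to a segment of the cylinder, is square
  integrable and hence a test function; the discarded part contributes at most \<open>Cf / h\<close>
  times the mass, uniformly in \<open>i\<close>.\<close>

lemma pot_tendsto:
  assumes w: "\<And>i. adm R (w i)" and v: "adm R v" and mw: "\<And>i. mass (w i) \<le> M" and M: "M \<ge> 0"
    and weak: "\<And>g. g \<in> borel_measurable borel \<Longrightarrow> integrable lborel (\<lambda>x. (g x)\<^sup>2) \<Longrightarrow>
      (\<lambda>i. LINT x|lborel. w i x * g x) \<longlonglongrightarrow> (LINT x|lborel. v x * g x)"
    and x: "x \<in> cyl R"
  shows "(\<lambda>i. pot (w i) x) \<longlonglongrightarrow> pot v x"
proof (rule tendsto_approx)
  fix \<epsilon> :: real assume e: "\<epsilon> > 0"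
  define m where "m = max M (mass v)"
  have m: "m \<ge> 0" "mass v \<le> m" "\<And>i. mass (w i) \<le> m" using mw M by (auto simp: m_def le_max_iff_disj)
  \<comment> \<open>Chosen for \<open>Cf / h * m \<le> \<epsilon>\<close>; \<open>h \<ge> 1\<close>
    ensures that \<open>far\<close> applies to everything cut off.\<close>
  define h where "h = 1 + Cf * m / \<epsilon>"
  have h: "h \<ge> 1" using e m const_pos by (simp add: h_def)
  have hm: "Cf / h * m \<le> \<epsilon>"
  proof -
    have "Cf * m = (h - 1) * \<epsilon>" using e by (simp add: h_def)
    also have "\<dots> \<le> h * \<epsilon>" using e by simp
    finally show ?thesis using h by (simp add: field_simps)
  qed
  define S where "S = cyl R \<inter> {y. \<bar>y $ 3 - x $ 3\<bar> \<le> h}"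
  have [measurable]: "S \<in> sets borel" by (simp add: S_def)
  define g where "g y = k x y * indicator S y" for y
  have gm [measurable]: "g \<in> borel_measurable borel" unfolding g_def[abs_def] by measurable
  have g2: "integrable lborel (\<lambda>y. (g y)\<^sup>2)"
  proof (rule Bochner_Integration.integrable_bound)
    show "integrable lborel (\<lambda>y. (k x y)\<^sup>2 * indicator (cyl R \<inter> slab x) y + Cf\<^sup>2 * indicator S y)"
      using k_near_sq(1)[OF x] cyl_segment_finite[of R "x $ 3" h]
      by (intro Bochner_Integration.integrable_add integrable_mult_right integrable_real_indicator) (auto simp: S_def)
    show "AE y in lborel. norm ((g y)\<^sup>2) \<le> norm ((k x y)\<^sup>2 * indicator (cyl R \<inter> slab x) y + Cf\<^sup>2 * indicator S y)"
    proof (rule AE_I2)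
      fix y
      show "norm ((g y)\<^sup>2) \<le> norm ((k x y)\<^sup>2 * indicator (cyl R \<inter> slab x) y + Cf\<^sup>2 * indicator S y)"
      proof (cases "y \<in> S \<and> y \<notin> slab x")
        case True
        then have "k x y \<le> Cf / 1" using x by (intro k_far_le) (auto simp: S_def slab_def)
        then have "(k x y)\<^sup>2 \<le> Cf\<^sup>2" using k_nonneg by (intro power_mono) auto
        then show ?thesis using True by (simp add: g_def)
      qed (auto simp: g_def indicator_def S_def)
    qed
  qed simp
  have err: "\<bar>pot f x - (LINT y|lborel. f y * g y)\<bar> \<le> \<epsilon>" if f: "adm R f" and fm: "mass f \<le> m" for f
  proof -
    note [measurable] = admD(1)[OF f]
    have i1: "integrable lborel (\<lambda>y. k x y * f y)" by (rule pot_bound(1)[OF f x, of 1]) simp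
    have i2: "integrable lborel (\<lambda>y. f y * g y)"
      by (rule Bochner_Integration.integrable_bound[OF i1]) (auto simp: g_def indicator_def mult.commute)
    have "pot f x - (LINT y|lborel. f y * g y) = (LINT y|lborel. k x y * f y - f y * g y)"
      unfolding pot_def using i1 i2 by simp
    also have "\<bar>\<dots>\<bar> \<le> (LINT y|lborel. \<bar>k x y * f y - f y * g y\<bar>)" by (rule integral_abs_bound)
    also have "\<dots> \<le> (LINT y|lborel. Cf / h * f y)"
    proof (rule integral_mono)
      show "integrable lborel (\<lambda>y. \<bar>k x y * f y - f y * g y\<bar>)" using i1 i2 by auto
      show "integrable lborel (\<lambda>y. Cf / h * f y)" using admD(4)[OF f] by simp
      fix y
      have c0: "0 \<le> Cf / h * f y" using const_pos h admD(2)[OF f] by simp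
      show "\<bar>k x y * f y - f y * g y\<bar> \<le> Cf / h * f y"
      proof (cases "y \<in> cyl R \<and> y \<notin> S")
        case True
        then have "k x y \<le> Cf / h" using x h by (intro k_far_le) (auto simp: S_def)
        then have "k x y * f y \<le> Cf / h * f y" using admD(2)[OF f] by (intro mult_right_mono)
        then show ?thesis using True k_nonneg admD(2)[OF f] by (simp add: g_def abs_of_nonneg)
      next
        case False
        then have eq0: "k x y * f y - f y * g y = 0" using admD(3)[OF f, of y] by (auto simp: g_def)
        show ?thesis unfolding eq0 using c0 by simp
      qed
    qed
    also have "\<dots> = Cf / h * mass f" by (rule integral_mult_right_zero)
    also have "\<dots> \<le> Cf / h * m" using fm const_pos h by (intro mult_left_mono) auto
    finally show ?thesis using hm by simp
  qed
  show "\<exists>ga l. ga \<longlonglongrightarrow> l \<and> (\<forall>i. \<bar>pot (w i) x - ga i\<bar> \<le> \<epsilon>) \<and> \<bar>pot v x - l\<bar> \<le> \<epsilon>"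
    using weak[OF gm g2] err[OF w m(3)] err[OF v m(2)] by blast
qed

text \<open>The potential energy is weakly continuous along tight sequences, whereas the internal energy is
  only weakly lower semicontinuous.\<close>

lemma en_weak_lsc:
  assumes w: "\<And>i. adm R (w i)" and v: "adm R v" and mw: "\<And>i. mass (w i) \<le> M" and nw: "\<And>i. nrm2 (w i) \<le> B"
    and weak: "\<And>g. g \<in> borel_measurable borel \<Longrightarrow> integrable lborel (\<lambda>x. (g x)\<^sup>2) \<Longrightarrow>
      (\<lambda>i. LINT x|lborel. w i x * g x) \<longlonglongrightarrow> (LINT x|lborel. v x * g x)"
    and tight: "\<And>\<epsilon>. \<epsilon> > 0 \<Longrightarrow> \<exists>L. \<forall>i. (LINT x|lborel. w i x * indicator (- {x. \<bar>x $ 3 - 0\<bar> \<le> L}) x) \<le> \<epsilon>"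
    and lim: "(\<lambda>i. en (w i)) \<longlonglongrightarrow> I"
  shows "en v \<le> I"
proof (rule field_le_epsilon)
  fix e :: real assume e: "e > 0"
  have M0: "M \<ge> 0" using mw[of 0] mass_nonneg[OF w, of 0] by linarith
  have B0: "B \<ge> 0" using nw[of 0] order_trans[OF Bochner_Integration.integral_nonneg[of lborel "\<lambda>x. (w 0 x)\<^sup>2"]] by simp
  note [measurable] = admD(1)[OF w] admD(1)[OF v] pot_measurable[OF w] pot_measurable[OF v]
  define P where "P = Cn / 2 + 1 / 2 * B + Cf * M + Pb v"
  have Pv: "pot v x \<le> P" if "x \<in> cyl R" for x
  proof -
    have "0 \<le> Cf * M" using const_pos M0 by simp
    then show ?thesis using pot_le_Pb[OF v that] const_pos B0 unfolding P_def by linarith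
  qed
  have Pv0: "Pb v \<ge> 0"
    using const_pos mass_nonneg[OF v] Bochner_Integration.integral_nonneg[of lborel "\<lambda>x. (v x)\<^sup>2"] by (simp add: Pb_def)
  have Pw: "pot (w i) x \<le> P" if "x \<in> cyl R" for x i
  proof -
    have "Cf * mass (w i) \<le> Cf * M" using mw const_pos by (intro mult_left_mono) auto
    then show ?thesis using pot_le_Pb[OF w that, of i] nw[of i] Pv0 by (simp add: P_def Pb_def)
  qed
  have P0: "P \<ge> 0" using const_pos B0 M0 Pv0 by (simp add: P_def)
  \<comment> \<open>The allowance \<open>e\<close> is shared by three errors: mass at most
    \<open>e1\<close> in the tail against a potential at most \<open>P\<close>, the L2 bound
    \<open>B\<close> times the weight \<open>t / 2\<close>, and the L2 distance of the potentials on
    \<open>D\<close>.\<close>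
  define e1 where "e1 = e / (3 * (P + 1))"
  have e1: "e1 > 0" "P * e1 \<le> e / 3" using e P0 by (auto simp: e1_def field_simps)
  obtain L where L: "\<And>i. (LINT x|lborel. w i x * indicator (- {x. \<bar>x $ 3 - 0\<bar> \<le> L}) x) \<le> e1"
    using tight[OF e1(1)] by auto
  define D where "D = cyl R \<inter> {x. \<bar>x $ 3 - 0\<bar> \<le> L}"
  have D [measurable]: "D \<in> sets borel" unfolding D_def by simp
  define t where "t = e / (3 * (B + 1))"
  have t: "t > 0" "t / 2 * B \<le> e / 3" using e B0 by (auto simp: t_def field_simps)
  \<comment> \<open>The potentials converge pointwise and are bounded by \<open>P\<close>; the
    cutoff to \<open>D\<close>, of finite measure, turns this into L2 convergence by
    domination.\<close>
  define d where "d i x = (pot (w i) x - pot v x) * indicator D x" for i x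
  have [measurable]: "d i \<in> borel_measurable borel" for i unfolding d_def[abs_def] by measurable
  have db: "\<bar>d i x\<bar> \<le> P * indicator D x" for i x
    using Pv[of x] Pw[of x i] pot_nonneg[OF v, of x] pot_nonneg[OF w, of i x]
    by (cases "x \<in> D") (auto simp: d_def D_def abs_le_iff)
  have db2: "(d i x)\<^sup>2 \<le> P\<^sup>2 * indicator D x" for i x
    using power_mono[OF db[of i x], of 2] by (cases "x \<in> D") auto
  have iD: "integrable lborel (\<lambda>x. P\<^sup>2 * indicator D x)"
    using cyl_segment_finite[of R 0 L] unfolding D_def by (intro integrable_mult_right integrable_real_indicator) auto
  have d2: "integrable lborel (\<lambda>x. (d i x)\<^sup>2)" for i
    by (rule Bochner_Integration.integrable_bound[OF iD]) (use db2 in auto)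
  have "(\<lambda>i. LINT x|lborel. (d i x)\<^sup>2) \<longlonglongrightarrow> (LINT x|(lborel :: (real^3) measure). 0)"
  proof (rule integral_dominated_convergence[OF _ _ iD])
    have "(\<lambda>i. (d i x)\<^sup>2) \<longlonglongrightarrow> 0" for x
    proof (cases "x \<in> D")
      case True
      then have "(\<lambda>i. pot (w i) x) \<longlonglongrightarrow> pot v x" by (intro pot_tendsto[OF w v mw M0 weak]) (auto simp: D_def)
      then have "(\<lambda>i. (pot (w i) x - pot v x)\<^sup>2) \<longlonglongrightarrow> (pot v x - pot v x)\<^sup>2" by (intro tendsto_intros)
      then show ?thesis using True by (simp add: d_def)
    qed (simp add: d_def)
    then show "AE x in lborel. (\<lambda>i. (d i x)\<^sup>2) \<longlonglongrightarrow> 0" by simp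
    show "AE x in lborel. norm ((d i x)\<^sup>2) \<le> P\<^sup>2 * indicator D x" for i using db2 by simp
  qed auto
  then have ev: "eventually (\<lambda>i. (LINT x|lborel. (d i x)\<^sup>2) < 2 * t * (e / 3)) sequentially"
    using t e by (intro order_tendstoD(2)[of _ 0]) auto
  let ?g = "\<lambda>x. pot v x * indicator D x"
  have g2: "integrable lborel (\<lambda>x. (?g x)\<^sup>2)"
  proof (rule Bochner_Integration.integrable_bound[OF iD])
    have "(?g x)\<^sup>2 \<le> P\<^sup>2 * indicator D x" for x
      using Pv[of x] pot_nonneg[OF v, of x] by (cases "x \<in> D") (auto simp: D_def intro!: power_mono)
    then show "AE x in lborel. norm ((?g x)\<^sup>2) \<le> norm (P\<^sup>2 * indicator D x)" by simp
  qed simp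
  have Qle: "Q (w i) (w i) \<le> (LINT x|lborel. w i x * ?g x) + (t / 2 * B + 1 / (2 * t) * (LINT x|lborel. (d i x)\<^sup>2)) + P * e1" for i
  proof -
    have i1: "integrable lborel (\<lambda>x. w i x * ?g x)" by (rule L2_product_bound(1)[OF _ _ admD(5)[OF w] g2]) auto
    have i2: "integrable lborel (\<lambda>x. w i x * d i x)" by (rule L2_product_bound(1)[OF _ _ admD(5)[OF w] d2]) auto
    have aw: "adm R (\<lambda>x. w i x * indicator (- {x. \<bar>x $ 3 - 0\<bar> \<le> L}) x)" by (rule adm_restrict[OF w]) simp
    have i3: "integrable lborel (\<lambda>x. P * (w i x * indicator (- {x. \<bar>x $ 3 - 0\<bar> \<le> L}) x))"
      using admD(4)[OF aw] by simp
    have "Q (w i) (w i) \<le> (LINT x|lborel. w i x * ?g x + w i x * d i x + P * (w i x * indicator (- {x. \<bar>x $ 3 - 0\<bar> \<le> L}) x))"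
      unfolding Q_def
    proof (rule integral_mono[OF Q_integrable[OF w w]])
      show "integrable lborel (\<lambda>x. w i x * ?g x + w i x * d i x + P * (w i x * indicator (- {x. \<bar>x $ 3 - 0\<bar> \<le> L}) x))"
        using i1 i2 i3 by (intro Bochner_Integration.integrable_add)
      fix x
      consider "x \<in> D" | "x \<notin> cyl R" | "x \<in> cyl R" "\<not> \<bar>x $ 3 - 0\<bar> \<le> L" by (auto simp: D_def)
      then show "w i x * pot (w i) x \<le> w i x * ?g x + w i x * d i x + P * (w i x * indicator (- {x. \<bar>x $ 3 - 0\<bar> \<le> L}) x)"
      proof cases
        case 1 then show ?thesis by (simp add: d_def D_def algebra_simps)
      next
        case 2 then show ?thesis using admD(3)[OF w] by simp
      next
        case 3
        then have "w i x * pot (w i) x \<le> w i x * P" using Pw admD(2)[OF w] by (intro mult_left_mono) auto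
        then show ?thesis using 3 by (simp add: d_def D_def mult.commute)
      qed
    qed
    also have "\<dots> = (LINT x|lborel. w i x * ?g x) + (LINT x|lborel. w i x * d i x) + P * (LINT x|lborel. w i x * indicator (- {x. \<bar>x $ 3 - 0\<bar> \<le> L}) x)"
      using i1 i2 i3 by (simp add: Bochner_Integration.integral_add)
    also have "(LINT x|lborel. w i x * d i x) \<le> (LINT x|lborel. \<bar>w i x * d i x\<bar>)"
      using i2 by (intro integral_mono) auto
    also have "\<dots> \<le> t / 2 * nrm2 (w i) + 1 / (2 * t) * (LINT x|lborel. (d i x)\<^sup>2)"
      by (rule L2_product_bound(2)[OF _ _ admD(5)[OF w] d2 t(1)]) auto
    also have "t / 2 * nrm2 (w i) \<le> t / 2 * B" using nw t by (intro mult_left_mono) auto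
    also have "P * (LINT x|lborel. w i x * indicator (- {x. \<bar>x $ 3 - 0\<bar> \<le> L}) x) \<le> P * e1"
      using L P0 by (intro mult_left_mono)
    finally show ?thesis by simp
  qed
  \<comment> \<open>Nonnegativity of the square of \<open>w i x - v x\<close> bounds the norm below
    by an expression linear in \<open>w i\<close>, to which weak convergence applies.\<close>
  have nle: "nrm2 (w i) \<ge> 2 * (LINT x|lborel. w i x * v x) - nrm2 v" for i
  proof -
    have iwv: "integrable lborel (\<lambda>x. w i x * v x)" by (rule L2_product_bound(1)[OF _ _ admD(5)[OF w] admD(5)[OF v]]) auto
    have "2 * (LINT x|lborel. w i x * v x) - nrm2 v = (LINT x|lborel. 2 * (w i x * v x) - (v x)\<^sup>2)"
      using iwv admD(5)[OF v] by simp
    also have "\<dots> \<le> nrm2 (w i)"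
    proof (rule integral_mono)
      show "2 * (w i x * v x) - (v x)\<^sup>2 \<le> (w i x)\<^sup>2" for x
        using zero_le_power2[of "w i x - v x"] by (simp add: power2_diff)
    qed (use iwv admD(5)[OF v] admD(5)[OF w] in auto)
    finally show ?thesis .
  qed
  have "(\<lambda>i. 2 * (LINT x|lborel. w i x * v x) - nrm2 v - (LINT x|lborel. w i x * ?g x) - e)
     \<longlonglongrightarrow> 2 * (LINT x|lborel. v x * v x) - nrm2 v - (LINT x|lborel. v x * ?g x) - e"
    by (intro tendsto_diff tendsto_mult tendsto_const weak g2 admD(5)[OF v]) auto
  moreover have "eventually (\<lambda>i. 2 * (LINT x|lborel. w i x * v x) - nrm2 v - (LINT x|lborel. w i x * ?g x) - e \<le> en (w i)) sequentially"
    using ev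
  proof eventually_elim
    case (elim i)
    have "1 / (2 * t) * (LINT x|lborel. (d i x)\<^sup>2) \<le> 1 / (2 * t) * (2 * t * (e / 3))"
      using elim t by (intro mult_left_mono) auto
    also have "\<dots> = e / 3" using t by simp
    finally show ?case using Qle[of i] nle[of i] t e1 unfolding en_def by linarith
  qed
  ultimately have "2 * (LINT x|lborel. v x * v x) - nrm2 v - (LINT x|lborel. v x * ?g x) - e \<le> I"
    using tendsto_le[OF _ lim] by simp
  moreover have "(LINT x|lborel. v x * v x) = nrm2 v" by (simp add: power2_eq_square)
  moreover have "(LINT x|lborel. v x * ?g x) \<le> Q v v"
    unfolding Q_def
  proof (rule integral_mono[OF _ Q_integrable[OF v v]])
    show "integrable lborel (\<lambda>x. v x * ?g x)" by (rule L2_product_bound(1)[OF _ _ admD(5)[OF v] g2]) auto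
    show "v x * ?g x \<le> v x * pot v x" for x
      using admD(2)[OF v, of x] pot_nonneg[OF v, of x] by (cases "x \<in> D") auto
  qed
  ultimately show "en v \<le> I + e" unfolding en_def by linarith
qed


lemma Pb_le_en: "adm R u \<Longrightarrow> Pb u \<le> Cn / 2 + en u + Cn / 2 * (mass u)\<^sup>2 + Cf * (mass u)\<^sup>2 + Cf * mass u"
  using en_lower[of u] by (simp add: Pb_def)

end

section \<open>Vertical translations\<close>

lemma integral_translate:
  fixes f :: "real^3 \<Rightarrow> real"
  assumes [measurable]: "f \<in> borel_measurable borel"
  shows "(LINT x|lborel. f (x + c)) = (LINT x|lborel. f x)"
    and "integrable lborel (\<lambda>x. f (x + c)) \<longleftrightarrow> integrable lborel f"
proof -
  have "(LINT x|lborel. f x) = (LINT x|distr lborel borel ((+) c). f x)" by (simp only: lborel_distr_plus)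
  also have "\<dots> = (LINT x|lborel. f (c + x))" by (subst integral_distr) auto
  finally show "(LINT x|lborel. f (x + c)) = (LINT x|lborel. f x)" by (simp add: add.commute)
  have "integrable lborel f \<longleftrightarrow> integrable (distr lborel borel ((+) c)) f" by (simp only: lborel_distr_plus)
  also have "\<dots> \<longleftrightarrow> integrable lborel (\<lambda>x. f (c + x))" by (subst integrable_distr_eq) auto
  finally show "integrable lborel (\<lambda>x. f (x + c)) \<longleftrightarrow> integrable lborel f" by (simp add: add.commute)
qed

lemma e3_nth [simp]: "e3 $ 1 = 0" "e3 $ 2 = 0" "e3 $ 3 = 1"
  by (simp_all add: e3_def axis_def)

lemma cyl_shift [simp]: "cyl_r (x + c *\<^sub>R e3) = cyl_r x" "x + c *\<^sub>R e3 \<in> cyl R \<longleftrightarrow> x \<in> cyl R"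
  by (simp_all add: cyl_r_def cyl_def)

lemma adm_shift:
  assumes u: "adm R u"
  shows "adm R (\<lambda>x. u (x + c *\<^sub>R e3))"
proof -
  note [measurable] = admD(1)[OF u]
  show ?thesis
    using integral_translate(2)[of u "c *\<^sub>R e3"] integral_translate(2)[of "\<lambda>x. (u x)\<^sup>2" "c *\<^sub>R e3"] admD[OF u]
    by (auto simp: adm_def)
qed

lemma axisymmetric_shift: "axisymmetric u \<Longrightarrow> axisymmetric (\<lambda>x. u (x + c *\<^sub>R e3))"
  unfolding axisymmetric_def by (auto intro: exI[of _ "\<lambda>r z. f r (z + c)" for f])

lemma (in cyl_kernel) en_shift:
  assumes u: "adm R u"
  shows "en (\<lambda>x. u (x + c *\<^sub>R e3)) = en u"
proof -
  note [measurable] = admD(1)[OF u] pot_measurable[OF u]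
  have "pot (\<lambda>x. u (x + c *\<^sub>R e3)) x = pot u (x + c *\<^sub>R e3)" for x
  proof -
    have "pot (\<lambda>x. u (x + c *\<^sub>R e3)) x = (LINT y|lborel. k (x + c *\<^sub>R e3) (y + c *\<^sub>R e3) * u (y + c *\<^sub>R e3))"
      by (simp add: pot_def k_shift)
    also have "\<dots> = pot u (x + c *\<^sub>R e3)"
      unfolding pot_def by (rule integral_translate(1)[of "\<lambda>y. k (x + c *\<^sub>R e3) y * u y"]) simp
    finally show ?thesis .
  qed
  then show ?thesis
    using integral_translate(1)[of "\<lambda>x. u x * pot u x" "c *\<^sub>R e3"] integral_translate(1)[of "\<lambda>x. (u x)\<^sup>2" "c *\<^sub>R e3"]
    by (simp add: en_def Q_def)
qed

lemma below_shift:
  assumes u: "adm R u"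
  shows "below (\<lambda>x. u (x + c *\<^sub>R e3)) b = below u (b + c)"
proof -
  note [measurable] = admD(1)[OF u]
  have "below (\<lambda>x. u (x + c *\<^sub>R e3)) b = (LINT x|lborel. u (x + c *\<^sub>R e3) * indicator {x. x $ 3 < b + c} (x + c *\<^sub>R e3))"
    by (simp add: below_def indicator_def)
  also have "\<dots> = below u (b + c)"
    unfolding below_def by (rule integral_translate(1)[of "\<lambda>x. u x * indicator {x. x $ 3 < b + c} x"]) simp
  finally show ?thesis .
qed

context en_bounded begin

text \<open>The heights \<open>a i\<close> are approximate medians. For late indices the energy
  excess is small and \<open>tails_bound\<close> applies with fixed \<open>h\<close> and
  \<open>K\<close>; the finitely many earlier densities have small tails individually. So the
  threshold for \<open>N\<close> is uniform in \<open>i\<close>.\<close>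

lemma tight_sequence:
  assumes u: "\<And>i. adm R (u i)" and ax: "\<And>i. axisymmetric (u i)" and M: "\<And>i. mass (u i) = M"
    and lim: "(\<lambda>i. en (u i)) \<longlonglongrightarrow> I"
  shows "\<exists>a. \<forall>\<epsilon>>0. eventually (\<lambda>N. \<forall>i. below (u i) (a i - real N) \<le> \<epsilon> \<and> M - below (u i) (a i + real N) \<le> \<epsilon>) sequentially"
proof -
  have "\<exists>a. below (u i) a \<le> M / 2 \<and> M / 2 \<le> below (u i) (a + 1)" for i
    using mass_median[OF u, of i] M M_pos by simp
  then obtain a where a: "\<And>i. below (u i) (a i) \<le> M / 2" "\<And>i. M / 2 \<le> below (u i) (a i + 1)" by metis
  obtain E where E: "\<And>i. en (u i) \<le> E"
  proof -
    have "Bseq (\<lambda>i. en (u i))" using lim by (intro convergent_imp_Bseq convergentI)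
    then obtain E where "\<And>i. norm (en (u i)) \<le> E" by (auto simp: Bseq_def)
    then show thesis by (intro that[of E]) (metis abs_le_D1 real_norm_def)
  qed
  define P where "P = \<bar>Cn / 2 + E + Cn / 2 * M\<^sup>2 + Cf * M\<^sup>2 + Cf * M\<bar>"
  have P: "pot (u i) x \<le> P" if "x \<in> cyl R" for i x
    using pot_le_Pb[OF u that, of i] Pb_le_en[OF u, of i] E[of i] M[of i] unfolding P_def by simp
  have P0: "P \<ge> 0" by (simp add: P_def)
  define T where "T i L \<epsilon> \<longleftrightarrow> below (u i) (a i - L) \<le> \<epsilon> \<and> M - below (u i) (a i + L) \<le> \<epsilon>" for i L \<epsilon>
  have Tmono: "T i L' \<epsilon>" if "T i L \<epsilon>" "L \<le> L'" for i L L' \<epsilon>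
    using that below_mono[OF u, of "a i - L'" "a i - L" i] below_mono[OF u, of "a i + L" "a i + L'" i]
    unfolding T_def by auto
  show ?thesis
  proof (intro exI[of _ a] allI impI)
    fix \<epsilon> :: real assume e: "\<epsilon> > 0"
    define c where "c = M / - I"
    have c: "c > 0" using M_pos I_neg by (simp add: c_def divide_pos_neg)
    \<comment> \<open>Each of the three terms of the tail bound gets a third of \<epsilon>:
      \<open>h\<close> controls the interaction, \<open>K\<close> the cost of the layer, and
      \<open>i0\<close> the energy excess.\<close>
    define h where "h = 1 + c * (2 * (Cf * M\<^sup>2)) / (\<epsilon> / 3)"
    have h: "h \<ge> 1" using c e const_pos by (simp add: h_def)
    have hb: "c * (2 * (Cf / h * M\<^sup>2)) \<le> \<epsilon> / 3"
    proof -
      have "c * (2 * (Cf * M\<^sup>2)) = (h - 1) * (\<epsilon> / 3)" using e by (simp add: h_def)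
      also have "\<dots> \<le> h * (\<epsilon> / 3)" using e by simp
      finally show ?thesis using h by (simp add: field_simps)
    qed
    obtain K :: nat where K: "c * (2 * (P * M)) / (\<epsilon> / 3) < real K" using reals_Archimedean2 by blast
    have K0: "K > 0"
    proof -
      have "0 \<le> c * (2 * (P * M)) / (\<epsilon> / 3)" using c P0 M_pos e by simp
      then show ?thesis using K by (cases K) auto
    qed
    have Kb: "c * (2 * (P * (M / real K))) \<le> \<epsilon> / 3"
      using K K0 e by (simp add: field_simps)
    have "(\<lambda>i. c * (en (u i) - I)) \<longlonglongrightarrow> c * (I - I)" by (intro tendsto_intros lim)
    then have "eventually (\<lambda>i. c * (en (u i) - I) < \<epsilon> / 3) sequentially"
      using e by (intro order_tendstoD(2)[of _ 0]) auto
    then obtain i0 where i0: "\<And>i. i \<ge> i0 \<Longrightarrow> c * (en (u i) - I) < \<epsilon> / 3" by (auto simp: eventually_sequentially)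
    \<comment> \<open>The extra 1 covers the unit gap between \<open>a\<close> and
      \<open>a + 1\<close> in \<open>tails_bound\<close>.\<close>
    have big: "T i (real K * h + 1) \<epsilon>" if "i \<ge> i0" for i
    proof -
      have "c * (en (u i) - I + 2 * (Cf / h * M\<^sup>2) + 2 * (P * (M / real K))) \<le> \<epsilon>"
        using i0[OF that] hb Kb unfolding distrib_left by linarith
      then have "below (u i) (a i - real K * h) \<le> \<epsilon>" "M - below (u i) (a i + 1 + real K * h) \<le> \<epsilon>"
        using tails_bound[OF u[of i] ax[of i] M[of i] h K0 P[where i = i] P0 a(1)[of i] a(2)[of i]]
        unfolding c_def by auto
      moreover have "below (u i) (a i - (real K * h + 1)) \<le> below (u i) (a i - real K * h)"
        by (intro below_mono[OF u]) simp
      ultimately show ?thesis unfolding T_def by (auto simp: add_ac)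
    qed
    have small: "eventually (\<lambda>N. T i (real N) \<epsilon>) sequentially" for i
    proof -
      have "eventually (\<lambda>N. below (u i) (a i - real N) < \<epsilon>) sequentially"
        using below_tendsto(2)[OF u] e by (intro order_tendstoD(2)[of _ 0]) auto
      moreover have "eventually (\<lambda>N. M - \<epsilon> < below (u i) (a i + real N)) sequentially"
        using below_tendsto(1)[OF u, of i "a i"] e M by (intro order_tendstoD(1)[of _ M]) auto
      ultimately show ?thesis unfolding T_def by eventually_elim auto
    qed
    have "eventually (\<lambda>N. \<forall>i\<in>{..<i0}. T i (real N) \<epsilon>) sequentially"
      using small by (intro eventually_ball_finite) auto
    moreover obtain N0 where N0: "real K * h + 1 < real N0" using reals_Archimedean2 by blast
    have "eventually (\<lambda>N. \<forall>i\<ge>i0. T i (real N) \<epsilon>) sequentially"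
    proof (rule eventually_sequentiallyI[of N0])
      fix N assume "N \<ge> N0"
      then have "real K * h + 1 \<le> real N" using N0 of_nat_mono[of N0 N, where 'a = real] by linarith
      then show "\<forall>i\<ge>i0. T i (real N) \<epsilon>" using big Tmono by blast
    qed
    ultimately show "eventually (\<lambda>N. \<forall>i. below (u i) (a i - real N) \<le> \<epsilon> \<and> M - below (u i) (a i + real N) \<le> \<epsilon>) sequentially"
    proof eventually_elim
      case (elim N)
      then have "T i (real N) \<epsilon>" for i by (cases "i < i0") auto
      then show ?case by (auto simp: T_def)
    qed
  qed
qed

end

section \<open>Reduction of the energy to Borel representatives\<close>

lemma lebesgue_lborel_transfer:
  fixes f g :: "'a::euclidean_space \<Rightarrow> real"
  assumes [measurable]: "g \<in> borel_measurable borel" and ae: "AE x in lborel. f x = g x"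
  shows "f \<in> borel_measurable lebesgue" "(LINT x|lebesgue. f x) = (LINT x|lborel. g x)"
    "integrable lebesgue f \<longleftrightarrow> integrable lborel g"
proof -
  have gl: "g \<in> borel_measurable lebesgue" by (rule measurable_completion) simp
  have ae': "AE x in lebesgue. g x = f x" using AE_completion[OF ae] by (auto elim!: eventually_mono)
  show fl: "f \<in> borel_measurable lebesgue" by (rule borel_measurable_AE[OF gl ae'])
  have "(LINT x|lebesgue. f x) = (LINT x|lebesgue. g x)"
    by (rule integral_cong_AE[OF fl gl]) (use ae' in \<open>auto elim!: eventually_mono\<close>)
  also have "\<dots> = (LINT x|lborel. g x)" by (rule integral_completion) simp
  finally show "(LINT x|lebesgue. f x) = (LINT x|lborel. g x)" .
  have "integrable lebesgue f \<longleftrightarrow> integrable lebesgue g"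
    by (rule integrable_cong_AE[OF fl gl]) (use ae' in \<open>auto elim!: eventually_mono\<close>)
  also have "\<dots> \<longleftrightarrow> integrable lborel g" by (rule integrable_completion) simp
  finally show "integrable lebesgue f \<longleftrightarrow> integrable lborel g" .
qed

text \<open>Half of \<open>4 * pi\<close> times the constant in \<open>G5\<close>: the half is the
  factor 1/2 of the energy, and the two minus signs cancel.\<close>

definition c5 :: real where
  "c5 = 2 * pi / (15 * measure lebesgue (ball (0 :: real ^ 5) 1))"

text \<open>The factor 1/2 of the energy is absorbed, so that minus the quadratic form is the full
  potential energy. One factor \<beta> comes from the magnetic potential, the other from the energy
  density.\<close>

definition kern :: "real \<Rightarrow> real ^ 3 \<Rightarrow> real ^ 3 \<Rightarrow> real" where
  "kern \<beta> x y = 1 / 2 * (1 / norm (x - y)) + \<beta>\<^sup>2 * c5 * enn2real (k5e x y)"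

lemma c5_nonneg: "c5 \<ge> 0"
  by (simp add: c5_def)

lemma k5e_shift: "k5e (x + c *\<^sub>R e3) (y + c *\<^sub>R e3) = k5e x y"
  by (simp add: k5e_def)

lemma kern_cyl_kernel:
  assumes R: "R > 0"
  shows "\<exists>Cn Cf. cyl_kernel (kern \<beta>) R Cn Cf"
proof -
  \<comment> \<open>From \<open>(a + b)\<^sup>2 \<le> 2 * a\<^sup>2 + 2 * b\<^sup>2\<close>: the
    coefficient 1/2 of the Newtonian part is \<open>2 * (1/2)\<^sup>2\<close>, and the remaining
    factors are the bounds of \<open>k3_near\<close> and \<open>k5e_near\<close>.\<close>
  define E where "E = ennreal (1 / 2) * omI (2/3) (2 * R + 1) ^ 3 + ennreal (2 * (\<beta>\<^sup>2 * c5)\<^sup>2) *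
    ((ennreal ((2 * R) powr (1/4) * (R\<^sup>2) powr (3/4)) * C0)\<^sup>2 * (ennreal pi * omI (1/2) (R\<^sup>2) * omI (1/2) 1))"
  have "E < \<infinity>"
    unfolding E_def using C0_finite omI_finite[of "2/3" "2 * R + 1"] omI_finite[of "1/2" "R\<^sup>2"] omI_finite[of "1/2" 1] R
      ennreal_less_top[of "1 / 2"]
    by (simp add: ennreal_mult_less_top power_less_top_ennreal)
  then have E: "ennreal (enn2real E) = E" by simp
  define Cf where "Cf = 1 / 2 + \<beta>\<^sup>2 * c5 * (R ^ 4 * pi)"
  have "cyl_kernel (kern \<beta>) R (enn2real E) Cf"
  proof
    show "(\<lambda>p. kern \<beta> (fst p) (snd p)) \<in> borel_measurable (borel \<Otimes>\<^sub>M borel)"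
      unfolding kern_def by measurable
    show "kern \<beta> x y \<ge> 0" for x y using c5_nonneg by (simp add: kern_def)
    show "kern \<beta> x y = kern \<beta> y x" for x y by (simp add: kern_def norm_minus_commute k5e_sym[of x])
    show "kern \<beta> (x + c *\<^sub>R e3) (y + c *\<^sub>R e3) = kern \<beta> x y" for x y c by (simp add: kern_def k5e_shift)
    show "R > 0" "enn2real E \<ge> 0" by (auto simp: R)
    show "Cf \<ge> 0" using c5_nonneg R by (simp add: Cf_def)
    show "kern \<beta> x y \<le> Cf / \<bar>x $ 3 - y $ 3\<bar>" if "x \<in> cyl R" "y \<in> cyl R" "1 \<le> \<bar>x $ 3 - y $ 3\<bar>" for x y
    proof -
      let ?z = "\<bar>x $ 3 - y $ 3\<bar>"
      have "?z \<le> norm (x - y)" using component_le_norm_cart[of "x - y" 3] by simp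
      then have "1 / norm (x - y) \<le> 1 / ?z" using that by (intro divide_left_mono mult_pos_pos) auto
      moreover have "enn2real (k5e x y) \<le> R ^ 4 * pi / ?z"
        using k5e_far[of x R y] that R by (intro enn2real_leI) (auto simp: cyl_def)
      then have "\<beta>\<^sup>2 * c5 * enn2real (k5e x y) \<le> \<beta>\<^sup>2 * c5 * (R ^ 4 * pi / ?z)"
        using c5_nonneg by (intro mult_left_mono) auto
      ultimately show ?thesis unfolding kern_def Cf_def add_divide_distrib by simp
    qed
    show "(\<integral>\<^sup>+y. ennreal ((kern \<beta> x y)\<^sup>2) * indicator (cyl R \<inter> slab x) y \<partial>lborel) \<le> ennreal (enn2real E)"
      if x: "x \<in> cyl R" for x
    proof -
      have "(\<integral>\<^sup>+y. ennreal ((kern \<beta> x y)\<^sup>2) * indicator (cyl R \<inter> slab x) y \<partial>lborel)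
        \<le> (\<integral>\<^sup>+y. ennreal (1 / 2) * (ennreal ((1 / norm (x - y))\<^sup>2) * indicator (cyl R \<inter> slab x) y)
             + ennreal (2 * (\<beta>\<^sup>2 * c5)\<^sup>2) * ((k5e x y)\<^sup>2 * indicator (cyl R \<inter> slab x) y) \<partial>lborel)"
      proof (rule nn_integral_mono)
        fix y
        have "(a + b)\<^sup>2 \<le> 2 * a\<^sup>2 + 2 * b\<^sup>2" for a b :: real
          using zero_le_power2[of "a - b"] by (simp add: power2_eq_square algebra_simps)
        from this[of "1 / 2 * (1 / norm (x - y))" "\<beta>\<^sup>2 * c5 * enn2real (k5e x y)"]
        have "(kern \<beta> x y)\<^sup>2 \<le> 1 / 2 * (1 / norm (x - y))\<^sup>2 + 2 * (\<beta>\<^sup>2 * c5)\<^sup>2 * (enn2real (k5e x y))\<^sup>2"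
          unfolding kern_def power_mult_distrib by (simp add: power2_eq_square)
        then have "ennreal ((kern \<beta> x y)\<^sup>2) \<le> ennreal (1 / 2 * (1 / norm (x - y))\<^sup>2 + 2 * (\<beta>\<^sup>2 * c5)\<^sup>2 * (enn2real (k5e x y))\<^sup>2)"
          by (rule ennreal_leI)
        also have "\<dots> = ennreal (1 / 2) * ennreal ((1 / norm (x - y))\<^sup>2) + ennreal (2 * (\<beta>\<^sup>2 * c5)\<^sup>2) * (ennreal (enn2real (k5e x y)))\<^sup>2"
          by (simp only: ennreal_plus ennreal_mult' ennreal_power[symmetric] mult_nonneg_nonneg zero_le_power2 enn2real_nonneg)
        also have "\<dots> \<le> ennreal (1 / 2) * ennreal ((1 / norm (x - y))\<^sup>2) + ennreal (2 * (\<beta>\<^sup>2 * c5)\<^sup>2) * (k5e x y)\<^sup>2"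
        proof -
          have "ennreal (enn2real (k5e x y)) \<le> k5e x y" by (cases "k5e x y") auto
          then show ?thesis by (intro add_left_mono mult_left_mono power_mono) auto
        qed
        finally show "ennreal ((kern \<beta> x y)\<^sup>2) * indicator (cyl R \<inter> slab x) y
          \<le> ennreal (1 / 2) * (ennreal ((1 / norm (x - y))\<^sup>2) * indicator (cyl R \<inter> slab x) y)
             + ennreal (2 * (\<beta>\<^sup>2 * c5)\<^sup>2) * ((k5e x y)\<^sup>2 * indicator (cyl R \<inter> slab x) y)"
          by (cases "y \<in> cyl R \<inter> slab x") simp_all
      qed
      also have "\<dots> = ennreal (1 / 2) * (\<integral>\<^sup>+y. ennreal ((1 / norm (x - y))\<^sup>2) * indicator (cyl R \<inter> slab x) y \<partial>lborel)
          + ennreal (2 * (\<beta>\<^sup>2 * c5)\<^sup>2) * (\<integral>\<^sup>+y. (k5e x y)\<^sup>2 * indicator (cyl R \<inter> slab x) y \<partial>lborel)"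
        by (subst nn_integral_add, simp, simp, subst nn_integral_cmult, simp, subst nn_integral_cmult, simp, rule refl)
      also have "\<dots> \<le> E"
        unfolding E_def by (intro add_mono mult_left_mono k3_near[OF x] k5e_near[OF x]) auto
      finally show ?thesis unfolding E .
    qed
  qed
  then show ?thesis by blast
qed

text \<open>\<open>enn2real\<close> sends infinity to 0, so \<open>k5e\<close> may be replaced by
  its real value only where it is finite. Square integrability in the slab and
  \<open>k5e_far\<close> outside it give this almost everywhere.\<close>

lemma k5e_AE_finite:
  assumes R: "R > 0" and x: "x \<in> cyl R"
  shows "AE y in lborel. y \<in> cyl R \<longrightarrow> k5e x y < \<infinity>"
proof -
  let ?b = "(ennreal ((2 * R) powr (1/4) * (R\<^sup>2) powr (3/4)) * C0)\<^sup>2 * (ennreal pi * omI (1/2) (R\<^sup>2) * omI (1/2) 1)"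
  have "?b < \<infinity>"
    using C0_finite omI_finite[of "1/2" "R\<^sup>2"] omI_finite[of "1/2" 1]
    by (simp add: ennreal_mult_less_top power_less_top_ennreal)
  then have "(\<integral>\<^sup>+y. (k5e x y)\<^sup>2 * indicator (cyl R \<inter> slab x) y \<partial>lborel) < \<infinity>"
    using k5e_near[OF x] le_less_trans by blast
  then have "AE y in lborel. (k5e x y)\<^sup>2 * indicator (cyl R \<inter> slab x) y \<noteq> \<infinity>"
    by (intro nn_integral_PInf_AE) auto
  then show ?thesis
  proof eventually_elim
    case (elim y)
    show ?case
    proof
      assume y: "y \<in> cyl R"
      show "k5e x y < \<infinity>"
      proof (cases "y \<in> slab x")
        case True
        then have "(k5e x y)\<^sup>2 \<noteq> \<infinity>" using elim y by simp
        then show ?thesis by (auto simp: power2_eq_square ennreal_mult_eq_top_iff less_top)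
      next
        case False
        then have "k5e x y \<le> ennreal (R ^ 4 * pi / \<bar>x $ 3 - y $ 3\<bar>)"
          using x y by (intro k5e_far) (auto simp: cyl_def slab_def)
        then show ?thesis by (rule le_less_trans) simp
      qed
    qed
  qed
qed

text \<open>The Bochner integral of a nonnegative measurable function is \<open>enn2real\<close> of
  its extended integral, even if that is infinite. So \<open>newton5_lift\<close> applies with no
  integrability known beforehand.\<close>

lemma mag_potential_lift:
  assumes [measurable]: "g \<in> borel_measurable borel" and g: "\<And>p. g p \<ge> 0"
    and lift: "AE y in lborel. lift5 u y = g (d5 y, y $ 3)"
    and R: "R > 0" and x: "x \<in> cyl R" and g0: "\<And>r z. r \<ge> R \<Longrightarrow> g (r, z) = 0"
  shows "mag_potential \<beta> u x = 2 * \<beta> * c5 * (LINT y|lborel. enn2real (k5e x y) * g (cyl_r y, y $ 3))"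
proof -
  have [measurable]: "g \<in> borel_measurable (borel \<Otimes>\<^sub>M borel)" by (simp add: borel_prod)
  let ?h = "\<lambda>y. 1 / norm (hat5 x - y) ^ 3 * g (d5 y, y $ 3)"
  have "chi_e \<beta> u (hat5 x) = (LINT y|lborel. 2 * \<beta> * c5 * ?h y)"
    unfolding chi_e_def
  proof (rule lebesgue_lborel_transfer(2))
    show "AE y in lborel. G5 (hat5 x - y) * (- 4 * pi * \<beta>) * lift5 u y = 2 * \<beta> * c5 * ?h y"
      using lift by eventually_elim (simp add: G5_def c5_def)
  qed measurable
  also have "\<dots> = 2 * \<beta> * c5 * (LINT y|lborel. ?h y)" by (rule integral_mult_right_zero)
  also have "(LINT y|lborel. ?h y) = enn2real (\<integral>\<^sup>+y. ennreal (?h y) \<partial>lborel)"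
    using g by (intro integral_eq_nn_integral) auto
  finally have "mag_potential \<beta> u x = (cyl_r x)\<^sup>2 * (2 * \<beta> * c5 * enn2real (\<integral>\<^sup>+y. ennreal (?h y) \<partial>lborel))"
    by (simp add: mag_potential_def hat5_def)
  also have "\<dots> = 2 * \<beta> * c5 * enn2real (ennreal ((cyl_r x)\<^sup>2) * (\<integral>\<^sup>+y. ennreal (?h y) \<partial>lborel))"
    by (simp add: enn2real_mult)
  also have "ennreal ((cyl_r x)\<^sup>2) * (\<integral>\<^sup>+y. ennreal (?h y) \<partial>lborel) = (\<integral>\<^sup>+y. k5e x y * ennreal (g (cyl_r y, y $ 3)) \<partial>lborel)"
    by (rule newton5_lift) (use g in auto)
  also have "\<dots> = (\<integral>\<^sup>+y. ennreal (enn2real (k5e x y) * g (cyl_r y, y $ 3)) \<partial>lborel)"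
  proof (rule nn_integral_cong_AE, use k5e_AE_finite[OF R x] in eventually_elim)
    case (elim y)
    show ?case
    proof (cases "y \<in> cyl R")
      case True then show ?thesis using elim by (simp add: ennreal_mult')
    next
      case False
      then have "g (cyl_r y, y $ 3) = 0" by (intro g0) (simp add: cyl_def)
      then show ?thesis by simp
    qed
  qed
  also have "enn2real \<dots> = (LINT y|lborel. enn2real (k5e x y) * g (cyl_r y, y $ 3))"
    using g by (intro integral_eq_nn_integral[symmetric]) auto
  finally show ?thesis .
qed

text \<open>The potentials need to agree only on the cylinder, because outside it the density
  vanishes.\<close>

lemma energy_eq_en:
  assumes K: "cyl_kernel (kern \<beta>) R Cn Cf"
    and [measurable]: "g \<in> borel_measurable borel" and g: "\<And>p. g p \<ge> 0" and g0: "\<And>r z. r \<ge> R \<Longrightarrow> g (r, z) = 0"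
    and u: "AE x in lborel. u x = g (cyl_r x, x $ 3)" and lift: "AE y in lborel. lift5 u y = g (d5 y, y $ 3)"
    and adm: "adm R (\<lambda>x. g (cyl_r x, x $ 3))"
  shows "energy 2 \<beta> u = cyl_kernel.en (kern \<beta>) (\<lambda>x. g (cyl_r x, x $ 3))"
proof -
  interpret cyl_kernel "kern \<beta>" R Cn Cf by (rule K)
  let ?w = "\<lambda>x. g (cyl_r x, x $ 3)"
  note [measurable] = admD(1)[OF adm] pot_measurable[OF adm]
  have R: "R > 0" by (rule const_pos)
  have G: "grav_potential u x = (LINT y|lborel. 1 / norm (x - y) * ?w y)" for x
    unfolding grav_potential_def
    by (rule lebesgue_lborel_transfer(2)) (use u in \<open>auto elim!: eventually_mono\<close>)
  have potx: "pot ?w x = 1 / 2 * grav_potential u x + 1 / 2 * \<beta> * mag_potential \<beta> u x" if x: "x \<in> cyl R" for x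
  proof -
    have i: "integrable lborel (\<lambda>y. kern \<beta> x y * ?w y)" by (rule pot_bound(1)[OF adm x, of 1]) simp
    have "\<bar>1 / 2 * (1 / norm (x - y)) * ?w y\<bar> \<le> \<bar>kern \<beta> x y * ?w y\<bar>" for y
      using c5_nonneg g unfolding abs_mult by (intro mult_right_mono) (auto simp: kern_def)
    then have i1: "integrable lborel (\<lambda>y. 1 / 2 * (1 / norm (x - y)) * ?w y)"
      by (intro Bochner_Integration.integrable_bound[OF i]) auto
    have i2: "integrable lborel (\<lambda>y. \<beta>\<^sup>2 * c5 * enn2real (k5e x y) * ?w y)"
      using Bochner_Integration.integrable_diff[OF i i1] by (simp add: kern_def algebra_simps)
    have "pot ?w x = (LINT y|lborel. 1 / 2 * (1 / norm (x - y)) * ?w y + \<beta>\<^sup>2 * c5 * enn2real (k5e x y) * ?w y)"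
      unfolding pot_def kern_def by (simp add: distrib_right)
    also have "\<dots> = (LINT y|lborel. 1 / 2 * (1 / norm (x - y)) * ?w y) + (LINT y|lborel. \<beta>\<^sup>2 * c5 * enn2real (k5e x y) * ?w y)"
      by (rule Bochner_Integration.integral_add[OF i1 i2])
    also have "(LINT y|lborel. 1 / 2 * (1 / norm (x - y)) * ?w y) = 1 / 2 * grav_potential u x"
      unfolding G by (simp only: mult.assoc integral_mult_right_zero)
    also have "(LINT y|lborel. \<beta>\<^sup>2 * c5 * enn2real (k5e x y) * ?w y) = \<beta>\<^sup>2 * c5 * (LINT y|lborel. enn2real (k5e x y) * ?w y)"
      by (simp only: mult.assoc integral_mult_right_zero)
    also have "\<dots> = 1 / 2 * \<beta> * mag_potential \<beta> u x"
    proof -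
      have "mag_potential \<beta> u x = 2 * \<beta> * c5 * (LINT y|lborel. enn2real (k5e x y) * ?w y)"
        by (rule mag_potential_lift[OF _ g lift R x g0]) simp
      then show ?thesis by (simp add: power2_eq_square)
    qed
    finally show ?thesis .
  qed
  have "energy 2 \<beta> u = (LINT x|lborel. (?w x)\<^sup>2 - ?w x * pot ?w x)"
    unfolding energy_def
  proof (rule lebesgue_lborel_transfer(2))
    show "AE x in lborel. internal_energy 2 (u x) - 1 / 2 * u x * grav_potential u x - 1 / 2 * \<beta> * u x * mag_potential \<beta> u x
      = (?w x)\<^sup>2 - ?w x * pot ?w x"
      using u
    proof eventually_elim
      case (elim x)
      have sq: "?w x powr 2 = (?w x)\<^sup>2" using g[of "(cyl_r x, x $ 3)"] by (cases "?w x = 0") auto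
      show ?case
      proof (cases "x \<in> cyl R")
        case True
        then show ?thesis unfolding elim by (simp add: potx internal_energy_def pressure_def sq algebra_simps)
      next
        case False
        then have "?w x = 0" by (intro g0) (simp add: cyl_def)
        then show ?thesis unfolding elim by (simp add: internal_energy_def pressure_def)
      qed
    qed
  qed measurable
  also have "\<dots> = en ?w"
    unfolding en_def Q_def by (rule Bochner_Integration.integral_diff[OF admD(5)[OF adm] Q_integrable[OF adm adm]])
  finally show ?thesis .
qed

text \<open>One representative serves all \<beta>, so that energies for different values of \<beta>
  can be compared on the same function.\<close>

lemma W_star_rep:
  assumes u: "u \<in> W_star 2 M R" and R: "R > 0"
  shows "\<exists>w. adm R w \<and> axisymmetric w \<and> mass w = M \<and> (AE x in lborel. u x = w x) \<and>
     (\<forall>\<beta> Cn Cf. cyl_kernel (kern \<beta>) R Cn Cf \<longrightarrow> energy 2 \<beta> u = cyl_kernel.en (kern \<beta>) w)"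
proof -
  have ax: "axisymmetric u" and u0: "AE x in lborel. u x \<ge> 0" and ui: "integrable lebesgue u"
    and uL: "in_Lp 2 u" and um: "(LINT x|lebesgue. u x) = M" and uR: "\<And>x. cyl_r x \<ge> R \<Longrightarrow> u x = 0"
    using u by (auto simp: W_star_def W_def AE_completion_iff)
  obtain g where g [measurable]: "g \<in> borel_measurable borel"
    and gu: "AE x in lborel. u x = g (cyl_r x, x $ 3)" and gl: "AE y in lborel. lift5 u y = g (d5 y, y $ 3)"
    using axisymmetric_Borel_rep[OF ax borel_measurable_integrable[OF ui]] .
  have gm [measurable]: "g \<in> borel_measurable (borel \<Otimes>\<^sub>M borel)" by (simp add: borel_prod)
  have g5: "AE y in lborel. g (d5 y, y $ 3) \<ge> 0"
    by (rule AE_R5_of_R3) (simp, use gu u0 in eventually_elim, simp)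
  \<comment> \<open>Enforces sign and support at every point. Almost everywhere nothing changes,
    neither on \<open>real ^ 3\<close> nor, by \<open>g5\<close>, for the lift.\<close>
  define h where "h p = (if fst p < R then max 0 (g p) else 0)" for p :: "real \<times> real"
  have [measurable]: "h \<in> borel_measurable borel"
    unfolding h_def[abs_def] borel_prod[symmetric] by measurable
  have hm [measurable]: "h \<in> borel_measurable (borel \<Otimes>\<^sub>M borel)" by (simp add: borel_prod)
  have h: "h p \<ge> 0" "r \<ge> R \<Longrightarrow> h (r, z) = 0" for p r z by (auto simp: h_def)
  have hu: "AE x in lborel. u x = h (cyl_r x, x $ 3)"
    using gu u0 by eventually_elim (use uR in \<open>auto simp: h_def not_less\<close>)
  have hl: "AE y in lborel. lift5 u y = h (d5 y, y $ 3)"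
    using gl g5
  proof eventually_elim
    case (elim y)
    have "d5 y \<ge> 0" by (simp add: d5_def)
    then have "cyl_r (vector [d5 y, 0, y $ 3]) = d5 y" by (simp add: cyl_r_def)
    then show ?case using elim uR[of "vector [d5 y, 0, y $ 3]"] by (auto simp: h_def not_less lift5_d5)
  qed
  let ?w = "\<lambda>x. h (cyl_r x, x $ 3)"
  have hu2: "AE x in lborel. \<bar>u x\<bar> powr 2 = (?w x)\<^sup>2"
    using hu
  proof eventually_elim
    case (elim x)
    then show ?case using h(1)[of "(cyl_r x, x $ 3)"] by (cases "?w x = 0") auto
  qed
  have adm: "adm R ?w"
    unfolding adm_def
  proof (intro conjI allI impI)
    show "integrable lborel ?w" using lebesgue_lborel_transfer(3)[OF _ hu] ui by simp
    show "integrable lborel (\<lambda>x. (?w x)\<^sup>2)" using lebesgue_lborel_transfer(3)[OF _ hu2] uL by (simp add: in_Lp_def)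
    show "?w x = 0" if "x \<notin> cyl R" for x using that by (intro h(2)) (simp add: cyl_def)
  qed (use h in auto)
  moreover have "axisymmetric ?w" unfolding axisymmetric_def by (intro exI[of _ "\<lambda>r z. h (r, z)"]) simp
  moreover have "mass ?w = M" using lebesgue_lborel_transfer(2)[OF _ hu] um by simp
  moreover have "energy 2 \<beta> u = cyl_kernel.en (kern \<beta>) ?w" if "cyl_kernel (kern \<beta>) R Cn Cf" for \<beta> Cn Cf
    by (rule energy_eq_en[OF that _ h hu hl adm]) simp
  ultimately show ?thesis using hu by blast
qed

lemma adm_in_W_star:
  assumes w: "adm R w" and ax: "axisymmetric w"
  shows "w \<in> W_star 2 (mass w) R"
proof -
  note [measurable] = admD(1)[OF w]
  have "AE x in lborel. \<bar>w x\<bar> powr 2 = (w x)\<^sup>2" using admD(2)[OF w] by auto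
  from lebesgue_lborel_transfer(3)[OF _ this] have "in_Lp 2 w"
    using admD(5)[OF w] measurable_completion[of w lborel borel] by (simp add: in_Lp_def)
  moreover have "integrable lebesgue w" "(LINT x|lebesgue. w x) = mass w"
    using admD(4)[OF w] by (simp_all add: integrable_completion integral_completion)
  ultimately show ?thesis
    using ax admD(2,3)[OF w] by (auto simp: W_star_def W_def cyl_def)
qed

lemma (in cyl_kernel) en_cong_AE:
  assumes u: "adm R u" and w: "adm R w" and ae: "AE x in lborel. u x = w x"
  shows "en u = en w"
proof -
  note [measurable] = admD(1)[OF u] admD(1)[OF w] pot_measurable[OF w]
  have p: "pot u = pot w"
    unfolding pot_def by (intro ext integral_cong_AE) (use ae in \<open>auto elim!: eventually_mono\<close>)
  have "nrm2 u = nrm2 w" by (intro integral_cong_AE) (use ae in \<open>auto elim!: eventually_mono\<close>)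
  moreover have "Q u u = Q w w" unfolding Q_def p by (intro integral_cong_AE) (use ae in \<open>auto elim!: eventually_mono\<close>)
  ultimately show ?thesis by (simp add: en_def)
qed

text \<open>The representative found by \<open>W_star_rep\<close> may differ from \<open>w\<close>
  on a null set, which \<open>en\<close> does not notice.\<close>

lemma energy_adm:
  assumes K: "cyl_kernel (kern \<beta>) R Cn Cf" and w: "adm R w" and ax: "axisymmetric w"
  shows "energy 2 \<beta> w = cyl_kernel.en (kern \<beta>) w"
proof -
  interpret cyl_kernel "kern \<beta>" R Cn Cf by (rule K)
  obtain w' where w': "adm R w'" "AE x in lborel. w x = w' x" "energy 2 \<beta> w = en w'"
    using W_star_rep[OF adm_in_W_star[OF w ax] const_pos(1)] K by blast
  then show ?thesis using en_cong_AE[OF w w'(1,2)] by simp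
qed

lemma abs_powr_2: "\<bar>x :: real\<bar> powr 2 = x\<^sup>2"
  by (cases "x = 0") auto

lemma in_Lp_2I:
  assumes [measurable]: "g \<in> borel_measurable borel" and g: "integrable lborel (\<lambda>x. (g x)\<^sup>2)"
    and ae: "AE x in lborel. f x = g x"
  shows "in_Lp 2 f"
proof -
  have "AE x in lborel. \<bar>f x\<bar> powr 2 = (g x)\<^sup>2" using ae by eventually_elim (simp add: abs_powr_2)
  from lebesgue_lborel_transfer(3)[OF _ this] have "integrable lebesgue (\<lambda>x. \<bar>f x\<bar> powr 2)" using g by simp
  then show ?thesis using lebesgue_lborel_transfer(1)[OF _ ae] by (simp add: in_Lp_def)
qed

lemma in_Lp_2_Borel_rep:
  assumes "in_Lp 2 f"
  obtains g where "g \<in> borel_measurable borel" "integrable lborel (\<lambda>x. (g x)\<^sup>2)" "AE x in lborel. f x = g x"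
proof -
  obtain g where g: "g \<in> borel_measurable lborel" "AE x in lborel. f x = g x"
    using completion_ex_borel_measurable_real[of f lborel] assms by (auto simp: in_Lp_def)
  then have [measurable]: "g \<in> borel_measurable borel" by simp
  have "AE x in lborel. \<bar>f x\<bar> powr 2 = (g x)\<^sup>2" using g(2) by eventually_elim (simp add: abs_powr_2)
  from lebesgue_lborel_transfer(3)[OF _ this] have "integrable lborel (\<lambda>x. (g x)\<^sup>2)"
    using assms by (simp add: in_Lp_def)
  then show thesis using g by (intro that) auto
qed

lemma AE_translate:
  fixes P :: "real^3 \<Rightarrow> bool"
  assumes "AE x in lborel. P x"
  shows "AE x in lborel. P (x + c)"
proof -
  obtain N where N: "{x. \<not> P x} \<subseteq> N" "emeasure lborel N = 0" and [measurable]: "N \<in> sets borel"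
    using AE_E[OF assms] by auto
  have "AE x in lborel. x \<notin> N" using N(2) by (intro AE_not_in) (auto simp: null_sets_def)
  then have "AE x in distr lborel borel ((+) c). x \<notin> N" by (simp only: lborel_distr_plus)
  then have "AE x in lborel. c + x \<notin> N" by (subst (asm) AE_distr_iff) auto
  then show ?thesis by eventually_elim (use N(1) in \<open>auto simp: add.commute\<close>)
qed

text \<open>For a uniform ball of radius 2, distances are at most 4, so \<open>kern 0\<close> is at
  least 1/8 and the potential energy at least \<open>M\<^sup>2 / 8\<close>; the internal energy is
  \<open>M\<^sup>2 / V\<close> with volume \<open>V > 8\<close>. Both scale like
  \<open>M\<^sup>2\<close>, so one radius serves all masses.\<close>

lemma grav_ball_trial:
  assumes M: "M > 0"
  shows "\<exists>\<sigma>\<in>X 2 M. nonmag_energy 2 \<sigma> < 0"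
proof -
  define V where "V = measure lborel (ball (0::real^3) 2)"
  have V: "V = 4 / 3 * pi * 8" unfolding V_def by (simp add: content_ball unit_ball_vol_3)
  have V8: "V > 8" using pi_gt3 by (simp add: V)
  define \<sigma> where "\<sigma> x = M / V * indicator (ball (0::real^3) 2) x" for x
  have [measurable]: "ball (0::real^3) 2 \<in> sets borel" by simp
  have cyl3: "x \<in> cyl 3" if "norm x < 2" for x :: "real^3"
  proof -
    have "(cyl_r x)\<^sup>2 \<le> (norm x)\<^sup>2" by (simp add: norm3_sq)
    then have "cyl_r x \<le> norm x" by (rule power2_le_imp_le) simp
    then show ?thesis using that by (simp add: cyl_def)
  qed
  have ind: "integrable lborel (indicat_real (ball (0::real^3) 2))"
    using emeasure_bounded_finite[of "ball (0::real^3) 2"] by (intro integrable_real_indicator) auto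
  have sq: "(\<sigma> x)\<^sup>2 = (M / V)\<^sup>2 * indicator (ball 0 2) x" for x by (simp add: \<sigma>_def indicator_def)
  have adm: "adm 3 \<sigma>"
    unfolding adm_def
  proof (intro conjI allI impI)
    show "integrable lborel \<sigma>" unfolding \<sigma>_def[abs_def] by (rule integrable_mult_right) (rule ind)
    show "integrable lborel (\<lambda>x. (\<sigma> x)\<^sup>2)" unfolding sq by (rule integrable_mult_right) (rule ind)
    show "\<sigma> \<in> borel_measurable borel" unfolding \<sigma>_def[abs_def] by measurable
    show "0 \<le> \<sigma> x" for x using M V8 by (simp add: \<sigma>_def)
    show "\<sigma> x = 0" if "x \<notin> cyl 3" for x using that cyl3[of x] by (auto simp: \<sigma>_def indicator_def)
  qed
  have ms: "mass \<sigma> = M" using V8 by (simp add: \<sigma>_def V_def)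
  have n2: "nrm2 \<sigma> = M\<^sup>2 / V" unfolding sq using V8 by (simp add: V_def[symmetric] power2_eq_square)
  have ax: "axisymmetric \<sigma>"
    unfolding axisymmetric_def
  proof (intro exI allI)
    fix x :: "real^3"
    have "norm x = sqrt ((cyl_r x)\<^sup>2 + (x $ 3)\<^sup>2)" unfolding norm3_sq[symmetric] by simp
    then show "\<sigma> x = (\<lambda>r z. M / V * of_bool (sqrt (r\<^sup>2 + z\<^sup>2) < 2)) (cyl_r x) (x $ 3)" by (simp add: \<sigma>_def indicator_def)
  qed
  \<comment> \<open>\<open>kern 0\<close> is the purely gravitational kernel, and the ball lies in
    the cylinder of radius 3.\<close>
  obtain Cn Cf where K: "cyl_kernel (kern 0) 3 Cn Cf" using kern_cyl_kernel[of 3 0] by auto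
  interpret cyl_kernel "kern 0" 3 Cn Cf by (rule K)
  note [measurable] = admD(1)[OF adm] pot_measurable[OF adm]
  have e: "nonmag_energy 2 \<sigma> = en \<sigma>"
    using energy_adm[OF K adm ax] by (simp add: energy_def nonmag_energy_def)
  have gp: "grav_potential \<sigma> x = 2 * pot \<sigma> x" for x
  proof -
    have "grav_potential \<sigma> x = (LINT y|lborel. 2 * (kern 0 x y * \<sigma> y))"
      unfolding grav_potential_def
      by (rule lebesgue_lborel_transfer(2)) (auto simp: kern_def)
    then show ?thesis by (simp add: pot_def)
  qed
  have pl: "pot \<sigma> x \<ge> M / 8" if x: "norm x < 2" for x
  proof -
    have "M / 8 = (LINT y|lborel. 1 / 8 * \<sigma> y)" using ms by simp
    also have "\<dots> \<le> pot \<sigma> x"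
      unfolding pot_def
    proof (rule integral_mono_AE)
      show "integrable lborel (\<lambda>y. 1 / 8 * \<sigma> y)" using admD(4)[OF adm] by simp
      show "integrable lborel (\<lambda>y. kern 0 x y * \<sigma> y)" by (rule pot_bound(1)[OF adm cyl3[OF x], of 1]) simp
      have "AE y in lborel. y \<noteq> x" by (rule AE_lborel_singleton)
      then show "AE y in lborel. 1 / 8 * \<sigma> y \<le> kern 0 x y * \<sigma> y"
      proof eventually_elim
        case (elim y)
        show ?case
        proof (cases "norm y < 2")
          case True
          have "norm (x - y) \<le> 4" using norm_triangle_ineq4[of x y] x True by linarith
          moreover have "norm (x - y) > 0" using elim by simp
          ultimately have "1 / 4 \<le> 1 / norm (x - y)" by (intro divide_left_mono mult_pos_pos) auto
          then have "1 / 8 \<le> kern 0 x y" by (simp add: kern_def)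
          then show ?thesis using admD(2)[OF adm] by (intro mult_right_mono)
        qed (simp add: \<sigma>_def indicator_def)
      qed
    qed
    finally show ?thesis .
  qed
  have "M / 8 * M \<le> Q \<sigma> \<sigma>"
  proof -
    have "M / 8 * M = (LINT x|lborel. \<sigma> x * (M / 8))" using ms by (simp add: mult.commute)
    also have "\<dots> \<le> Q \<sigma> \<sigma>"
      unfolding Q_def
    proof (rule integral_mono[OF _ Q_integrable[OF adm adm]])
      show "integrable lborel (\<lambda>x. \<sigma> x * (M / 8))" using admD(4)[OF adm] by simp
      show "\<sigma> x * (M / 8) \<le> \<sigma> x * pot \<sigma> x" for x
      proof (cases "norm x < 2")
        case True
        then show ?thesis using pl[of x] admD(2)[OF adm, of x] by (intro mult_left_mono)
      qed (simp add: \<sigma>_def indicator_def)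
    qed
    finally show ?thesis .
  qed
  moreover have "M\<^sup>2 / V < M\<^sup>2 / 8" using M V8 by (intro divide_strict_left_mono mult_pos_pos) auto
  ultimately have neg: "nonmag_energy 2 \<sigma> < 0" unfolding e en_def n2 unfolding power2_eq_square by argo
  have "\<sigma> \<in> X 2 M"
  proof -
    have "integrable lborel (\<lambda>x. (\<sigma> x)\<^sup>2 + \<sigma> x * pot \<sigma> x)"
      using admD(5)[OF adm] Q_integrable[OF adm adm] by (rule Bochner_Integration.integrable_add)
    moreover have "AE x in lborel. internal_energy 2 (\<sigma> x) + 1 / 2 * \<sigma> x * grav_potential \<sigma> x = (\<sigma> x)\<^sup>2 + \<sigma> x * pot \<sigma> x"
      using admD(2)[OF adm] abs_powr_2 by (auto simp: gp internal_energy_def pressure_def)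
    ultimately have "integrable lebesgue (\<lambda>x. internal_energy 2 (\<sigma> x) + 1 / 2 * \<sigma> x * grav_potential \<sigma> x)"
      using lebesgue_lborel_transfer(3)[of "\<lambda>x. (\<sigma> x)\<^sup>2 + \<sigma> x * pot \<sigma> x"] by simp
    then show ?thesis
      using admD(2,4)[OF adm] ms by (auto simp: X_def integrable_completion integral_completion)
  qed
  then show ?thesis using neg by blast
qed

text \<open>The star does no worse than the ball. It is square integrable because the gravitational
  term in \<open>X\<close> is nonnegative, and its support lies in the cylinder because the norm
  dominates \<open>cyl_r\<close>.\<close>

lemma star_in_W_star:
  assumes M: "M > 0" and star: "star_radius 2 M RM" and R: "R \<ge> RM"
  shows "\<exists>\<rho>\<in>W_star 2 M R. nonmag_energy 2 \<rho> < 0"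
proof -
  obtain \<rho> where min: "minimizer_on (nonmag_energy 2) (X 2 M) \<rho>" and rad: "radial \<rho>"
    and out: "\<And>x. norm x \<ge> RM \<Longrightarrow> \<rho> x = 0"
    using star by (auto simp: star_radius_def)
  have neg: "nonmag_energy 2 \<rho> < 0"
    using min grav_ball_trial[OF M] by (auto simp: minimizer_on_def intro: le_less_trans)
  have \<rho>X: "\<rho> \<in> X 2 M" using min by (simp add: minimizer_on_def)
  then have nn: "AE x in lebesgue. \<rho> x \<ge> 0" and i: "integrable lebesgue \<rho>" and m: "(LINT x|lebesgue. \<rho> x) = M"
    and e: "integrable lebesgue (\<lambda>x. internal_energy 2 (\<rho> x) + 1 / 2 * \<rho> x * grav_potential \<rho> x)"
    by (auto simp: X_def)
  have [measurable]: "\<rho> \<in> borel_measurable lebesgue" using i by (rule borel_measurable_integrable)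
  have G: "grav_potential \<rho> x \<ge> 0" for x
    unfolding grav_potential_def by (rule integral_nonneg_AE) (use nn in eventually_elim, simp)
  have "integrable lebesgue (\<lambda>x. \<bar>\<rho> x\<bar> powr 2)"
  proof (rule Bochner_Integration.integrable_bound[OF e])
    show "(\<lambda>x. \<bar>\<rho> x\<bar> powr 2) \<in> borel_measurable lebesgue" by measurable
    show "AE x in lebesgue. norm (\<bar>\<rho> x\<bar> powr 2) \<le> norm (internal_energy 2 (\<rho> x) + 1 / 2 * \<rho> x * grav_potential \<rho> x)"
      using nn
    proof eventually_elim
      case (elim x)
      then have "0 \<le> 1 / 2 * \<rho> x * grav_potential \<rho> x" using G[of x] by simp
      then show ?case using elim by (simp add: internal_energy_def pressure_def)
    qed
  qed
  then have L: "in_Lp 2 \<rho>" by (simp add: in_Lp_def)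
  obtain f where f: "\<And>x. \<rho> x = f (norm x)" using rad by (auto simp: radial_def)
  have ax: "axisymmetric \<rho>"
    unfolding axisymmetric_def
  proof (intro exI allI)
    fix x :: "real^3"
    have "norm x = sqrt ((cyl_r x)\<^sup>2 + (x $ 3)\<^sup>2)" unfolding norm3_sq[symmetric] by simp
    then show "\<rho> x = (\<lambda>r z. f (sqrt (r\<^sup>2 + z\<^sup>2))) (cyl_r x) (x $ 3)" by (simp add: f)
  qed
  have "\<rho> x = 0" if "cyl_r x \<ge> R" for x
  proof (rule out)
    have "(cyl_r x)\<^sup>2 \<le> (norm x)\<^sup>2" by (simp add: norm3_sq)
    then have "cyl_r x \<le> norm x" by (rule power2_le_imp_le) simp
    then show "RM \<le> norm x" using that R by linarith
  qed
  then have "\<rho> \<in> W_star 2 M R" using ax nn i L m by (auto simp: W_star_def W_def)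
  with neg show ?thesis by blast
qed

text \<open>\<open>kern 0\<close> is pointwise at most \<open>kern \<beta>\<close>: the magnetic
  term only adds attraction.\<close>

lemma energy_le_nonmag:
  assumes \<rho>: "\<rho> \<in> W_star 2 M R" and R: "R > 0"
  shows "energy 2 \<beta> \<rho> \<le> nonmag_energy 2 \<rho>"
proof -
  obtain Cn Cf where K: "cyl_kernel (kern \<beta>) R Cn Cf" using kern_cyl_kernel[OF R] by blast
  obtain Cn0 Cf0 where K0: "cyl_kernel (kern 0) R Cn0 Cf0" using kern_cyl_kernel[OF R] by blast
  obtain w where w: "adm R w" and e: "energy 2 \<beta> \<rho> = cyl_kernel.en (kern \<beta>) w"
      "energy 2 0 \<rho> = cyl_kernel.en (kern 0) w"
    using W_star_rep[OF \<rho> R] K K0 by blast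
  interpret K: cyl_kernel "kern \<beta>" R Cn Cf by (rule K)
  interpret K0: cyl_kernel "kern 0" R Cn0 Cf0 by (rule K0)
  have "K0.pot w x \<le> K.pot w x" if "x \<in> cyl R" for x
    unfolding K.pot_def K0.pot_def
  proof (rule integral_mono[OF K0.pot_bound(1)[OF w that zero_less_one] K.pot_bound(1)[OF w that zero_less_one]])
    show "kern 0 x y * w y \<le> kern \<beta> x y * w y" for y
      using c5_nonneg admD(2)[OF w] by (intro mult_right_mono) (auto simp: kern_def)
  qed
  then have "K0.Q w w \<le> K.Q w w"
    unfolding K.Q_def K0.Q_def
    by (intro integral_mono[OF K0.Q_integrable[OF w w] K.Q_integrable[OF w w]])
       (metis admD(2,3)[OF w] mult_left_mono mult_zero_left order_refl)
  moreover have "energy 2 0 \<rho> = nonmag_energy 2 \<rho>" by (simp add: energy_def nonmag_energy_def)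
  ultimately show ?thesis using e by (simp add: K.en_def K0.en_def)
qed

lemma slab_in_ball:
  assumes "x \<in> cyl R" "\<bar>x $ 3 - a\<bar> \<le> L" "R > 0"
  shows "x \<in> ball (a *\<^sub>R e3) (R + L)"
proof -
  have L: "L \<ge> 0" using assms(2) by linarith
  have "(norm (x - a *\<^sub>R e3))\<^sup>2 = (cyl_r x)\<^sup>2 + (x $ 3 - a)\<^sup>2"
    unfolding norm3_sq by (simp add: cyl_r_def)
  also have "\<dots> \<le> (cyl_r x)\<^sup>2 + L\<^sup>2" using power_mono[OF assms(2), of 2] by simp
  also have "\<dots> < R\<^sup>2 + L\<^sup>2" using assms(1) by (intro add_strict_right_mono power_strict_mono) (auto simp: cyl_def)
  also have "\<dots> \<le> (R + L)\<^sup>2" using assms(3) L by (simp add: power2_sum)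
  finally have "norm (x - a *\<^sub>R e3) < R + L" using assms(3) L by (intro power2_less_imp_less[of _ "R + L"]) auto
  then show ?thesis by (simp add: dist_norm norm_minus_commute)
qed

text \<open>Tightness is obtained in slabs but stated with balls; a piece of the cylinder of
  half-height \<open>L\<close> fits into a ball of radius \<open>R + L\<close>.\<close>

lemma ball_mass_ge:
  assumes u: "adm R u" and L: "L \<ge> 0" and R: "R > 0"
  shows "(LINT x|lborel. u x * indicator (ball (a *\<^sub>R e3) (R + L)) x) \<ge> below u (a + L) - below u (a - L)"
proof -
  have "below u (a + L) - below u (a - L) = (LINT x|lborel. u x * indicator {x. a - L \<le> x $ 3 \<and> x $ 3 < a + L} x)"
    using below_diff[OF u, of "a - L" "a + L"] L by simp
  also have "\<dots> \<le> (LINT x|lborel. u x * indicator (ball (a *\<^sub>R e3) (R + L)) x)"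
  proof (rule integral_mono)
    show "integrable lborel (\<lambda>x. u x * indicator {x. a - L \<le> x $ 3 \<and> x $ 3 < a + L} x)"
      by (rule admD(4)[OF adm_restrict[OF u]]) simp
    show "integrable lborel (\<lambda>x. u x * indicator (ball (a *\<^sub>R e3) (R + L)) x)"
      by (rule admD(4)[OF adm_restrict[OF u]]) simp
    fix x
    show "u x * indicator {x. a - L \<le> x $ 3 \<and> x $ 3 < a + L} x \<le> u x * indicator (ball (a *\<^sub>R e3) (R + L)) x"
    proof (cases "x \<in> cyl R \<and> \<bar>x $ 3 - a\<bar> \<le> L")
      case True
      then have "x \<in> ball (a *\<^sub>R e3) (R + L)" using slab_in_ball R by blast
      then show ?thesis using admD(2)[OF u, of x] by (simp add: indicator_def)
    next
      case False
      then have eq0: "u x * indicator {x. a - L \<le> x $ 3 \<and> x $ 3 < a + L} x = 0"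
        using admD(3)[OF u, of x] by (auto simp: indicator_def)
      show ?thesis unfolding eq0 using admD(2)[OF u, of x] by simp
    qed
  qed
  finally show ?thesis .
qed

section \<open>Existence of minimizers\<close>

text \<open>Testing \<open>u i\<close> with \<open>v\<close> and with the rotated \<open>v\<close>
  gives the same numbers. In the limit the inner product of \<open>v\<close> with its rotation
  equals the squared norm of both, which forces them to coincide in L2.\<close>

lemma weak_limit_rot_invariant:
  assumes [measurable]: "v \<in> borel_measurable borel" and v2: "integrable lborel (\<lambda>x. (v x)\<^sup>2)"
    and um: "\<And>i. u i \<in> borel_measurable borel" and ax: "\<And>i. axisymmetric (u i)"
    and weak: "\<And>g. g \<in> borel_measurable borel \<Longrightarrow> integrable lborel (\<lambda>x. (g x)\<^sup>2) \<Longrightarrow>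
      (\<lambda>i. LINT x|lborel. u i x * g x) \<longlonglongrightarrow> (LINT x|lborel. v x * g x)"
    and w: "w \<noteq> 0"
  shows "AE x in lborel. v (rot w x) = v x"
proof -
  note [measurable] = um
  have rm [measurable]: "rot w \<in> borel \<rightarrow>\<^sub>M borel" by measurable
  have tr: "(LINT x|lborel. f (rot w x)) = (LINT x|lborel. f x)" if [measurable]: "f \<in> borel_measurable borel" for f :: "real^3 \<Rightarrow> real"
  proof -
    have "(LINT x|lborel. f x) = (LINT x|distr lborel borel (rot w). f x)" by (simp only: lborel_rot[OF w])
    also have "\<dots> = (LINT x|lborel. f (rot w x))" by (rule integral_distr) auto
    finally show ?thesis by simp
  qed
  have v2r: "integrable lborel (\<lambda>x. (v (rot w x))\<^sup>2)"
  proof -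
    have "integrable (distr lborel borel (rot w)) (\<lambda>x. (v x)\<^sup>2)" using v2 by (simp only: lborel_rot[OF w])
    then show ?thesis by (subst (asm) integrable_distr_eq) auto
  qed
  have ur: "u i (rot w x) = u i x" for i x
    using ax[of i] w by (auto simp: axisymmetric_def cyl_r_rot)
  have "(LINT x|lborel. u i x * v (rot w x)) = (LINT x|lborel. u i x * v x)" for i
    using tr[of "\<lambda>x. u i x * v x"] by (simp add: ur)
  moreover have "(\<lambda>i. LINT x|lborel. u i x * v (rot w x)) \<longlonglongrightarrow> (LINT x|lborel. v x * v (rot w x))"
    by (rule weak) (use v2r in auto)
  moreover have "(\<lambda>i. LINT x|lborel. u i x * v x) \<longlonglongrightarrow> (LINT x|lborel. v x * v x)"
    by (rule weak) (use v2 in auto)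
  ultimately have eq: "(LINT x|lborel. v x * v (rot w x)) = (LINT x|lborel. v x * v x)"
    using LIMSEQ_unique by auto
  have i1: "integrable lborel (\<lambda>x. v x * v (rot w x))" by (rule L2_product_bound(1)[OF _ _ v2 v2r]) auto
  have sq: "(v (rot w x) - v x)\<^sup>2 = (v (rot w x))\<^sup>2 + (v x)\<^sup>2 - 2 * (v x * v (rot w x))" for x
    by (simp add: power2_diff)
  have i2: "integrable lborel (\<lambda>x. (v (rot w x) - v x)\<^sup>2)"
    unfolding sq using v2 v2r i1 by simp
  have "(LINT x|lborel. (v (rot w x) - v x)\<^sup>2) = (LINT x|lborel. (v (rot w x))\<^sup>2 + (v x)\<^sup>2 - 2 * (v x * v (rot w x)))"
    unfolding sq ..
  also have "\<dots> = (LINT x|lborel. (v (rot w x))\<^sup>2) + (LINT x|lborel. (v x)\<^sup>2) - 2 * (LINT x|lborel. v x * v (rot w x))"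
    using v2 v2r i1 by simp
  also have "\<dots> = 0" using tr[of "\<lambda>x. (v x)\<^sup>2"] eq by (simp add: power2_eq_square)
  finally have "AE x in lborel. (v (rot w x) - v x)\<^sup>2 = 0"
    using integral_nonneg_eq_0_iff_AE[OF i2] by simp
  then show ?thesis by eventually_elim simp
qed

text \<open>Axisymmetry comes from \<open>rot_invariant_rep\<close>, the support from testing with
  \<open>v\<close> cut off to the outside of the cylinder. The modified function has both properties
  at every point.\<close>

lemma weak_limit_in_adm:
  assumes vm: "v \<in> borel_measurable borel" and v0: "\<And>x. 0 \<le> v x" and vi: "integrable lborel v"
    and v2: "integrable lborel (\<lambda>x. (v x)\<^sup>2)"
    and u: "\<And>i. adm R (u i)" and ax: "\<And>i. axisymmetric (u i)"
    and weak: "\<And>g. g \<in> borel_measurable borel \<Longrightarrow> integrable lborel (\<lambda>x. (g x)\<^sup>2) \<Longrightarrow>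
      (\<lambda>i. LINT x|lborel. u i x * g x) \<longlonglongrightarrow> (LINT x|lborel. v x * g x)"
  shows "\<exists>v'. adm R v' \<and> axisymmetric v' \<and> (AE x in lborel. v x = v' x)"
proof -
  note [measurable] = vm admD(1)[OF u]
  have "AE x in lborel. v x = disc_mean v (cyl_r x, x $ 3)"
    by (rule rot_invariant_rep[OF vm]) (rule weak_limit_rot_invariant[OF vm v2 admD(1)[OF u] ax weak])
  moreover have "AE x in lborel. x \<notin> cyl R \<longrightarrow> v x = 0"
  proof -
    let ?g = "\<lambda>x. v x * indicator (- cyl R) x"
    have g2: "integrable lborel (\<lambda>x. (?g x)\<^sup>2)"
      by (rule Bochner_Integration.integrable_bound[OF v2]) (auto simp: indicator_def)
    have "(\<lambda>i. LINT x|lborel. u i x * ?g x) \<longlonglongrightarrow> (LINT x|lborel. v x * ?g x)"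
      by (rule weak) (use g2 in auto)
    moreover have "u i x * ?g x = 0" for i x using admD(3)[OF u, of x i] by (auto simp: indicator_def)
    ultimately have "(LINT x|lborel. v x * ?g x) = 0" using LIMSEQ_unique[of "\<lambda>i. 0::real"] by simp
    moreover have "v x * ?g x = (?g x)\<^sup>2" for x by (cases "x \<in> cyl R") (auto simp: power2_eq_square)
    ultimately have "AE x in lborel. (?g x)\<^sup>2 = 0"
      using integral_nonneg_eq_0_iff_AE[OF g2] by simp
    then show ?thesis by eventually_elim (auto simp: indicator_def)
  qed
  ultimately have ae: "AE x in lborel. v x = (if cyl_r x < R then max 0 (disc_mean v (cyl_r x, x $ 3)) else 0)" (is "AE x in lborel. v x = ?v x")
  proof eventually_elim
    case (elim x)
    then show ?case using v0[of x] by (auto simp: cyl_def)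
  qed
  have [measurable]: "disc_mean v \<in> borel_measurable (borel \<Otimes>\<^sub>M borel)"
    using disc_mean_measurable[OF vm] by (simp add: borel_prod)
  have [measurable]: "?v \<in> borel_measurable borel" by measurable
  have "integrable lborel ?v" using integrable_cong_AE[OF _ _ ae] vi by simp
  moreover have "AE x in lborel. (v x)\<^sup>2 = (?v x)\<^sup>2" using ae by eventually_elim simp
  then have "integrable lborel (\<lambda>x. (?v x)\<^sup>2)" using integrable_cong_AE[of "\<lambda>x. (v x)\<^sup>2" lborel "\<lambda>x. (?v x)\<^sup>2"] v2 by simp
  ultimately have "adm R ?v" by (auto simp: adm_def cyl_def)
  moreover have "axisymmetric ?v"
    unfolding axisymmetric_def by (intro exI[of _ "\<lambda>r z. if r < R then max 0 (disc_mean v (r, z)) else 0"]) simp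
  ultimately show ?thesis using ae by blast
qed

lemma integral_AE_eq_mult:
  assumes [measurable]: "f \<in> borel_measurable borel" "g \<in> borel_measurable borel"
    and f: "AE x in lborel. f' x = f x" and g: "AE x in lborel. g' x = g x"
  shows "(LINT x|lebesgue. f' x * g' x) = (LINT x|(lborel :: (real^3) measure). f x * (g x :: real))"
  by (rule lebesgue_lborel_transfer(2)) (simp, use f g in eventually_elim, simp)

lemma set_integral_rep:
  assumes [measurable]: "w \<in> borel_measurable borel" "A \<in> sets borel" and u: "AE x in lborel. u x = w x"
  shows "(LINT x:A|lebesgue. u x) = (LINT x|(lborel :: (real^3) measure). (w x :: real) * indicator A x)"
  unfolding set_lebesgue_integral_def
  by (rule lebesgue_lborel_transfer(2)) (simp, use u in eventually_elim, simp)

lemma ereal_inf_on: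
  assumes b: "\<And>\<rho>. \<rho> \<in> S \<Longrightarrow> c \<le> E \<rho>" and \<rho>: "\<rho> \<in> S" "E \<rho> < 0"
  obtains I where "inf_on E S = ereal I" "I < 0" "\<And>\<sigma>. \<sigma> \<in> S \<Longrightarrow> I \<le> E \<sigma>"
proof -
  have lo: "ereal c \<le> inf_on E S" unfolding inf_on_def using b by (intro INF_greatest) simp
  have up: "inf_on E S \<le> ereal (E \<sigma>)" if "\<sigma> \<in> S" for \<sigma> unfolding inf_on_def using that by (rule INF_lower)
  obtain I where I: "inf_on E S = ereal I"
    using lo up[OF \<rho>(1)] by (cases "inf_on E S") auto
  show thesis
  proof (rule that[OF I])
    show "I \<le> E \<sigma>" if "\<sigma> \<in> S" for \<sigma> using up[OF that] I by simp
    then show "I < 0" using \<rho> by (meson le_less_trans)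
  qed
qed

lemma energy_lower:
  assumes K: "cyl_kernel (kern \<beta>) R Cn Cf" and \<rho>: "\<rho> \<in> W_star 2 M R"
  shows "energy 2 \<beta> \<rho> \<ge> 1 / 2 * (LINT x|lebesgue. (\<rho> x)\<^sup>2) - (Cn / 2 * M\<^sup>2 + Cf * M\<^sup>2)"
proof -
  interpret cyl_kernel "kern \<beta>" R Cn Cf by (rule K)
  obtain w where w: "adm R w" "mass w = M" and ae: "AE x in lborel. \<rho> x = w x" and e: "energy 2 \<beta> \<rho> = en w"
    using W_star_rep[OF \<rho> const_pos(1)] K by blast
  note [measurable] = admD(1)[OF w(1)]
  have "(LINT x|lebesgue. (\<rho> x)\<^sup>2) = nrm2 w"
    by (rule lebesgue_lborel_transfer(2)) (simp, use ae in eventually_elim, simp)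
  then show ?thesis using en_lower[OF w(1)] w(2) e by simp
qed

context en_bounded begin

text \<open>The shifted densities are tight and, by coercivity, bounded in L2, so
  \<open>weak_limit\<close> applies to them. The shifts returned are those along the
  subsequence.\<close>

lemma minimizing_subseq:
  assumes w: "\<And>i. adm R (w i)" and ax: "\<And>i. axisymmetric (w i)" and M: "\<And>i. mass (w i) = M"
    and lim: "(\<lambda>i. en (w i)) \<longlonglongrightarrow> I"
  shows "\<exists>a s v. strict_mono (s :: nat \<Rightarrow> nat) \<and> adm R v \<and> axisymmetric v \<and> mass v = M \<and>
    (\<forall>\<epsilon>>0. \<exists>L>0. \<forall>i. M - \<epsilon> \<le> (LINT x|lborel. w (s i) x * indicator (ball (a i *\<^sub>R e3) L) x)) \<and>
    (\<forall>g. g \<in> borel_measurable borel \<longrightarrow> integrable lborel (\<lambda>x. (g x)\<^sup>2) \<longrightarrow>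
      (\<lambda>i. LINT x|lborel. w (s i) (x + a i *\<^sub>R e3) * g x) \<longlonglongrightarrow> (LINT x|lborel. v x * g x))"
proof -
  obtain a where a: "\<And>\<epsilon>. \<epsilon> > 0 \<Longrightarrow> eventually (\<lambda>N. \<forall>i. below (w i) (a i - real N) \<le> \<epsilon> \<and> M - below (w i) (a i + real N) \<le> \<epsilon>) sequentially"
    using tight_sequence[OF w ax M lim] by blast
  define ws where "ws i x = w i (x + a i *\<^sub>R e3)" for i x
  have aw: "adm R (ws i)" for i unfolding ws_def[abs_def] by (rule adm_shift[OF w])
  have axw: "axisymmetric (ws i)" for i unfolding ws_def[abs_def] by (rule axisymmetric_shift[OF ax])
  note [measurable] = admD(1)[OF w] admD(1)[OF aw]
  have mw: "mass (ws i) = M" for i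
    unfolding ws_def using integral_translate(1)[of "w i"] M by simp
  have ew: "en (ws i) = en (w i)" for i unfolding ws_def[abs_def] by (rule en_shift[OF w])
  have "Bseq (\<lambda>i. en (w i))" using lim by (intro convergent_imp_Bseq convergentI)
  then obtain E where E: "\<And>i. norm (en (w i)) \<le> E" by (auto simp: Bseq_def)
  define B where "B = 2 * (E + (Cn / 2 * M\<^sup>2 + Cf * M\<^sup>2))"
  have B: "nrm2 (ws i) \<le> B" for i
    using en_lower[OF aw, of i] E[of i] mw[of i] ew[of i] by (simp add: B_def)
  interpret tight_L2 ws B M
  proof
    fix \<epsilon> :: real assume e: "\<epsilon> > 0"
    obtain N where N: "\<And>i. below (w i) (a i - real N) \<le> \<epsilon> / 2 \<and> M - below (w i) (a i + real N) \<le> \<epsilon> / 2"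
      using a[of "\<epsilon> / 2"] e by (auto simp: eventually_sequentially)
    let ?S = "cyl R \<inter> {x. \<bar>x $ 3 - 0\<bar> \<le> real N}"
    have "(LINT x|lborel. ws i x * indicator (- ?S) x) \<le> \<epsilon>" for i
    proof -
      have c: "integrable lborel (\<lambda>x. ws i x * indicator A x)" if "A \<in> sets borel" for A
        by (rule admD(4)[OF adm_restrict[OF aw that]])
      have "(LINT x|lborel. ws i x * indicator (- ?S) x)
        \<le> (LINT x|lborel. ws i x * indicator {x. x $ 3 < 0 - real N} x + ws i x * indicator {x. 0 + real N \<le> x $ 3} x)"
      proof (rule integral_mono)
        show "ws i x * indicator (- ?S) x \<le> ws i x * indicator {x. x $ 3 < 0 - real N} x + ws i x * indicator {x. 0 + real N \<le> x $ 3} x" for x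
          using admD(2)[OF aw, of i x] admD(3)[OF aw, of x i] by (auto simp: indicator_def)
      qed (auto intro!: c Bochner_Integration.integrable_add)
      also have "\<dots> = below (ws i) (0 - real N) + (LINT x|lborel. ws i x * indicator {x. 0 + real N \<le> x $ 3} x)"
        unfolding below_def by (rule Bochner_Integration.integral_add) (auto intro!: c)
      also have "(LINT x|lborel. ws i x * indicator {x. 0 + real N \<le> x $ 3} x) = M - below (ws i) (0 + real N)"
        using above_eq[OF aw] mw by simp
      finally have f: "(LINT x|lborel. ws i x * indicator (- ?S) x)
        \<le> below (ws i) (0 - real N) + (M - below (ws i) (0 + real N))" .
      have bs: "below (ws i) b = below (w i) (b + a i)" for b
        unfolding ws_def[abs_def] by (rule below_shift[OF w])
      have "0 - real N + a i = a i - real N" "0 + real N + a i = a i + real N" by auto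
      then show ?thesis using f N[of i] unfolding bs by argo
    qed
    then show "\<exists>S. S \<in> sets borel \<and> emeasure lborel S < \<infinity> \<and> (\<forall>i. (LINT x|lborel. ws i x * indicator (- S) x) \<le> \<epsilon>)"
      using cyl_segment_finite[of R 0 "real N"] by (intro exI[of _ ?S]) auto
  qed (use admD[OF aw] mw B in auto)
  obtain s v where s: "strict_mono s" and v: "v \<in> borel_measurable borel" "\<And>x. 0 \<le> v x" "integrable lborel v"
    "integrable lborel (\<lambda>x. (v x)\<^sup>2)" "(LINT x|lborel. v x) = M"
    and weak: "\<And>g. g \<in> borel_measurable borel \<Longrightarrow> integrable lborel (\<lambda>x. (g x)\<^sup>2) \<Longrightarrow>
      (\<lambda>i. LINT x|lborel. ws (s i) x * g x) \<longlonglongrightarrow> (LINT x|lborel. v x * g x)"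
    using weak_limit by blast
  obtain v' where v': "adm R v'" "axisymmetric v'" and ae: "AE x in lborel. v x = v' x"
    using weak_limit_in_adm[where u = "\<lambda>i. ws (s i)" and R = R, OF v(1-4) aw axw weak] by blast
  note [measurable] = v(1) admD(1)[OF v'(1)]
  have "mass v' = M" using integral_cong_AE[of v lborel v'] ae v(5) by simp
  moreover have "\<exists>L>0. \<forall>i. M - \<epsilon> \<le> (LINT x|lborel. w (s i) x * indicator (ball (a (s i) *\<^sub>R e3) L) x)" if e: "\<epsilon> > 0" for \<epsilon>
  proof -
    obtain N where N: "\<And>i. below (w i) (a i - real N) \<le> \<epsilon> / 2 \<and> M - below (w i) (a i + real N) \<le> \<epsilon> / 2"
      using a[of "\<epsilon> / 2"] e by (auto simp: eventually_sequentially)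
    have "M - \<epsilon> \<le> (LINT x|lborel. w (s i) x * indicator (ball (a (s i) *\<^sub>R e3) (R + real N)) x)" for i
      using N[of "s i"] ball_mass_ge[OF w[of "s i"], of "real N" "a (s i)"] const_pos by simp
    then show ?thesis using const_pos by (intro exI[of _ "R + real N"]) auto
  qed
  moreover have "(\<lambda>i. LINT x|lborel. w (s i) (x + a (s i) *\<^sub>R e3) * g x) \<longlonglongrightarrow> (LINT x|lborel. v' x * g x)"
    if [measurable]: "g \<in> borel_measurable borel" and "integrable lborel (\<lambda>x. (g x)\<^sup>2)" for g
  proof -
    have "(LINT x|lborel. v x * g x) = (LINT x|lborel. v' x * g x)"
      by (rule integral_cong_AE) (simp, simp, use ae in eventually_elim, simp)
    then show ?thesis using weak[OF that] by (simp add: ws_def)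
  qed
  ultimately show ?thesis using s v' by (intro exI[of _ "a \<circ> s"] exI[of _ s] exI[of _ v']) auto
qed

text \<open>Minimality is claimed for every limit with the stated properties, not just for the
  constructed one; hence shifts and limit are arbitrary here, and tightness is taken in its ball
  form.\<close>

lemma limit_minimizes:
  assumes w: "\<And>i. adm R (w i)" and M: "\<And>i. mass (w i) = M" and v: "adm R v"
    and lim: "(\<lambda>i. en (w i)) \<longlonglongrightarrow> I"
    and tight: "\<And>\<epsilon>. \<epsilon> > 0 \<Longrightarrow> \<exists>L>0. \<forall>i. M - \<epsilon> \<le> (LINT x|lborel. w i x * indicator (ball (a i *\<^sub>R e3) L) x)"
    and weak: "\<And>g. g \<in> borel_measurable borel \<Longrightarrow> integrable lborel (\<lambda>x. (g x)\<^sup>2) \<Longrightarrow>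
      (\<lambda>i. LINT x|lborel. w i (x + a i *\<^sub>R e3) * g x) \<longlonglongrightarrow> (LINT x|lborel. v x * g x)"
  shows "en v \<le> I"
proof -
  define ws where "ws i x = w i (x + a i *\<^sub>R e3)" for i x
  have aw: "adm R (ws i)" for i unfolding ws_def[abs_def] by (rule adm_shift[OF w])
  note [measurable] = admD(1)[OF w] admD(1)[OF aw]
  have mw: "mass (ws i) = M" for i
    unfolding ws_def using integral_translate(1)[of "w i"] M by simp
  have ew: "en (ws i) = en (w i)" for i unfolding ws_def[abs_def] by (rule en_shift[OF w])
  have "Bseq (\<lambda>i. en (w i))" using lim by (intro convergent_imp_Bseq convergentI)
  then obtain E where E: "\<And>i. norm (en (w i)) \<le> E" by (auto simp: Bseq_def)
  have B: "nrm2 (ws i) \<le> 2 * (E + (Cn / 2 * M\<^sup>2 + Cf * M\<^sup>2))" for i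
    using en_lower[OF aw, of i] E[of i] mw[of i] ew[of i] by simp
  show ?thesis
  proof (rule en_weak_lsc[OF aw v _ B])
    show "mass (ws i) \<le> M" for i using mw by simp
    show "(\<lambda>i. en (ws i)) \<longlonglongrightarrow> I" using lim by (simp add: ew)
    show "(\<lambda>i. LINT x|lborel. ws i x * g x) \<longlonglongrightarrow> (LINT x|lborel. v x * g x)"
      if "g \<in> borel_measurable borel" "integrable lborel (\<lambda>x. (g x)\<^sup>2)" for g
      using weak[OF that] by (simp add: ws_def)
    fix \<epsilon> :: real assume e: "\<epsilon> > 0"
    obtain L where L: "L > 0" "\<And>i. M - \<epsilon> \<le> (LINT x|lborel. w i x * indicator (ball (a i *\<^sub>R e3) L) x)"
      using tight[OF e] by auto
    have "(LINT x|lborel. ws i x * indicator (- {x. \<bar>x $ 3 - 0\<bar> \<le> L}) x) \<le> \<epsilon>" for i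
    proof -
      have [measurable]: "ball (a i *\<^sub>R e3) L \<in> sets borel" by simp
      let ?b = "\<lambda>x. w i x * indicator (ball (a i *\<^sub>R e3) L) x"
      have ib: "integrable lborel ?b" by (rule admD(4)[OF adm_restrict[OF w]]) simp
      have ibs: "integrable lborel (\<lambda>x. ?b (x + a i *\<^sub>R e3))" using integral_translate(2)[of ?b "a i *\<^sub>R e3"] ib by simp
      have "(LINT x|lborel. ws i x * indicator (- {x. \<bar>x $ 3 - 0\<bar> \<le> L}) x) \<le> (LINT x|lborel. ws i x - ?b (x + a i *\<^sub>R e3))"
      proof (rule integral_mono)
        show "integrable lborel (\<lambda>x. ws i x * indicator (- {x. \<bar>x $ 3 - 0\<bar> \<le> L}) x)"
          by (rule admD(4)[OF adm_restrict[OF aw]]) simp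
        show "integrable lborel (\<lambda>x. ws i x - ?b (x + a i *\<^sub>R e3))" using admD(4)[OF aw] ibs by simp
        fix x :: "real^3"
        \<comment> \<open>A point of the centred ball has height at most \<open>L\<close>, so what
          lies beyond \<open>L\<close> is part of the mass missing from the ball.\<close>
        have "\<bar>x $ 3\<bar> \<le> norm x" by (rule component_le_norm_cart)
        then show "ws i x * indicator (- {x. \<bar>x $ 3 - 0\<bar> \<le> L}) x \<le> ws i x - ?b (x + a i *\<^sub>R e3)"
          using admD(2)[OF aw, of i x] by (auto simp: indicator_def ws_def dist_norm)
      qed
      also have "\<dots> = mass (ws i) - (LINT x|lborel. ?b (x + a i *\<^sub>R e3))"
        using admD(4)[OF aw] ibs by simp
      also have "(LINT x|lborel. ?b (x + a i *\<^sub>R e3)) = (LINT x|lborel. ?b x)" by (rule integral_translate(1)) simp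
      finally show ?thesis using L(2)[of i] mw by simp
    qed
    then show "\<exists>L. \<forall>i. (LINT x|lborel. ws i x * indicator (- {x. \<bar>x $ 3 - 0\<bar> \<le> L}) x) \<le> \<epsilon>" by blast
  qed
qed

end

theorem theoremA1:
  fixes M R\<^sub>M \<RR> :: real
  assumes "M > 0"
    and "star_radius 2 M R\<^sub>M"
    and "\<RR> \<ge> R\<^sub>M"
  shows "\<exists>\<beta>\<^sub>0>0. \<forall>\<beta>. \<bar>\<beta>\<bar> < \<beta>\<^sub>0 \<longrightarrow>
    (inf_on (energy 2 \<beta>) (W_star 2 M \<RR>) < 0 \<and>
     (\<exists>C\<^sub>1>0. \<exists>C\<^sub>2>0. \<forall>\<rho>\<in>W_star 2 M \<RR>.
        energy 2 \<beta> \<rho> \<ge> C\<^sub>1 * (LINT x|lebesgue. (\<rho> x)\<^sup>2) - C\<^sub>2)) \<and>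
    (\<forall>u. minimizing_sequence (energy 2 \<beta>) (W_star 2 M \<RR>) u \<longrightarrow>
       (\<exists>a s. strict_mono s \<and>
          (\<exists>v\<in>W_star 2 M \<RR>. tight_weak_limit M (u \<circ> s) a v))) \<and>
    (\<forall>u a s v. minimizing_sequence (energy 2 \<beta>) (W_star 2 M \<RR>) u \<and> strict_mono s \<and>
       v \<in> W_star 2 M \<RR> \<and> tight_weak_limit M (u \<circ> s) a v \<longrightarrow>
       minimizer_on (energy 2 \<beta>) (W_star 2 M \<RR>) v)"
proof (rule exI[of _ 1], rule conjI[OF zero_less_one], intro allI impI)
  fix \<beta> :: real
  have R: "\<RR> > 0" using assms(2,3) by (simp add: star_radius_def)
  obtain Cn Cf where K: "cyl_kernel (kern \<beta>) \<RR> Cn Cf" using kern_cyl_kernel[OF R] by blast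
  interpret K: cyl_kernel "kern \<beta>" \<RR> Cn Cf by (rule K)
  let ?S = "W_star 2 M \<RR>" and ?E = "energy 2 \<beta>"
  \<comment> \<open>The summand 1 makes the constant strictly positive.\<close>
  define C where "C = Cn / 2 * M\<^sup>2 + Cf * M\<^sup>2 + 1"
  have C: "C > 0" using K.const_pos by (simp add: C_def add_nonneg_pos)
  have lower: "?E \<rho> \<ge> 1 / 2 * (LINT x|lebesgue. (\<rho> x)\<^sup>2) - C" if "\<rho> \<in> ?S" for \<rho>
    using energy_lower[OF K that] by (simp add: C_def)
  have lower': "- C \<le> ?E \<rho>" if "\<rho> \<in> ?S" for \<rho>
  proof -
    have "0 \<le> (LINT x|lebesgue. (\<rho> x)\<^sup>2)" by (rule Bochner_Integration.integral_nonneg) simp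
    then show ?thesis using lower[OF that] by linarith
  qed
  obtain \<rho>0 where \<rho>0: "\<rho>0 \<in> ?S" "nonmag_energy 2 \<rho>0 < 0" using star_in_W_star[OF assms] by blast
  have E0: "?E \<rho>0 < 0" using energy_le_nonmag[OF \<rho>0(1) R, of \<beta>] \<rho>0(2) by linarith
  obtain I where I: "inf_on ?E ?S = ereal I" "I < 0" and I_min: "\<And>\<sigma>. \<sigma> \<in> ?S \<Longrightarrow> I \<le> ?E \<sigma>"
    using ereal_inf_on[of ?S "- C" ?E, OF lower' \<rho>0(1) E0] by blast
  \<comment> \<open>An admissible axisymmetric Borel density of mass \<open>M\<close> itself belongs
    to \<open>W_star\<close>, so the infimum bounds its energy.\<close>
  interpret en_bounded "kern \<beta>" \<RR> Cn Cf M I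
  proof
    show "M > 0" "I < 0" by (fact assms(1) I(2))+
    show "I \<le> K.en u" if "adm \<RR> u" "axisymmetric u" "mass u = M" for u
      using I_min[OF adm_in_W_star[OF that(1,2), unfolded that(3)]] energy_adm[OF K that(1,2)] by simp
  qed
  have rep: "\<exists>w. adm \<RR> w \<and> axisymmetric w \<and> mass w = M \<and> (AE x in lborel. \<rho> x = w x) \<and> ?E \<rho> = K.en w"
    if "\<rho> \<in> ?S" for \<rho>
    using W_star_rep[OF that R] K by blast
  have part1: "inf_on ?E ?S < 0" "\<exists>C\<^sub>1>0. \<exists>C\<^sub>2>0. \<forall>\<rho>\<in>?S. ?E \<rho> \<ge> C\<^sub>1 * (LINT x|lebesgue. (\<rho> x)\<^sup>2) - C\<^sub>2"
  proof -
    show "inf_on ?E ?S < 0" using I by simp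
    show "\<exists>C\<^sub>1>0. \<exists>C\<^sub>2>0. \<forall>\<rho>\<in>?S. ?E \<rho> \<ge> C\<^sub>1 * (LINT x|lebesgue. (\<rho> x)\<^sup>2) - C\<^sub>2"
      by (rule exI[of _ "1 / 2"], rule conjI, simp, rule exI[of _ C]) (use C lower in auto)
  qed
  have part2: "\<exists>a s. strict_mono s \<and> (\<exists>v\<in>?S. tight_weak_limit M (u \<circ> s) a v)"
    if u: "minimizing_sequence ?E ?S u" for u
  proof -
    have uS: "\<And>i. u i \<in> ?S" and ul: "(\<lambda>i. ?E (u i)) \<longlonglongrightarrow> I"
      using u I(1) by (auto simp: minimizing_sequence_def)
    obtain w where w: "\<And>i. adm \<RR> (w i)" "\<And>i. axisymmetric (w i)" "\<And>i. mass (w i) = M"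
      and ae: "\<And>i. AE x in lborel. u i x = w i x" and e: "\<And>i. ?E (u i) = K.en (w i)"
      using rep[OF uS] by metis
    obtain a s v where s: "strict_mono s" and v: "adm \<RR> v" "axisymmetric v" "mass v = M"
      and t: "\<And>\<epsilon>. \<epsilon> > 0 \<Longrightarrow> \<exists>L>0. \<forall>i. M - \<epsilon> \<le> (LINT x|lborel. w (s i) x * indicator (ball (a i *\<^sub>R e3) L) x)"
      and weak: "\<And>g. g \<in> borel_measurable borel \<Longrightarrow> integrable lborel (\<lambda>x. (g x)\<^sup>2) \<Longrightarrow>
        (\<lambda>i. LINT x|lborel. w (s i) (x + a i *\<^sub>R e3) * g x) \<longlonglongrightarrow> (LINT x|lborel. v x * g x)"
      using minimizing_subseq[OF w ul[unfolded e]] by blast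
    note [measurable] = admD(1)[OF w(1)] admD(1)[OF v(1)]
    have aes: "AE x in lborel. (u \<circ> s) i (x + a i *\<^sub>R e3) = w (s i) (x + a i *\<^sub>R e3)" for i
      using AE_translate[OF ae[of "s i"]] by simp
    have "tight_weak_limit M (u \<circ> s) a v"
      unfolding tight_weak_limit_def weakly_L2_def
    proof (intro conjI allI impI)
      fix \<epsilon> :: real assume "\<epsilon> > 0"
      moreover have "(LINT x:ball (a i *\<^sub>R e3) L|lebesgue. (u \<circ> s) i x) = (LINT x|lborel. w (s i) x * indicator (ball (a i *\<^sub>R e3) L) x)" for i L
        by (rule set_integral_rep) (use ae[of "s i"] in auto)
      ultimately show "\<exists>L>0. \<forall>i. M - \<epsilon> \<le> (LINT x:ball (a i *\<^sub>R e3) L|lebesgue. (u \<circ> s) i x)"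
        using t by simp
    next
      fix i
      have "adm \<RR> (\<lambda>x. w (s i) (x + a i *\<^sub>R e3))" by (rule adm_shift[OF w(1)])
      then show "in_Lp 2 (\<lambda>x. (u \<circ> s) i (x + a i *\<^sub>R e3))"
        by (intro in_Lp_2I[OF admD(1) admD(5) aes])
    next
      show "in_Lp 2 v" by (rule in_Lp_2I[OF admD(1,5)[OF v(1)]]) simp
    next
      fix g assume "in_Lp 2 g"
      then obtain h where h: "h \<in> borel_measurable borel" "integrable lborel (\<lambda>x. (h x)\<^sup>2)" "AE x in lborel. g x = h x"
        by (rule in_Lp_2_Borel_rep)
      have "(LINT x|lebesgue. (u \<circ> s) i (x + a i *\<^sub>R e3) * g x) = (LINT x|lborel. w (s i) (x + a i *\<^sub>R e3) * h x)" for i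
        by (rule integral_AE_eq_mult[OF _ h(1) aes h(3)]) simp
      moreover have "(LINT x|lebesgue. v x * g x) = (LINT x|lborel. v x * h x)"
        by (rule integral_AE_eq_mult[OF _ h(1) _ h(3)]) simp_all
      ultimately show "(\<lambda>i. LINT x|lebesgue. (u \<circ> s) i (x + a i *\<^sub>R e3) * g x) \<longlonglongrightarrow> (LINT x|lebesgue. v x * g x)"
        using weak[OF h(1,2)] by simp
    qed
    moreover have "v \<in> ?S" using adm_in_W_star[OF v(1,2)] v(3) by simp
    ultimately show ?thesis using s by blast
  qed
  have part3: "minimizer_on ?E ?S v"
    if u: "minimizing_sequence ?E ?S u" and s: "strict_mono s" and v: "v \<in> ?S" and t: "tight_weak_limit M (u \<circ> s) a v" for u a s v
  proof -
    have uS: "\<And>i. u i \<in> ?S" and ul: "(\<lambda>i. ?E (u i)) \<longlonglongrightarrow> I"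
      using u I(1) by (auto simp: minimizing_sequence_def)
    have "\<exists>w. adm \<RR> w \<and> axisymmetric w \<and> mass w = M \<and> (AE x in lborel. u (s i) x = w x) \<and> ?E (u (s i)) = K.en w" for i
      by (rule rep[OF uS])
    then obtain w where w: "\<And>i. adm \<RR> (w i)" "\<And>i. axisymmetric (w i)" "\<And>i. mass (w i) = M"
      and ae: "\<And>i. AE x in lborel. u (s i) x = w i x" and e: "\<And>i. ?E (u (s i)) = K.en (w i)"
      by metis
    obtain v' where v': "adm \<RR> v'" and aev: "AE x in lborel. v x = v' x" and ev: "?E v = K.en v'"
      using rep[OF v] by blast
    note [measurable] = admD(1)[OF w(1)] admD(1)[OF v']
    have "K.en v' \<le> I"
    proof (rule limit_minimizes[OF w(1,3) v'])
      show "(\<lambda>i. K.en (w i)) \<longlonglongrightarrow> I"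
        using LIMSEQ_subseq_LIMSEQ[OF ul s] by (simp add: o_def e)
      show "\<exists>L>0. \<forall>i. M - \<epsilon> \<le> (LINT x|lborel. w i x * indicator (ball (a i *\<^sub>R e3) L) x)" if "\<epsilon> > 0" for \<epsilon>
      proof -
        have "(LINT x:ball (a i *\<^sub>R e3) L|lebesgue. (u \<circ> s) i x) = (LINT x|lborel. w i x * indicator (ball (a i *\<^sub>R e3) L) x)" for i L
          by (rule set_integral_rep) (use ae[of i] in auto)
        then show ?thesis using t that by (simp add: tight_weak_limit_def)
      qed
      fix g :: "real^3 \<Rightarrow> real" assume g: "g \<in> borel_measurable borel" "integrable lborel (\<lambda>x. (g x)\<^sup>2)"
      have "in_Lp 2 g" by (rule in_Lp_2I[OF g]) simp
      then have "(\<lambda>i. LINT x|lebesgue. (u \<circ> s) i (x + a i *\<^sub>R e3) * g x) \<longlonglongrightarrow> (LINT x|lebesgue. v x * g x)"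
        using t by (simp add: tight_weak_limit_def weakly_L2_def)
      moreover have "(LINT x|lebesgue. (u \<circ> s) i (x + a i *\<^sub>R e3) * g x) = (LINT x|lborel. w i (x + a i *\<^sub>R e3) * g x)" for i
        by (rule integral_AE_eq_mult[OF _ g(1)]) (use AE_translate[OF ae[of i]] in auto)
      moreover have "(LINT x|lebesgue. v x * g x) = (LINT x|lborel. v' x * g x)"
        by (rule integral_AE_eq_mult[OF _ g(1) aev]) simp_all
      ultimately show "(\<lambda>i. LINT x|lborel. w i (x + a i *\<^sub>R e3) * g x) \<longlonglongrightarrow> (LINT x|lborel. v' x * g x)" by simp
    qed
    then show ?thesis unfolding minimizer_on_def using v ev I_min order_trans by metis
  qed
  show "(inf_on ?E ?S < 0 \<and>
     (\<exists>C\<^sub>1>0. \<exists>C\<^sub>2>0. \<forall>\<rho>\<in>?S. ?E \<rho> \<ge> C\<^sub>1 * (LINT x|lebesgue. (\<rho> x)\<^sup>2) - C\<^sub>2)) \<and>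
    (\<forall>u. minimizing_sequence ?E ?S u \<longrightarrow>
       (\<exists>a s. strict_mono s \<and> (\<exists>v\<in>?S. tight_weak_limit M (u \<circ> s) a v))) \<and>
    (\<forall>u a s v. minimizing_sequence ?E ?S u \<and> strict_mono s \<and>
       v \<in> ?S \<and> tight_weak_limit M (u \<circ> s) a v \<longrightarrow> minimizer_on ?E ?S v)"
    using part1 part2 part3 by blast
qed

end
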